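(* Squashed entanglement $E_{sq}$ is an entanglement monotone. That is: (a) it does not increase under local operations and classical communication: for every state $\rho^{AB}$ on a finite-dimensional bipartite Hilbert space $\mathcal{H}_A\otimes\mathcal{H}_B$ and every LOCC operation $\Lambda$ taking states on $\mathcal{H}_A\otimes\mathcal{H}_B$ to states on a finite-dimensional bipartite space $\mathcal{H}_{\tilde A}\otimes\mathcal{H}_{\tilde B}$, one has $E_{sq}(\Lambda(\rho^{AB}))\le E_{sq}(\rho^{AB})$; (b) it is convex: for all states $\rho^{AB},\sigma^{AB}$ on the same space $\mathcal{H}_A\otimes\mathcal{H}_B$ and all $0\le\lambda\le 1$, $$E_{sq}\left(\lambda\rho^{AB}+(1-\lambda)\sigma^{AB}\right)\le \lambda E_{sq}(\rho^{AB})+(1-\lambda)E_{sq}(\sigma^{AB}).$$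
   Context: All Hilbert spaces are finite dimensional; a state is a density operator (positive semidefinite, trace one). For a state $\rho$ on a tensor product of systems, $\rho^X$ denotes its reduced state (partial trace) on the subsystem $X$, and $S(X)=S(\rho^X)=-\operatorname{Tr}\rho^X\log\rho^X$ is the von Neumann entropy ($\log$ to base 2). For a tripartite state $\rho^{ABE}$ the quantum conditional mutual information is $I(A;B|E)=S(AE)+S(BE)-S(ABE)-S(E)$. The squashed entanglement of a state $\rho^{AB}$ on $\mathcal{H}_A\otimes\mathcal{H}_B$ is $$E_{sq}(\rho^{AB})=\inf\left\{\tfrac12 I(A;B|E)\;:\;\rho^{ABE}\text{ a state on }\mathcal{H}_A\otimes\mathcal{H}_B\otimes\mathcal{H}_E\text{ with }\operatorname{Tr}_E\rho^{ABE}=\rho^{AB}\right\},$$ where the infimum is over all extensions $\rho^{ABE}$, with $\mathcal{H}_E$ of arbitrary (a priori unbounded) finite dimension. An LOCC operation with respect to the cut between parties $A$ and $B$ is a completely positive trace-preserving map obtained by finitely many rounds, in each of which one party applies to its own system a quantum instrument (a finite family of completely positive maps $(\mathcal{E}_k)$, possibly changing that party's Hilbert space, whose sum is trace preserving) and communicates the outcome $k$ to the other party, where the instrument used may depend on all earlier outcomes; at the end the outcome record may be discarded (the output is the sum over outcomes). *)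

theory Defs
  imports "Jordan_Normal_Form.Schur_Decomposition" "HOL.Transcendental"
begin

text \<open>
  Operators on a Hilbert space of dimension \<open>n\<close> are complex \<open>n \<times> n\<close> matrices.  In a tensor product
  of spaces of dimensions \<open>p\<close>, \<open>n\<close>, \<open>q\<close> (in this order) the basis vector
  \<open>e\<^sub>a \<otimes> e\<^sub>i \<otimes> e\<^sub>c\<close> has index \<open>(a * n + i) * q + c\<close>.  This numbering is associative, so factors may be
  grouped freely by multiplying their dimensions; a factor of dimension 1 can be left out.
\<close>

definition tidx :: "nat \<Rightarrow> nat \<Rightarrow> nat \<Rightarrow> nat \<Rightarrow> nat \<Rightarrow> nat" where
  "tidx n q a i c = (a * n + i) * q + c"

section \<open>States\<close>

definition mtrace :: "complex mat \<Rightarrow> complex" where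
  "mtrace M = (\<Sum>i<dim_row M. M $$ (i, i))"

text \<open>The order on the complex numbers makes \<open>0 \<le> z\<close> mean that \<open>z\<close> is real and nonnegative;
  over the complex field this forces \<open>M\<close> to be Hermitian.\<close>

definition psd :: "nat \<Rightarrow> complex mat \<Rightarrow> bool" where
  "psd n M \<longleftrightarrow> M \<in> carrier_mat n n \<and> (\<forall>v \<in> carrier_vec n. 0 \<le> (M *\<^sub>v v) \<bullet>c v)"

definition state :: "nat \<Rightarrow> complex mat \<Rightarrow> bool" where
  "state n \<rho> \<longleftrightarrow> psd n \<rho> \<and> mtrace \<rho> = 1"

text \<open>Partial trace over the middle factor of dimension \<open>n\<close>:\<close>

definition ptrace :: "nat \<Rightarrow> nat \<Rightarrow> nat \<Rightarrow> complex mat \<Rightarrow> complex mat" where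
  "ptrace p n q M = mat (p * q) (p * q)
     (\<lambda>(x, y). \<Sum>k<n. M $$ (tidx n q (x div q) k (x mod q), tidx n q (y div q) k (y mod q)))"

section \<open>Entropy and squashed entanglement\<close>

text \<open>\<open>f(M)\<close> for Hermitian \<open>M\<close>; the matrix is independent of the chosen spectral decomposition.\<close>

definition herm_fun :: "(real \<Rightarrow> real) \<Rightarrow> complex mat \<Rightarrow> complex mat" where
  "herm_fun f M = (THE L. \<exists>U d. let n = dim_row M in
      U \<in> carrier_mat n n \<and> U * mat_adjoint U = 1\<^sub>m n \<and>
      M = U * mat_diag n (\<lambda>i. complex_of_real (d i)) * mat_adjoint U \<and>
      L = U * mat_diag n (\<lambda>i. complex_of_real (f (d i))) * mat_adjoint U)"

text \<open>The value of \<open>log 2 0\<close> does not matter, since \<open>log \<rho>\<close> is multiplied by \<open>\<rho>\<close>.\<close>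

definition entropy :: "complex mat \<Rightarrow> real" where
  "entropy \<rho> = - Re (mtrace (\<rho> * herm_fun (log 2) \<rho>))"

text \<open>\<open>I(A;B|E)\<close> of an operator on the product of spaces of dimensions \<open>dA\<close>, \<open>dB\<close>, \<open>dE\<close>:\<close>

definition cond_mutual_info :: "nat \<Rightarrow> nat \<Rightarrow> nat \<Rightarrow> complex mat \<Rightarrow> real" where
  "cond_mutual_info dA dB dE \<rho> =
     entropy (ptrace dA dB dE \<rho>) + entropy (ptrace 1 dA (dB * dE) \<rho>)
     - entropy \<rho> - entropy (ptrace 1 (dA * dB) dE \<rho>)"

definition squashed_entanglement :: "nat \<Rightarrow> nat \<Rightarrow> complex mat \<Rightarrow> real" where
  "squashed_entanglement dA dB \<rho> =
     Inf {cond_mutual_info dA dB dE \<omega> / 2 | dE \<omega>.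
            state (dA * dB * dE) \<omega> \<and> ptrace (dA * dB) dE 1 \<omega> = \<rho>}"

section \<open>Quantum operations\<close>

text \<open>A map from operators on dimension \<open>n\<close> to operators on dimension \<open>m\<close> is a function on matrices,
  of which only the restriction to \<open>carrier_mat n n\<close> is relevant.\<close>

definition linear_map :: "nat \<Rightarrow> nat \<Rightarrow> (complex mat \<Rightarrow> complex mat) \<Rightarrow> bool" where
  "linear_map n m \<Phi> \<longleftrightarrow>
     (\<forall>M \<in> carrier_mat n n. \<Phi> M \<in> carrier_mat m m) \<and>
     (\<forall>M \<in> carrier_mat n n. \<forall>N \<in> carrier_mat n n. \<Phi> (M + N) = \<Phi> M + \<Phi> N) \<and>
     (\<forall>c. \<forall>M \<in> carrier_mat n n. \<Phi> (c \<cdot>\<^sub>m M) = c \<cdot>\<^sub>m \<Phi> M)"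

text \<open>\<open>id\<^sub>p \<otimes> \<Phi> \<otimes> id\<^sub>q\<close> for \<open>\<Phi>\<close> from dimension \<open>n\<close> to dimension \<open>m\<close>: the \<open>n \<times> n\<close> block of \<open>M\<close>
  belonging to the matrix units \<open>|a\<rangle>\<langle>b|\<close> and \<open>|c\<rangle>\<langle>d|\<close> of the outer factors is replaced by its
  image under \<open>\<Phi>\<close>.\<close>

definition tensor_map ::
  "nat \<Rightarrow> nat \<Rightarrow> nat \<Rightarrow> nat \<Rightarrow> (complex mat \<Rightarrow> complex mat) \<Rightarrow> complex mat \<Rightarrow> complex mat" where
  "tensor_map p n m q \<Phi> M = mat (p * m * q) (p * m * q)
     (\<lambda>(x, y).
        let a = x div (m * q); i = (x div q) mod m; c = x mod q;
            b = y div (m * q); j = (y div q) mod m; d = y mod q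
        in \<Phi> (mat n n (\<lambda>(k, l). M $$ (tidx n q a k c, tidx n q b l d))) $$ (i, j))"

definition completely_positive :: "nat \<Rightarrow> nat \<Rightarrow> (complex mat \<Rightarrow> complex mat) \<Rightarrow> bool" where
  "completely_positive n m \<Phi> \<longleftrightarrow> linear_map n m \<Phi> \<and>
     (\<forall>r M. psd (n * r) M \<longrightarrow> psd (m * r) (tensor_map 1 n m r \<Phi> M))"

definition trace_preserving :: "nat \<Rightarrow> (complex mat \<Rightarrow> complex mat) \<Rightarrow> bool" where
  "trace_preserving n \<Phi> \<longleftrightarrow> (\<forall>M \<in> carrier_mat n n. mtrace (\<Phi> M) = mtrace M)"

text \<open>Finite sum of \<open>m \<times> m\<close> matrices (the type of matrices of all sizes has no zero element, so
  \<open>sum\<close> is not available).\<close>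

definition msum :: "nat \<Rightarrow> nat \<Rightarrow> (nat \<Rightarrow> complex mat) \<Rightarrow> complex mat" where
  "msum m K F = mat m m (\<lambda>ij. \<Sum>k<K. F k $$ ij)"

text \<open>Instruments with outcomes \<open>k < K\<close>:\<close>

definition instrument ::
  "nat \<Rightarrow> nat \<Rightarrow> nat \<Rightarrow> (nat \<Rightarrow> complex mat \<Rightarrow> complex mat) \<Rightarrow> bool" where
  "instrument n m K \<E> \<longleftrightarrow> (\<forall>k<K. completely_positive n m (\<E> k)) \<and>
     trace_preserving n (\<lambda>M. msum m K (\<lambda>k. \<E> k M))"

text \<open>\<open>locc dA dB dA' dB' \<Lambda>\<close>: a protocol from \<open>dA \<times> dB\<close> to \<open>dA' \<times> dB'\<close> realises \<open>\<Lambda>\<close>.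
  A protocol stops, or one party applies an instrument and announces the outcome \<open>k\<close>, after which
  the remaining protocol (realising \<open>L k\<close>) may depend on \<open>k\<close>; so every instrument depends on all
  earlier outcomes.  The result is the sum over all outcome sequences.\<close>

inductive locc ::
  "nat \<Rightarrow> nat \<Rightarrow> nat \<Rightarrow> nat \<Rightarrow> (complex mat \<Rightarrow> complex mat) \<Rightarrow> bool" where
  stop: "locc dA dB dA dB (\<lambda>M. M)"
| Alice: "instrument dA d K \<E> \<Longrightarrow> (\<And>k. k < K \<Longrightarrow> locc d dB dA' dB' (L k)) \<Longrightarrow>
     locc dA dB dA' dB' (\<lambda>M. msum (dA' * dB') K (\<lambda>k. L k (tensor_map 1 dA d dB (\<E> k) M)))"
| Bob: "instrument dB d K \<E> \<Longrightarrow> (\<And>k. k < K \<Longrightarrow> locc dA d dA' dB' (L k)) \<Longrightarrow>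
     locc dA dB dA' dB' (\<lambda>M. msum (dA' * dB') K (\<lambda>k. L k (tensor_map dA dB d 1 (\<E> k) M)))"

end

theory Submission
  imports Defs "Jordan_Normal_Form.Spectral_Radius"
begin

text \<open>
  Monotonicity of the relative entropy is obtained from the spectral sums
  \<open>Q\<^sub>s(\<rho>,\<sigma>) = \<Sum>\<^sub>i\<^sub>j |\<langle>g\<^sub>j|f\<^sub>i\<rangle>|\<^sup>2 r\<^sub>i\<^sup>2 / (t\<^sub>j + s r\<^sub>i)\<close>: on the one hand \<open>Q\<^sub>s\<close> is the maximum over \<open>Y\<close> of
  \<open>2 Re Tr \<rho>Y - Tr \<sigma>YY\<^sup>* - s Tr \<rho>Y\<^sup>*Y\<close>, which by the Schwarz inequality for the adjoint of a channel
  does not increase under channels; on the other hand \<open>Q\<^sub>s\<close> is the derivative in \<open>s\<close> of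
  \<open>\<Sum>\<^sub>i\<^sub>j |\<langle>g\<^sub>j|f\<^sub>i\<rangle>|\<^sup>2 r\<^sub>i ln (t\<^sub>j + s r\<^sub>i)\<close>, which interpolates between \<open>Tr \<rho> ln \<sigma>\<close> at \<open>s = 0\<close> and, up to \<open>ln s\<close>,
  \<open>Tr \<rho> ln \<rho>\<close> as \<open>s \<longlongrightarrow> \<infinity>\<close>.

  Taking \<open>\<sigma> = 1 \<otimes> \<rho>\<^sup>E\<close> shows that \<open>S(B|E)\<close> increases under channels on \<open>E\<close>.  Since
  \<open>I(A;B|E) = S(B|E) - S(B|AE)\<close>, an instrument on \<open>A\<close> does not increase the sum over its outcomes of the
  conditional mutual informations of the unnormalised outcome states.  LOCC monotonicity then follows
  on the level of extensions, by induction on the protocol: the extensions belonging to the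
  different outcomes are combined in the direct sum of their environments, where \<open>I(A;B|E)\<close> adds up.
  The same direct sum gives convexity.
\<close>

section \<open>Vectors and kernels on finite index sets\<close>

text \<open>The number \<open>Q\<^sub>s\<close> contains no logarithm and no inverse of a singular
  operator: with s > 0 every denominator with r_i > 0 is positive. Comparing two such numbers then
  takes only the completion of a square for each pair of eigenvectors, and the logarithm enters
  afterwards through calculus in one real variable. The second argument of the relative entropy has
  to be an arbitrary positive operator, because 1 \<otimes> \<rho> is not normalised. For an
  instrument on A the two conditional entropies behave differently. In S(B|AE) the outcome is kept:
  the instrument becomes a channel that writes it into a classical register next to A E. In S(B|E)
  the outcome operators on B E add up to the original one, so concavity is what is needed, and this
  is strong subadditivity for the register. An instrument on B is reduced to this case by exchanging
  A and B. Different branches of a protocol may end with environments of different dimensions. The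
  direct sum accommodates them without padding, and since the infimum runs over all dimensions it is
  again admissible.\<close>

text \<open>Operators are represented by kernels \<open>\<rho> x y\<close> with \<open>x\<close>, \<open>y\<close> in a finite index set of any type; only the
  values there matter.  Tensor products then correspond to products of index sets, and regrouping or
  exchanging factors to a bijection of index sets.\<close>

definition ip :: "'a set \<Rightarrow> ('a \<Rightarrow> complex) \<Rightarrow> ('a \<Rightarrow> complex) \<Rightarrow> complex" where
  "ip I u v = (\<Sum>x\<in>I. cnj (u x) * v x)"

definition app :: "'a set \<Rightarrow> ('b \<Rightarrow> 'a \<Rightarrow> complex) \<Rightarrow> ('a \<Rightarrow> complex) \<Rightarrow> 'b \<Rightarrow> complex" where
  "app I A v x = (\<Sum>y\<in>I. A x y * v y)"

definition nrm2 :: "'a set \<Rightarrow> ('a \<Rightarrow> complex) \<Rightarrow> real" where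
  "nrm2 I v = (\<Sum>x\<in>I. (cmod (v x))\<^sup>2)"

text \<open>The basis is indexed by the set it lives on, and the two clauses say that the matrix of
  \<open>e\<close> is unitary from either side. Expansion in the basis therefore needs no dimension
  count.\<close>

definition onb :: "'a set \<Rightarrow> ('a \<Rightarrow> 'a \<Rightarrow> complex) \<Rightarrow> bool" where
  "onb I e \<longleftrightarrow> (\<forall>j\<in>I. \<forall>k\<in>I. ip I (e j) (e k) = (if j = k then 1 else 0)) \<and>
     (\<forall>x\<in>I. \<forall>y\<in>I. (\<Sum>j\<in>I. e j x * cnj (e j y)) = (if x = y then 1 else 0))"

definition spectral ::
  "'a set \<Rightarrow> ('a \<Rightarrow> 'a \<Rightarrow> complex) \<Rightarrow> ('a \<Rightarrow> 'a \<Rightarrow> complex) \<Rightarrow> ('a \<Rightarrow> real) \<Rightarrow> bool" where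
  "spectral I \<rho> e r \<longleftrightarrow> onb I e \<and>
     (\<forall>x\<in>I. \<forall>y\<in>I. \<rho> x y = (\<Sum>j\<in>I. complex_of_real (r j) * e j x * cnj (e j y)))"

definition herm :: "'a set \<Rightarrow> ('a \<Rightarrow> 'a \<Rightarrow> complex) \<Rightarrow> bool" where
  "herm I \<rho> \<longleftrightarrow> (\<forall>x\<in>I. \<forall>y\<in>I. cnj (\<rho> x y) = \<rho> y x)"

definition pos :: "'a set \<Rightarrow> ('a \<Rightarrow> 'a \<Rightarrow> complex) \<Rightarrow> bool" where
  "pos I \<rho> \<longleftrightarrow> (\<forall>v. 0 \<le> ip I v (app I \<rho> v))"

lemma ip_cong: "(\<And>x. x \<in> I \<Longrightarrow> u x = u' x) \<Longrightarrow> (\<And>x. x \<in> I \<Longrightarrow> v x = v' x) \<Longrightarrow> ip I u v = ip I u' v'"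
  unfolding ip_def by (rule sum.cong) auto

lemma cnj_ip: "cnj (ip I u v) = ip I v u"
  unfolding ip_def cnj_sum by (rule sum.cong) (auto simp: mult.commute)

lemma ip_self: "ip I v v = of_real (nrm2 I v)"
  unfolding ip_def nrm2_def of_real_sum
  by (rule sum.cong) (simp_all only: complex_norm_square mult.commute)

lemma nrm2_nonneg: "0 \<le> nrm2 I v"
  unfolding nrm2_def by (simp add: sum_nonneg)

lemma ip_sum_right: "ip I u (\<lambda>x. \<Sum>k\<in>K. c k * f k x) = (\<Sum>k\<in>K. c k * ip I u (f k))"
  unfolding ip_def sum_distrib_left by (subst sum.swap) (simp add: mult.left_commute)

lemma ip_sum_left: "ip I (\<lambda>x. \<Sum>k\<in>K. c k * f k x) u = (\<Sum>k\<in>K. cnj (c k) * ip I (f k) u)"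
  unfolding ip_def cnj_sum sum_distrib_left sum_distrib_right
  by (subst sum.swap) (simp add: mult.left_commute mult.assoc)

lemma ip_scale_right: "ip I u (\<lambda>x. c * v x) = c * ip I u v"
  unfolding ip_def sum_distrib_left by (simp add: mult.left_commute)

lemma app_cong: "(\<And>x. x \<in> I \<Longrightarrow> v x = v' x) \<Longrightarrow> app I A v = app I A v'"
  unfolding app_def by (intro ext sum.cong) auto

lemma app_sum: "app I A (\<lambda>x. \<Sum>k\<in>K. c k * f k x) y = (\<Sum>k\<in>K. c k * app I A (f k) y)"
  unfolding app_def sum_distrib_left by (subst sum.swap) (simp add: mult.left_commute)

lemma ip_app_adjoint:
  "ip I u (app J A v) = ip J (app I (\<lambda>y x. cnj (A x y)) u) v"
  unfolding ip_def app_def cnj_sum sum_distrib_left sum_distrib_right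
  by (subst sum.swap) (simp add: mult.left_commute mult.assoc mult.commute)

lemma hermD: "herm I \<rho> \<Longrightarrow> x \<in> I \<Longrightarrow> y \<in> I \<Longrightarrow> cnj (\<rho> x y) = \<rho> y x"
  unfolding herm_def by simp

lemma ip_app_herm: "herm I \<rho> \<Longrightarrow> ip I u (app I \<rho> v) = ip I (app I \<rho> u) v"
  by (subst ip_app_adjoint, intro ip_cong) (auto simp: app_def hermD intro!: sum.cong)

lemma onb_ip: "onb I e \<Longrightarrow> j \<in> I \<Longrightarrow> k \<in> I \<Longrightarrow> ip I (e j) (e k) = (if j = k then 1 else 0)"
  unfolding onb_def by blast

lemma onb_complete:
  "onb I e \<Longrightarrow> x \<in> I \<Longrightarrow> y \<in> I \<Longrightarrow> (\<Sum>j\<in>I. e j x * cnj (e j y)) = (if x = y then 1 else 0)"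
  unfolding onb_def by blast

lemma onb_expand:
  assumes "finite I" "onb I e" "x \<in> I"
  shows "v x = (\<Sum>j\<in>I. ip I (e j) v * e j x)"
proof -
  have "(\<Sum>j\<in>I. ip I (e j) v * e j x) = (\<Sum>y\<in>I. (\<Sum>j\<in>I. e j x * cnj (e j y)) * v y)"
    unfolding ip_def sum_distrib_right by (subst sum.swap) (simp add: mult_ac)
  also have "\<dots> = (\<Sum>y\<in>I. if x = y then v y else 0)"
    by (rule sum.cong) (use onb_complete[OF assms(2,3)] in auto)
  finally show ?thesis using assms by simp
qed

lemma parseval:
  assumes "finite I" "onb I e"
  shows "(\<Sum>j\<in>I. cnj (ip I (e j) u) * ip I (e j) v) = ip I u v"
proof -
  have "ip I u v = ip I (\<lambda>x. \<Sum>j\<in>I. ip I (e j) u * e j x) v"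
    by (rule ip_cong) (simp_all add: onb_expand[OF assms, symmetric])
  then show ?thesis unfolding ip_sum_left by simp
qed

lemma parseval_nrm2:
  assumes "finite I" "onb I e"
  shows "(\<Sum>j\<in>I. (cmod (ip I (e j) v))\<^sup>2) = nrm2 I v"
proof -
  have "complex_of_real (\<Sum>j\<in>I. (cmod (ip I (e j) v))\<^sup>2) = (\<Sum>j\<in>I. cnj (ip I (e j) v) * ip I (e j) v)"
    unfolding of_real_sum by (rule sum.cong) (simp_all only: complex_norm_square mult.commute)
  also have "\<dots> = of_real (nrm2 I v)" unfolding parseval[OF assms] ip_self ..
  finally have "complex_of_real (\<Sum>j\<in>I. (cmod (ip I (e j) v))\<^sup>2) = of_real (nrm2 I v)" .
  then show ?thesis by (simp only: of_real_eq_iff)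
qed

section \<open>Spectral decompositions and what does not depend on their choice\<close>

lemma spectral_onb: "spectral I \<rho> e r \<Longrightarrow> onb I e"
  unfolding spectral_def by blast

lemma spectral_eq:
  "spectral I \<rho> e r \<Longrightarrow> x \<in> I \<Longrightarrow> y \<in> I \<Longrightarrow> \<rho> x y = (\<Sum>j\<in>I. complex_of_real (r j) * e j x * cnj (e j y))"
  unfolding spectral_def by blast

lemma spectral_app:
  assumes "spectral I \<rho> e r" "x \<in> I"
  shows "app I \<rho> v x = (\<Sum>j\<in>I. complex_of_real (r j) * ip I (e j) v * e j x)"
proof -
  have "app I \<rho> v x = (\<Sum>y\<in>I. (\<Sum>j\<in>I. complex_of_real (r j) * e j x * cnj (e j y)) * v y)"
    unfolding app_def by (rule sum.cong) (use spectral_eq[OF assms] in auto)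
  also have "\<dots> = (\<Sum>j\<in>I. complex_of_real (r j) * ip I (e j) v * e j x)"
    unfolding ip_def sum_distrib_right sum_distrib_left by (subst sum.swap) (simp add: mult_ac)
  finally show ?thesis .
qed

lemma spectral_eigen:
  assumes "finite I" "spectral I \<rho> e r" "x \<in> I" "j \<in> I"
  shows "app I \<rho> (e j) x = r j * e j x"
proof -
  have "app I \<rho> (e j) x = (\<Sum>k\<in>I. if k = j then r j * e j x else 0)"
    unfolding spectral_app[OF assms(2,3)]
    by (rule sum.cong) (use onb_ip[OF spectral_onb[OF assms(2)] _ assms(4)] in auto)
  then show ?thesis using assms by simp
qed

lemma spectralI:
  assumes "finite I" "onb I e" "\<And>j x. j \<in> I \<Longrightarrow> x \<in> I \<Longrightarrow> app I \<rho> (e j) x = complex_of_real (r j) * e j x"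
  shows "spectral I \<rho> e r"
  unfolding spectral_def
proof (intro conjI ballI)
  show "onb I e" by fact
  fix x y assume x: "x \<in> I" and y: "y \<in> I"
  have "(\<Sum>j\<in>I. complex_of_real (r j) * e j x * cnj (e j y)) = (\<Sum>j\<in>I. app I \<rho> (e j) x * cnj (e j y))"
    by (rule sum.cong) (use assms(3) x in auto)
  also have "\<dots> = (\<Sum>z\<in>I. \<rho> x z * (\<Sum>j\<in>I. e j z * cnj (e j y)))"
    unfolding app_def sum_distrib_right sum_distrib_left by (subst sum.swap) (simp add: mult_ac)
  also have "\<dots> = (\<Sum>z\<in>I. if z = y then \<rho> x y else 0)"
    by (rule sum.cong) (use onb_complete[OF assms(2) _ y] in auto)
  finally show "\<rho> x y = (\<Sum>j\<in>I. complex_of_real (r j) * e j x * cnj (e j y))"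
    using assms(1) y by simp
qed

text \<open>The matrix element of \<open>\<rho>\<close> between \<open>e' k\<close> and
  \<open>e j\<close> is computed twice, once with each decomposition; the overlap gets multiplied by
  \<open>r j\<close> and by \<open>r' k\<close>.\<close>

lemma spectral_overlap:
  assumes I: "finite I" and s: "spectral I \<rho> e r" and s': "spectral I \<rho> e' r'"
    and j: "j \<in> I" and k: "k \<in> I"
  shows "ip I (e' k) (e j) = 0 \<or> r j = r' k"
proof -
  have "ip I (e' k) (app I \<rho> (e j)) = r j * ip I (e' k) (e j)"
    by (subst ip_scale_right[symmetric]) (use spectral_eigen[OF I s _ j] in \<open>auto intro!: ip_cong\<close>)
  moreover have "ip I (e' k) (app I \<rho> (e j)) =
      ip I (e' k) (\<lambda>x. \<Sum>m\<in>I. complex_of_real (r' m) * ip I (e' m) (e j) * e' m x)"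
    by (rule ip_cong) (use spectral_app[OF s'] in auto)
  moreover have "\<dots> = (\<Sum>m\<in>I. if m = k then r' k * ip I (e' k) (e j) else 0)"
    unfolding ip_sum_right by (rule sum.cong) (use onb_ip[OF spectral_onb[OF s'] k] in auto)
  ultimately have "complex_of_real (r j) * ip I (e' k) (e j) = r' k * ip I (e' k) (e j)"
    using I k by (simp, metis)
  then show ?thesis by (auto dest: sym)
qed

text \<open>The squared overlaps of the two bases have row and column sums 1 by Parseval and vanish
  unless the eigenvalues agree, so the double sum weighted with them collapses to either
  side.\<close>

lemma spectral_sum_unique:
  fixes \<phi> :: "real \<Rightarrow> real"
  assumes I: "finite I" and s: "spectral I \<rho> e r" and s': "spectral I \<rho> e' r'"
  shows "(\<Sum>j\<in>I. \<phi> (r j)) = (\<Sum>j\<in>I. \<phi> (r' j))"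
proof -
  note o = spectral_onb[OF s] and o' = spectral_onb[OF s']
  have eq: "\<phi> (r j) * (cmod (ip I (e' k) (e j)))\<^sup>2 = \<phi> (r' k) * (cmod (ip I (e j) (e' k)))\<^sup>2"
    if j: "j \<in> I" and k: "k \<in> I" for j k
  proof -
    have "cmod (ip I (e j) (e' k)) = cmod (ip I (e' k) (e j))"
      by (metis cnj_ip complex_mod_cnj)
    then show ?thesis using spectral_overlap[OF I s s' j k] by auto
  qed
  have n: "nrm2 I (e j) = 1" if "j \<in> I" for j
    using onb_ip[OF o that that] unfolding ip_self by simp
  have n': "nrm2 I (e' j) = 1" if "j \<in> I" for j
    using onb_ip[OF o' that that] unfolding ip_self by simp
  have "(\<Sum>j\<in>I. \<phi> (r j)) = (\<Sum>j\<in>I. \<Sum>k\<in>I. \<phi> (r j) * (cmod (ip I (e' k) (e j)))\<^sup>2)"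
    unfolding sum_distrib_left[symmetric] parseval_nrm2[OF I o'] by (simp add: n)
  also have "\<dots> = (\<Sum>k\<in>I. \<Sum>j\<in>I. \<phi> (r' k) * (cmod (ip I (e j) (e' k)))\<^sup>2)"
    by (subst sum.swap) (auto intro!: sum.cong eq)
  also have "\<dots> = (\<Sum>j\<in>I. \<phi> (r' j))"
    unfolding sum_distrib_left[symmetric] parseval_nrm2[OF I o] by (simp add: n')
  finally show ?thesis .
qed

lemma onb_compose:
  assumes I: "finite I" and E: "onb I E" and g: "onb I g"
  shows "onb I (\<lambda>j x. \<Sum>k\<in>I. E j k * g k x)"
  unfolding onb_def
proof (intro conjI ballI)
  fix j l assume j: "j \<in> I" and l: "l \<in> I"
  have "ip I (\<lambda>x. \<Sum>k\<in>I. E j k * g k x) (\<lambda>x. \<Sum>k\<in>I. E l k * g k x) =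
      (\<Sum>k\<in>I. \<Sum>m\<in>I. if m = k then cnj (E j k) * E l k else 0)"
    unfolding ip_sum_left ip_sum_right sum_distrib_left
    by (intro sum.cong refl) (use onb_ip[OF g] in auto)
  also have "\<dots> = ip I (E j) (E l)" unfolding ip_def using I by (auto intro!: sum.cong)
  finally show "ip I (\<lambda>x. \<Sum>k\<in>I. E j k * g k x) (\<lambda>x. \<Sum>k\<in>I. E l k * g k x) = (if j = l then 1 else 0)"
    using onb_ip[OF E j l] by simp
next
  fix x y assume x: "x \<in> I" and y: "y \<in> I"
  have "(\<Sum>j\<in>I. (\<Sum>k\<in>I. E j k * g k x) * cnj (\<Sum>k\<in>I. E j k * g k y)) =
      (\<Sum>j\<in>I. \<Sum>k\<in>I. \<Sum>m\<in>I. g k x * cnj (g m y) * (E j k * cnj (E j m)))"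
    unfolding cnj_sum sum_distrib_left sum_distrib_right
    by (rule sum.cong[OF refl], subst sum.swap) (simp add: mult_ac)
  also have "\<dots> = (\<Sum>k\<in>I. \<Sum>m\<in>I. g k x * cnj (g m y) * (\<Sum>j\<in>I. E j k * cnj (E j m)))"
    unfolding sum_distrib_left by (subst sum.swap, rule sum.cong[OF refl], subst sum.swap) simp
  also have "\<dots> = (\<Sum>k\<in>I. \<Sum>m\<in>I. if m = k then g k x * cnj (g k y) else 0)"
    by (intro sum.cong refl) (use onb_complete[OF E] in auto)
  also have "\<dots> = (\<Sum>k\<in>I. g k x * cnj (g k y))" using I by (auto intro!: sum.cong)
  finally show "(\<Sum>j\<in>I. (\<Sum>k\<in>I. E j k * g k x) * cnj (\<Sum>k\<in>I. E j k * g k y)) = (if x = y then 1 else 0)"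
    using onb_complete[OF g x y] by simp
qed

text \<open>Eigenvectors of the matrix of \<open>\<rho>\<close> in the basis \<open>g\<close> are
  coordinate vectors; expanding them in \<open>g\<close> gives eigenvectors of \<open>\<rho>\<close>
  itself.\<close>

lemma spectral_change_basis:
  assumes I: "finite I" and g: "onb I g"
    and s: "spectral I (\<lambda>j k. ip I (g j) (app I \<rho> (g k))) E r"
  shows "spectral I \<rho> (\<lambda>j x. \<Sum>k\<in>I. E j k * g k x) r"
proof (rule spectralI[OF I onb_compose[OF I spectral_onb[OF s] g]])
  fix j x assume j: "j \<in> I" and x: "x \<in> I"
  let ?f = "\<lambda>x. \<Sum>k\<in>I. E j k * g k x"
  have "app I \<rho> ?f x = (\<Sum>l\<in>I. ip I (g l) (app I \<rho> ?f) * g l x)"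
    by (rule onb_expand[OF I g x])
  also have "\<dots> = (\<Sum>l\<in>I. r j * E j l * g l x)"
  proof (rule sum.cong[OF refl])
    fix l assume l: "l \<in> I"
    have "ip I (g l) (app I \<rho> ?f) = ip I (g l) (\<lambda>y. \<Sum>k\<in>I. E j k * app I \<rho> (g k) y)"
      by (rule ip_cong) (simp_all add: app_sum)
    also have "\<dots> = app I (\<lambda>j k. ip I (g j) (app I \<rho> (g k))) (E j) l"
      unfolding ip_sum_right app_def[of _ _ "E j"] by (simp add: mult.commute)
    also have "\<dots> = r j * E j l" by (rule spectral_eigen[OF I s l j])
    finally show "ip I (g l) (app I \<rho> ?f) * g l x = r j * E j l * g l x" by simp
  qed
  also have "\<dots> = r j * ?f x" unfolding sum_distrib_left by (simp add: mult.assoc)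
  finally show "app I \<rho> ?f x = r j * ?f x" .
qed

lemma spectral_cong:
  "spectral I \<rho> e r \<Longrightarrow> (\<And>x y. x \<in> I \<Longrightarrow> y \<in> I \<Longrightarrow> \<rho> x y = \<rho>' x y) \<Longrightarrow> spectral I \<rho>' e r"
  unfolding spectral_def by metis

lemma spectral_union:
  assumes fin: "finite I" "finite J" and dis: "I \<inter> J = {}"
    and s1: "spectral I \<rho> e r" and s2: "spectral J \<rho> f t"
    and z: "\<And>x y. x \<in> I \<Longrightarrow> y \<in> J \<Longrightarrow> \<rho> x y = 0" "\<And>x y. x \<in> I \<Longrightarrow> y \<in> J \<Longrightarrow> \<rho> y x = 0"
  shows "spectral (I \<union> J) \<rho>
    (\<lambda>j x. if j \<in> I then if x \<in> I then e j x else 0 else if x \<in> I then 0 else f j x)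
    (\<lambda>j. if j \<in> I then r j else t j)"
proof -
  have J: "\<And>x. x \<in> J \<Longrightarrow> x \<notin> I" using dis by auto
  have S: "sum h (I \<union> J) = sum h I + sum h J" for h :: "'a \<Rightarrow> complex"
    by (rule sum.union_disjoint[OF fin dis])
  note o = onb_ip[OF spectral_onb[OF s1], unfolded ip_def] onb_complete[OF spectral_onb[OF s1]]
    onb_ip[OF spectral_onb[OF s2], unfolded ip_def] onb_complete[OF spectral_onb[OF s2]]
    spectral_eq[OF s1] spectral_eq[OF s2]
  show ?thesis
    unfolding spectral_def onb_def ip_def
    by (auto simp: S J o z)
qed

lemma spectral_singleton:
  "spectral {a} \<rho> (\<lambda>_ _. 1) (\<lambda>_. c)" if "\<rho> a a = complex_of_real c"
  using that by (auto simp: spectral_def onb_def ip_def)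

section \<open>Existence of spectral decompositions\<close>

lemma householder_orthogonal:
  assumes I: "finite I" and jk: "j \<in> I" "k \<in> I" and q: "q \<noteq> 0" "(\<Sum>z\<in>I. w z * cnj (w z)) = 2 * q"
  shows "(\<Sum>z\<in>I. ((if z = j then 1 else 0) - cnj (w z) * w j / q) *
      ((if z = k then 1 else 0) - w z * cnj (w k) / q)) = (if j = k then 1 else (0::complex))"
proof -
  have "(\<Sum>z\<in>I. ((if z = j then 1 else 0) - cnj (w z) * w j / q) *
      ((if z = k then 1 else 0) - w z * cnj (w k) / q)) =
    (\<Sum>z\<in>I. (if z = j then if j = k then 1 else 0 else 0) - (if z = j then w j * cnj (w k) / q else 0)
      - (if z = k then w j * cnj (w k) / q else 0) + (w z * cnj (w z)) * (w j * cnj (w k) / q\<^sup>2))"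
    by (rule sum.cong) (auto simp: algebra_simps power2_eq_square)
  also have "\<dots> = (if j = k then 1 else 0)"
    unfolding sum.distrib sum_subtractf sum_distrib_right[symmetric] q(2)
    using I jk q(1) by (auto simp: field_simps power2_eq_square)
  finally show ?thesis .
qed

text \<open>A single Householder reflection 1 - |w><w| / q, with q half the squared norm of w, sends
  the standard basis vector at \<open>a\<close> to \<open>v\<close> up to a phase; its columns,
  multiplied by that phase, are the basis.\<close>

lemma onb_extend:
  assumes I: "finite I" and a: "a \<in> I" and v: "ip I v v = 1"
  obtains g where "onb I g" "\<And>x. x \<in> I \<Longrightarrow> g a x = v x"
proof -
  define p where "p = cmod (v a)"
  \<comment> \<open>The phase of \<open>v a\<close> is split off, so that \<open>u\<close> below has
    a nonnegative real entry at \<open>a\<close>.\<close>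
  define \<omega> where "\<omega> = (if v a = 0 then 1 else v a / p)"
  have \<omega>: "\<omega> * cnj \<omega> = 1" "cnj \<omega> * \<omega> = 1"
    unfolding \<omega>_def p_def complex_norm_square[symmetric] mult.commute[of "cnj _"]
    by (auto simp: norm_divide)
  have va: "cnj \<omega> * v a = p"
  proof (cases "v a = 0")
    case False
    have "cnj (v a) * v a = p * p"
      unfolding p_def by (simp only: mult.commute[of "cnj _"] complex_norm_square[symmetric] power2_eq_square of_real_mult)
    then show ?thesis using False unfolding \<omega>_def by (simp add: p_def)
  qed (simp add: p_def)
  define u where "u = (\<lambda>x. cnj \<omega> * v x)"
  \<comment> \<open>With the plus sign the reflection sends the basis vector at \<open>a\<close> to
    \<open>- u\<close>, and half the squared norm of \<open>w\<close> is 1 + p, which cannot vanish.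
    The factor \<open>- \<omega>\<close> in \<open>g\<close> then turns \<open>- u\<close> into
    \<open>v\<close>.\<close>
  define w where "w = (\<lambda>x. u x + (if x = a then 1 else 0))"
  define q :: complex where "q = 1 + p"
  have q0: "q \<noteq> 0"
  proof
    assume "q = 0"
    then have "Re q = 0" by simp
    then show False using norm_ge_zero[of "v a"] by (simp add: q_def p_def)
  qed
  have ua: "u a = p" unfolding u_def by (rule va)
  have uu: "(\<Sum>z\<in>I. u z * cnj (u z)) = 1"
  proof -
    have "(\<Sum>z\<in>I. u z * cnj (u z)) = (cnj \<omega> * \<omega>) * ip I v v"
      unfolding ip_def u_def sum_distrib_left by (simp add: mult_ac)
    then show ?thesis using \<omega> v by simp
  qed
  have "(\<Sum>z\<in>I. w z * cnj (w z)) =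
      (\<Sum>z\<in>I. u z * cnj (u z) + (if z = a then u a + cnj (u a) + 1 else 0))"
    unfolding w_def by (rule sum.cong) (auto simp: algebra_simps)
  also have "\<dots> = 2 * q" unfolding sum.distrib uu using I a by (simp add: ua q_def)
  finally have q: "(\<Sum>z\<in>I. w z * cnj (w z)) = 2 * q" .
  note hh = householder_orthogonal[OF I _ _ q0 q]
  have wa: "cnj (w a) = q" unfolding w_def q_def by (simp add: ua)
  define g where "g = (\<lambda>j x. - \<omega> * ((if x = j then 1 else 0) - w x * cnj (w j) / q))"
  have cq: "cnj q = q" by (simp add: q_def)
  show ?thesis
  proof
    show "g a x = v x" if "x \<in> I" for x
    proof -
      have "g a x = \<omega> * u x" unfolding g_def wa using q0 by (simp add: w_def)
      then show ?thesis unfolding u_def using \<omega> by (simp flip: mult.assoc)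
    qed
    have cg: "cnj (g j x) = - cnj \<omega> * ((if x = j then 1 else 0) - cnj (w x) * w j / q)" for j x
      by (simp add: g_def cq)
    have m: "(- s * a) * (- t * b) = (s * t) * (a * b)" for s t a b :: complex
      by (simp add: mult_ac)
    show "onb I g" unfolding onb_def ip_def
    proof (intro conjI ballI)
      fix j k assume j: "j \<in> I" and k: "k \<in> I"
      show "(\<Sum>x\<in>I. cnj (g j x) * g k x) = (if j = k then 1 else 0)"
        unfolding cg unfolding g_def m \<omega> mult_1 by (rule hh[OF j k])
      have "(\<Sum>i\<in>I. g i j * cnj (g i k)) = (\<Sum>z\<in>I. (\<omega> * cnj \<omega>) * (((if z = j then 1 else 0) - cnj (w z) * w j / q) *
        ((if z = k then 1 else 0) - w z * cnj (w k) / q)))"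
        unfolding cg unfolding g_def m
        by (intro sum.cong refl arg_cong2[where f = "(*)"] arg_cong2[where f = "(-)"]) (auto simp: mult.commute)
      then show "(\<Sum>i\<in>I. g i j * cnj (g i k)) = (if j = k then 1 else 0)"
        using hh[OF j k] by (simp add: \<omega>)
    qed
  qed
qed

lemma eigenvector_exists:
  assumes I: "finite I" and ne: "I \<noteq> {}"
  obtains v c where "ip I v v = 1" "\<And>x. x \<in> I \<Longrightarrow> app I \<rho> v x = c * v x"
proof -
  define n where "n = card I"
  obtain h where h: "bij_betw h {0..<n} I" using ex_bij_betw_nat_finite[OF I] unfolding n_def by blast
  define g where "g = inv_into {0..<n} h"
  have gh: "g (h i) = i" if "i < n" for i
    using bij_betw_inv_into_left[OF h] that unfolding g_def by auto
  define A where "A = mat n n (\<lambda>(i, j). \<rho> (h i) (h j))"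
  have A: "A \<in> carrier_mat n n" unfolding A_def by simp
  have "n > 0" using I ne unfolding n_def by (simp add: card_gt_0_iff)
  then obtain c where "eigenvalue A c"
    using spectrum_non_empty[OF A] unfolding spectrum_def by auto
  then obtain w where w: "w \<in> carrier_vec n" "w \<noteq> 0\<^sub>v n" "A *\<^sub>v w = c \<cdot>\<^sub>v w"
    using A unfolding eigenvalue_def eigenvector_def by auto
  define v where "v = (\<lambda>x. w $ g x)"
  have ev: "app I \<rho> v x = c * v x" if x: "x \<in> I" for x
  proof -
    obtain i where i: "i < n" "x = h i" using h x unfolding bij_betw_def by auto
    have "app I \<rho> v x = (\<Sum>j\<in>{0..<n}. \<rho> (h i) (h j) * w $ j)"
      unfolding app_def v_def i(2) sum.reindex_bij_betw[OF h, symmetric]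
      by (rule sum.cong) (auto simp: gh)
    also have "\<dots> = (A *\<^sub>v w) $ i"
      using i w(1) by (simp add: A_def scalar_prod_def)
    finally show ?thesis using i w by (simp add: w(3) v_def gh)
  qed
  have pos: "nrm2 I v > 0"
  proof (rule ccontr)
    assume "\<not> nrm2 I v > 0"
    then have "nrm2 I v = 0" using nrm2_nonneg[of I v] by simp
    then have "v x = 0" if "x \<in> I" for x
      using I that unfolding nrm2_def by (subst (asm) sum_nonneg_eq_0_iff) auto
    then have "w $ i = 0" if "i < n" for i
      using that gh[OF that] h unfolding v_def bij_betw_def by (metis atLeastLessThan_iff imageI zero_le)
    then have "w = 0\<^sub>v n" using w(1) by (intro eq_vecI) auto
    with w(2) show False by simp
  qed
  define s where "s = complex_of_real (1 / sqrt (nrm2 I v))"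
  have "s * s * of_real (nrm2 I v) = 1"
    unfolding s_def using pos by (simp flip: of_real_mult)
  moreover have "cnj s = s" by (simp add: s_def)
  then have "ip I (\<lambda>x. s * v x) (\<lambda>x. s * v x) = s * s * ip I v v"
    unfolding ip_def sum_distrib_left by (simp add: mult_ac)
  ultimately have 1: "ip I (\<lambda>x. s * v x) (\<lambda>x. s * v x) = 1"
    by (simp only: ip_self)
  have 2: "app I \<rho> (\<lambda>x. s * v x) x = c * (s * v x)" if "x \<in> I" for x
    using ev[OF that] unfolding app_def by (simp add: mult.left_commute flip: sum_distrib_left)
  show ?thesis by (rule that[OF 1 2])
qed

text \<open>Induction on the index set. A unit eigenvector is completed to a basis \<open>g\<close>.
  In this basis its column vanishes off the diagonal, hence by Hermiticity so does its row, and the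
  eigenvalue is real; the remaining block is Hermitian on a smaller set.\<close>

theorem spectral_exists:
  assumes "finite I" "herm I \<rho>"
  shows "\<exists>e r. spectral I \<rho> e r"
  using assms
proof (induction I arbitrary: \<rho> rule: finite_induct)
  case empty
  show ?case by (auto simp: spectral_def onb_def)
next
  case (insert a F)
  let ?I = "insert a F"
  have I: "finite ?I" using insert by simp
  obtain v c where v: "ip ?I v v = 1" "\<And>x. x \<in> ?I \<Longrightarrow> app ?I \<rho> v x = c * v x"
    by (rule eigenvector_exists[OF I, of \<rho>]) auto
  obtain g where g: "onb ?I g" "\<And>x. x \<in> ?I \<Longrightarrow> g a x = v x"
    by (rule onb_extend[OF I _ v(1), of a]) auto
  let ?\<rho> = "\<lambda>j k. ip ?I (g j) (app ?I \<rho> (g k))"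
  have h: "cnj (?\<rho> j k) = ?\<rho> k j" for j k
    unfolding cnj_ip by (rule ip_app_herm[OF insert.prems, symmetric])
  have ja: "?\<rho> j a = (if j = a then c else 0)" if "j \<in> ?I" for j
  proof -
    have "?\<rho> j a = ip ?I (g j) (\<lambda>x. c * g a x)"
      using v(2) g(2) app_cong[of ?I "g a" v \<rho>] by (intro ip_cong) auto
    then show ?thesis using onb_ip[OF g(1) that, of a] by (simp add: ip_scale_right)
  qed
  have c: "c = complex_of_real (Re c)"
    using h[of a a] ja[of a] by (simp add: complex_eq_iff)
  have "herm F ?\<rho>" unfolding herm_def by (simp add: h)
  then obtain E r where s: "spectral F ?\<rho> E r" using insert.IH by blast
  have s1: "spectral {a} ?\<rho> (\<lambda>_ _. 1) (\<lambda>_. Re c)"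
    by (rule spectral_singleton) (use ja[of a] c in auto)
  have z: "?\<rho> x y = 0" "?\<rho> y x = 0" if "x \<in> {a}" "y \<in> F" for x y
    using that insert.hyps ja[of y] h[of y x] by (auto split: if_splits)
  have "\<exists>E r. spectral ({a} \<union> F) ?\<rho> E r"
    using spectral_union[OF _ insert.hyps(1) _ s1 s z] insert.hyps(2) by blast
  then obtain E r where "spectral ?I ?\<rho> E r" by auto
  from spectral_change_basis[OF I g(1) this] show ?case by blast
qed

section \<open>Entropy of Hermitian kernels\<close>

definition ent :: "'a set \<Rightarrow> ('a \<Rightarrow> 'a \<Rightarrow> complex) \<Rightarrow> real" where
  "ent I \<rho> = (let r = SOME r. \<exists>e. spectral I \<rho> e r in - (\<Sum>j\<in>I. r j * log 2 (r j)))"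

text \<open>The choice made in the definition is harmless, since \<open>spectral_sum_unique\<close>
  for x log x compares any two decompositions.\<close>

lemma ent_eq:
  assumes "finite I" "spectral I \<rho> e r"
  shows "ent I \<rho> = - (\<Sum>j\<in>I. r j * log 2 (r j))"
proof -
  have "\<exists>e. spectral I \<rho> e (SOME r. \<exists>e. spectral I \<rho> e r)"
    using someI_ex[of "\<lambda>r. \<exists>e. spectral I \<rho> e r"] assms(2) by blast
  then obtain e' where "spectral I \<rho> e' (SOME r. \<exists>e. spectral I \<rho> e r)" ..
  from spectral_sum_unique[OF assms(1) this assms(2), of "\<lambda>x. x * log 2 x"]
  show ?thesis unfolding ent_def Let_def by simp
qed

lemma ent_cong:
  assumes "\<And>x y. x \<in> I \<Longrightarrow> y \<in> I \<Longrightarrow> \<rho> x y = \<rho>' x y"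
  shows "ent I \<rho> = ent I \<rho>'"
proof -
  have "spectral I \<rho> e r = spectral I \<rho>' e r" for e r
    using assms unfolding spectral_def by simp
  then show ?thesis unfolding ent_def by simp
qed

lemma spectral_reindex:
  assumes f: "bij_betw f J I" and s: "spectral I \<rho> e r"
  shows "spectral J (\<lambda>x y. \<rho> (f x) (f y)) (\<lambda>j x. e (f j) (f x)) (\<lambda>j. r (f j))"
proof -
  have m: "f x \<in> I" if "x \<in> J" for x using f that by (auto simp: bij_betw_def)
  have inj: "f x = f y \<longleftrightarrow> x = y" if "x \<in> J" "y \<in> J" for x y
    using f that by (auto simp: bij_betw_def inj_on_def)
  have o: "onb I e" by (rule spectral_onb[OF s])
  show ?thesis
    unfolding spectral_def onb_def
  proof (intro conjI ballI)
    fix j k assume jk: "j \<in> J" "k \<in> J"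
    have "ip J (\<lambda>x. e (f j) (f x)) (\<lambda>x. e (f k) (f x)) = ip I (e (f j)) (e (f k))"
      unfolding ip_def by (rule sum.reindex_bij_betw[OF f, of "\<lambda>x. cnj (e (f j) x) * e (f k) x"])
    then show "ip J (\<lambda>x. e (f j) (f x)) (\<lambda>x. e (f k) (f x)) = (if j = k then 1 else 0)"
      using onb_ip[OF o m[OF jk(1)] m[OF jk(2)]] inj[OF jk] by simp
    show "(\<Sum>i\<in>J. e (f i) (f j) * cnj (e (f i) (f k))) = (if j = k then 1 else 0)"
      unfolding sum.reindex_bij_betw[OF f, of "\<lambda>i. e i (f j) * cnj (e i (f k))"]
      using onb_complete[OF o m[OF jk(1)] m[OF jk(2)]] inj[OF jk] by simp
    show "\<rho> (f j) (f k) = (\<Sum>i\<in>J. complex_of_real (r (f i)) * e (f i) (f j) * cnj (e (f i) (f k)))"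
      unfolding sum.reindex_bij_betw[OF f, of "\<lambda>i. complex_of_real (r i) * e i (f j) * cnj (e i (f k))"]
      by (rule spectral_eq[OF s m[OF jk(1)] m[OF jk(2)]])
  qed
qed

lemma ent_reindex:
  assumes I: "finite I" and f: "bij_betw f J I" and h: "herm I \<rho>"
  shows "ent J (\<lambda>x y. \<rho> (f x) (f y)) = ent I \<rho>"
proof -
  obtain e r where s: "spectral I \<rho> e r" using spectral_exists[OF I h] by blast
  have J: "finite J" using f I bij_betw_finite by blast
  show ?thesis
    unfolding ent_eq[OF I s] ent_eq[OF J spectral_reindex[OF f s]]
    by (simp only: sum.reindex_bij_betw[OF f, of "\<lambda>j. r j * log 2 (r j)"])
qed

lemma ent_union:
  assumes fin: "finite I" "finite J" and dis: "I \<inter> J = {}" and h: "herm I \<rho>" "herm J \<rho>"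
    and z: "\<And>x y. x \<in> I \<Longrightarrow> y \<in> J \<Longrightarrow> \<rho> x y = 0" "\<And>x y. x \<in> I \<Longrightarrow> y \<in> J \<Longrightarrow> \<rho> y x = 0"
  shows "ent (I \<union> J) \<rho> = ent I \<rho> + ent J \<rho>"
proof -
  obtain e r where s: "spectral I \<rho> e r" using spectral_exists[OF fin(1) h(1)] by blast
  obtain f t where t: "spectral J \<rho> f t" using spectral_exists[OF fin(2) h(2)] by blast
  have J: "\<And>x. x \<in> J \<Longrightarrow> x \<notin> I" using dis by auto
  show ?thesis
    unfolding ent_eq[OF fin(1) s] ent_eq[OF fin(2) t]
    by (subst ent_eq[OF _ spectral_union[OF fin dis s t z]])
      (use fin J in \<open>auto simp: sum.union_disjoint[OF fin dis] intro!: sum.cong\<close>)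
qed

text \<open>Polarisation: the quadratic form is real on all combinations of the basis vectors at x
  and y, and the coefficients (1, 0), (0, 1), (1, 1) and (1, i) force the two off-diagonal entries
  to be conjugate.\<close>

lemma pos_herm:
  assumes I: "finite I" and p: "pos I \<rho>"
  shows "herm I \<rho>"
  unfolding herm_def
proof (intro ballI)
  fix x y assume x: "x \<in> I" and y: "y \<in> I"
  have q: "Im (cnj a * a * \<rho> x x + cnj a * b * \<rho> x y + cnj b * a * \<rho> y x + cnj b * b * \<rho> y y) = 0" for a b
  proof -
    \<comment> \<open>Written as a sum of two indicators, the test vector is also correct for x =
      y.\<close>
    define V where "V a b z = (if z = x then a else 0) + (if z = y then b else (0::complex))" for a b z
    have d: "(\<Sum>z\<in>I. V a b z * h z) = a * h x + b * h y" for a b h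
    proof -
      have "(\<Sum>z\<in>I. V a b z * h z) = (\<Sum>z\<in>I. (if z = x then a * h x else 0) + (if z = y then b * h y else 0))"
        by (rule sum.cong) (auto simp: V_def distrib_right)
      then show ?thesis using I x y by (simp add: sum.distrib)
    qed
    have 1: "app I \<rho> (V a b) z = a * \<rho> z x + b * \<rho> z y" for z
      unfolding app_def mult.commute[of "\<rho> z _"] by (rule d)
    have "ip I (V a b) (app I \<rho> (V a b)) = (\<Sum>z\<in>I. V (cnj a) (cnj b) z * (a * \<rho> z x + b * \<rho> z y))"
      unfolding ip_def 1 by (rule sum.cong) (simp_all add: V_def)
    also have "\<dots> = cnj a * (a * \<rho> x x + b * \<rho> x y) + cnj b * (a * \<rho> y x + b * \<rho> y y)"
      by (rule d)
    finally have "ip I (V a b) (app I \<rho> (V a b)) =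
        cnj a * a * \<rho> x x + cnj a * b * \<rho> x y + cnj b * a * \<rho> y x + cnj b * b * \<rho> y y"
      by (simp only: distrib_left mult.assoc add.assoc)
    then show ?thesis using p unfolding pos_def less_eq_complex_def by (metis zero_complex.sel(2))
  qed
  show "cnj (\<rho> x y) = \<rho> y x"
    using q[of 1 0] q[of 0 1] q[of 1 1] q[of 1 "\<i>"] by (simp add: complex_eq_iff)
qed

lemma spectral_nonneg:
  assumes I: "finite I" and s: "spectral I \<rho> e r" and p: "pos I \<rho>" and j: "j \<in> I"
  shows "0 \<le> r j"
proof -
  have "ip I (e j) (app I \<rho> (e j)) = ip I (e j) (\<lambda>x. r j * e j x)"
    by (rule ip_cong) (use spectral_eigen[OF I s _ j] in auto)
  then have "ip I (e j) (app I \<rho> (e j)) = r j"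
    using onb_ip[OF spectral_onb[OF s] j j] by (simp add: ip_scale_right)
  then show ?thesis using p unfolding pos_def by (auto simp: less_eq_complex_def dest: spec[of _ "e j"])
qed

lemma spectral_trace:
  assumes I: "finite I" and s: "spectral I \<rho> e r"
  shows "(\<Sum>x\<in>I. \<rho> x x) = complex_of_real (\<Sum>j\<in>I. r j)"
proof -
  have "(\<Sum>x\<in>I. \<rho> x x) = (\<Sum>j\<in>I. complex_of_real (r j) * ip I (e j) (e j))"
    unfolding ip_def sum_distrib_left by (subst sum.swap) (simp add: spectral_eq[OF s] mult_ac)
  then show ?thesis using onb_ip[OF spectral_onb[OF s]] by simp
qed

text \<open>An eigenvalue c r contributes c r log r plus r c log c; at a zero of c or r everything
  vanishes. The correction is proportional to the trace, which is why it will cancel in the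
  conditional mutual information.\<close>

lemma ent_scale:
  assumes I: "finite I" and p: "pos I \<rho>" and c: "0 \<le> c"
  shows "ent I (\<lambda>x y. complex_of_real c * \<rho> x y) = c * ent I \<rho> - c * log 2 c * Re (\<Sum>x\<in>I. \<rho> x x)"
proof -
  obtain e r where s: "spectral I \<rho> e r" using spectral_exists[OF I pos_herm[OF I p]] by blast
  have s': "spectral I (\<lambda>x y. complex_of_real c * \<rho> x y) e (\<lambda>j. c * r j)"
    using s unfolding spectral_def by (simp add: sum_distrib_left mult.assoc)
  have "c * r j * log 2 (c * r j) = c * (r j * log 2 (r j)) + c * log 2 c * r j" if "j \<in> I" for j
    using spectral_nonneg[OF I s p that] c
    by (cases "c = 0 \<or> r j = 0") (auto simp: log_mult algebra_simps)
  then show ?thesis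
    unfolding ent_eq[OF I s] ent_eq[OF I s'] spectral_trace[OF I s]
    by (simp add: sum.distrib sum_distrib_left)
qed

section \<open>Monotonicity of the relative entropy\<close>

lemma sum_rotate: "(\<Sum>x\<in>A. \<Sum>a\<in>B. \<Sum>b\<in>C. h x a b) = (\<Sum>a\<in>B. \<Sum>b\<in>C. \<Sum>x\<in>A. h x a b)"
  by (subst sum.swap, rule sum.cong[OF refl], rule sum.swap)

definition kraus_map ::
  "'l set \<Rightarrow> 'a set \<Rightarrow> ('l \<Rightarrow> 'b \<Rightarrow> 'a \<Rightarrow> complex) \<Rightarrow> ('a \<Rightarrow> 'a \<Rightarrow> complex) \<Rightarrow> 'b \<Rightarrow> 'b \<Rightarrow> complex" where
  "kraus_map L I M \<rho> x y = (\<Sum>l\<in>L. \<Sum>a\<in>I. \<Sum>b\<in>I. M l x a * \<rho> a b * cnj (M l y b))"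

definition kraus_tp ::
  "'l set \<Rightarrow> 'a set \<Rightarrow> 'b set \<Rightarrow> ('l \<Rightarrow> 'b \<Rightarrow> 'a \<Rightarrow> complex) \<Rightarrow> bool" where
  "kraus_tp L I J M \<longleftrightarrow>
     (\<forall>a\<in>I. \<forall>b\<in>I. (\<Sum>l\<in>L. \<Sum>x\<in>J. cnj (M l x a) * M l x b) = (if a = b then 1 else 0))"

lemma kraus_tpD:
  "kraus_tp L I J M \<Longrightarrow> a \<in> I \<Longrightarrow> b \<in> I \<Longrightarrow>
   (\<Sum>l\<in>L. \<Sum>x\<in>J. cnj (M l x a) * M l x b) = (if a = b then 1 else 0)"
  unfolding kraus_tp_def by blast

section \<open>Kraus maps and the Schwarz inequality for their adjoints\<close>

lemma ip_app_expand:
  "ip J (app I A u) (app I A v) = (\<Sum>a\<in>I. \<Sum>b\<in>I. cnj (u a) * v b * (\<Sum>x\<in>J. cnj (A x a) * A x b))"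
proof -
  have "ip J (app I A u) (app I A v) =
      (\<Sum>x\<in>J. \<Sum>a\<in>I. \<Sum>b\<in>I. cnj (u a) * v b * (cnj (A x a) * A x b))"
    unfolding ip_def app_def cnj_sum sum_product by (intro sum.cong refl) simp
  also have "\<dots> = (\<Sum>a\<in>I. \<Sum>b\<in>I. cnj (u a) * v b * (\<Sum>x\<in>J. cnj (A x a) * A x b))"
    unfolding sum_distrib_left
    by (subst sum.swap, rule sum.cong[OF refl], subst sum.swap) (rule refl)
  finally show ?thesis .
qed

text \<open>Trace preservation says that stacking the Kraus operators, z to the family of all M_l z,
  is an isometry V (Stinespring).\<close>

lemma kraus_tp_isometry:
  assumes I: "finite I" and tp: "kraus_tp L I J M"
  shows "(\<Sum>l\<in>L. nrm2 J (app I (M l) z)) = nrm2 I z"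
proof -
  have "(\<Sum>l\<in>L. ip J (app I (M l) z) (app I (M l) z)) =
      (\<Sum>a\<in>I. \<Sum>b\<in>I. cnj (z a) * z b * (\<Sum>l\<in>L. \<Sum>x\<in>J. cnj (M l x a) * M l x b))"
    unfolding ip_app_expand sum_distrib_left
    by (subst sum.swap, rule sum.cong[OF refl], subst sum.swap) (rule refl)
  also have "\<dots> = (\<Sum>a\<in>I. \<Sum>b\<in>I. if b = a then cnj (z a) * z a else 0)"
    by (intro sum.cong refl) (use kraus_tpD[OF tp] in auto)
  also have "\<dots> = ip I z z" unfolding ip_def using I by (intro sum.cong) auto
  finally have "complex_of_real (\<Sum>l\<in>L. nrm2 J (app I (M l) z)) = of_real (nrm2 I z)"
    unfolding ip_self by simp
  then show ?thesis by (simp only: of_real_eq_iff)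
qed

lemma Re_ip_le: "Re (ip I u v) \<le> (nrm2 I u + nrm2 I v) / 2"
proof -
  have "Re (cnj a * b) \<le> ((cmod a)\<^sup>2 + (cmod b)\<^sup>2) / 2" for a b
  proof -
    have "0 \<le> (Re a - Re b)\<^sup>2 + (Im a - Im b)\<^sup>2" by simp
    then show ?thesis unfolding cmod_power2 by (simp add: power2_eq_square algebra_simps)
  qed
  then have "Re (ip I u v) \<le> (\<Sum>x\<in>I. ((cmod (u x))\<^sup>2 + (cmod (v x))\<^sup>2) / 2)"
    unfolding ip_def Re_sum by (intro sum_mono)
  then show ?thesis unfolding nrm2_def by (simp add: sum.distrib flip: sum_divide_distrib)
qed

text \<open>Here \<open>z\<close> is the adjoint of the Stinespring isometry V applied to the family
  \<open>w\<close>. It is a contraction because |z|^2 = Re <V z, w> is at most half of |V z|^2 +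
  |w|^2, and |V z| = |z|.\<close>

lemma kraus_tp_coisometry:
  fixes w :: "'l \<Rightarrow> 'b \<Rightarrow> complex"
  assumes I: "finite I" and tp: "kraus_tp L I J M"
  defines "z \<equiv> \<lambda>a. \<Sum>l\<in>L. app J (\<lambda>a x. cnj (M l x a)) (w l) a"
  shows "nrm2 I z \<le> (\<Sum>l\<in>L. nrm2 J (w l))"
proof -
  have "ip I z z = (\<Sum>l\<in>L. ip I z (app J (\<lambda>a x. cnj (M l x a)) (w l)))"
    using ip_sum_right[of I z "\<lambda>_. 1" "\<lambda>l. app J (\<lambda>a x. cnj (M l x a)) (w l)" L]
    unfolding z_def by simp
  also have "\<dots> = (\<Sum>l\<in>L. ip J (app I (M l) z) (w l))"
    by (rule sum.cong[OF refl], subst ip_app_adjoint) simp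
  finally have "nrm2 I z = (\<Sum>l\<in>L. Re (ip J (app I (M l) z) (w l)))"
    unfolding ip_self by (metis Re_complex_of_real Re_sum)
  also have "\<dots> \<le> (\<Sum>l\<in>L. (nrm2 J (app I (M l) z) + nrm2 J (w l)) / 2)"
    by (intro sum_mono Re_ip_le)
  also have "\<dots> = (nrm2 I z + (\<Sum>l\<in>L. nrm2 J (w l))) / 2"
    unfolding kraus_tp_isometry[OF I tp, of z, symmetric] by (simp add: sum.distrib flip: sum_divide_distrib)
  finally show ?thesis by simp
qed

text \<open>Unlike in \<open>spectral\<close>, the vectors need be neither orthogonal nor
  normalised. This is the form that survives a Kraus map: the images of the eigenvectors under all
  Kraus operators form an ensemble of the image.\<close>

definition ensemble ::
  "'k set \<Rightarrow> 'a set \<Rightarrow> ('a \<Rightarrow> 'a \<Rightarrow> complex) \<Rightarrow> ('k \<Rightarrow> 'a \<Rightarrow> complex) \<Rightarrow> ('k \<Rightarrow> real) \<Rightarrow> bool" where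
  "ensemble K I \<rho> e r \<longleftrightarrow>
     (\<forall>x\<in>I. \<forall>y\<in>I. \<rho> x y = (\<Sum>j\<in>K. complex_of_real (r j) * e j x * cnj (e j y)))"

lemma spectral_ensemble: "spectral I \<rho> e r \<Longrightarrow> ensemble I I \<rho> e r"
  unfolding spectral_def ensemble_def by blast

text \<open>The right-hand side is the trace of \<open>Y \<rho>\<close> and mentions no ensemble, so
  the left-hand side may be evaluated in whichever ensemble is convenient.\<close>

lemma ensemble_ip:
  assumes "ensemble K I \<rho> e r"
  shows "(\<Sum>i\<in>K. complex_of_real (r i) * ip I (e i) (app I Y (e i))) = (\<Sum>x\<in>I. \<Sum>y\<in>I. Y x y * \<rho> y x)"
proof -
  have "(\<Sum>x\<in>I. \<Sum>y\<in>I. Y x y * \<rho> y x) =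
      (\<Sum>x\<in>I. \<Sum>y\<in>I. \<Sum>i\<in>K. complex_of_real (r i) * (cnj (e i x) * (Y x y * e i y)))"
    by (intro sum.cong refl)
      (use assms in \<open>auto simp: ensemble_def sum_distrib_left mult_ac intro!: sum.cong\<close>)
  also have "\<dots> = (\<Sum>i\<in>K. complex_of_real (r i) * ip I (e i) (app I Y (e i)))"
    unfolding ip_def app_def sum_distrib_left
    by (subst (2) sum.swap, subst sum.swap, rule sum.cong[OF refl], rule sum.cong[OF refl]) simp
  finally show ?thesis ..
qed

lemma ensemble_nrm2:
  assumes "ensemble K I \<rho> e r"
  shows "complex_of_real (\<Sum>i\<in>K. r i * nrm2 I (app I Y (e i))) =
    (\<Sum>x\<in>I. \<Sum>y\<in>I. (\<Sum>z\<in>I. cnj (Y z x) * Y z y) * \<rho> y x)"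
proof -
  have "complex_of_real (\<Sum>i\<in>K. r i * nrm2 I (app I Y (e i))) =
      (\<Sum>i\<in>K. complex_of_real (r i) * ip I (app I Y (e i)) (app I Y (e i)))"
    by (simp add: ip_self)
  also have "\<dots> = (\<Sum>i\<in>K. complex_of_real (r i) * ip I (e i) (app I (\<lambda>x y. \<Sum>z\<in>I. cnj (Y z x) * Y z y) (e i)))"
    unfolding ip_app_expand unfolding ip_def app_def
    by (simp add: sum_distrib_left sum_distrib_right mult_ac)
  also have "\<dots> = (\<Sum>x\<in>I. \<Sum>y\<in>I. (\<Sum>z\<in>I. cnj (Y z x) * Y z y) * \<rho> y x)"
    by (rule ensemble_ip[OF assms])
  finally show ?thesis .
qed

lemma ensemble_nrm2_unique:
  assumes "ensemble K I \<rho> e r" "ensemble K' I \<rho> e' r'"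
  shows "(\<Sum>i\<in>K. r i * nrm2 I (app I Y (e i))) = (\<Sum>i\<in>K'. r' i * nrm2 I (app I Y (e' i)))"
proof -
  have "complex_of_real (\<Sum>i\<in>K. r i * nrm2 I (app I Y (e i))) =
      complex_of_real (\<Sum>i\<in>K'. r' i * nrm2 I (app I Y (e' i)))"
    unfolding ensemble_nrm2[OF assms(1)] ensemble_nrm2[OF assms(2)] ..
  then show ?thesis by (simp only: of_real_eq_iff)
qed

lemma ensemble_kraus:
  assumes "ensemble K I \<rho> e r"
  shows "ensemble (L \<times> K) J (kraus_map L I M \<rho>) (\<lambda>(l, i). app I (M l) (e i)) (\<lambda>(l, i). r i)"
  unfolding ensemble_def
proof (intro ballI)
  fix x y
  have "kraus_map L I M \<rho> x y =
      (\<Sum>l\<in>L. \<Sum>a\<in>I. \<Sum>b\<in>I. \<Sum>i\<in>K. complex_of_real (r i) * ((M l x a * e i a) * (cnj (M l y b) * cnj (e i b))))"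
    unfolding kraus_map_def
    by (intro sum.cong refl)
      (use assms in \<open>auto simp: ensemble_def sum_distrib_left sum_distrib_right mult_ac intro!: sum.cong\<close>)
  also have "\<dots> = (\<Sum>l\<in>L. \<Sum>i\<in>K. complex_of_real (r i) * app I (M l) (e i) x * cnj (app I (M l) (e i) y))"
  proof (rule sum.cong[OF refl])
    fix l
    show "(\<Sum>a\<in>I. \<Sum>b\<in>I. \<Sum>i\<in>K. complex_of_real (r i) * ((M l x a * e i a) * (cnj (M l y b) * cnj (e i b)))) =
      (\<Sum>i\<in>K. complex_of_real (r i) * app I (M l) (e i) x * cnj (app I (M l) (e i) y))"
      unfolding app_def cnj_sum mult.assoc[of "complex_of_real _"] sum_product unfolding sum_distrib_left
      by (subst (2) sum.swap, subst sum.swap, rule sum.cong[OF refl], rule sum.cong[OF refl]) simp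
  qed
  finally show "kraus_map L I M \<rho> x y = (\<Sum>k\<in>L \<times> K. complex_of_real (case k of (l, i) \<Rightarrow> r i) *
      (case k of (l, i) \<Rightarrow> app I (M l) (e i)) x * cnj ((case k of (l, i) \<Rightarrow> app I (M l) (e i)) y))"
    by (simp add: sum.cartesian_product split_def)
qed

text \<open>For \<open>\<rho> = \<Sum>\<^sub>i r\<^sub>i |f\<^sub>i\<rangle>\<langle>f\<^sub>i|\<close> and \<open>\<sigma> = \<Sum>\<^sub>j t\<^sub>j |g\<^sub>j\<rangle>\<langle>g\<^sub>j|\<close>, the number \<open>vval\<close> is
  \<open>2 Re Tr \<rho>Y - Tr \<sigma>YY\<^sup>* - s Tr \<rho>Y\<^sup>*Y\<close>, and its maximum \<open>qval\<close> over \<open>Y\<close> is the expectation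
  of the resolvent \<open>(\<Delta> + s)\<^sup>-\<^sup>1\<close> of the relative modular operator in the vector \<open>\<rho>\<^sup>1\<^sup>/\<^sup>2\<close>.\<close>

definition qval where
  "qval s I f r g t = (\<Sum>i\<in>I. \<Sum>j\<in>I. (r i)\<^sup>2 * (cmod (ip I (g j) (f i)))\<^sup>2 / (t j + s * r i :: real))"

definition vval where
  "vval s I K f r K' g t Y = 2 * Re (\<Sum>i\<in>K. complex_of_real (r i) * ip I (f i) (app I Y (f i)))
     - (\<Sum>j\<in>K'. t j * nrm2 I (app I (\<lambda>x y. cnj (Y y x)) (g j)))
     - s * (\<Sum>i\<in>K. r i * nrm2 I (app I Y (f i)))"

lemma vval_ensemble:
  assumes "ensemble K I \<rho> f r" "ensemble K1 I \<rho> f1 r1" "ensemble K' I \<sigma> g t" "ensemble K1' I \<sigma> g1 t1"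
  shows "vval s I K f r K' g t Y = vval s I K1 f1 r1 K1' g1 t1 Y"
  unfolding vval_def ensemble_ip[OF assms(1)] ensemble_ip[OF assms(2)]
    ensemble_nrm2_unique[OF assms(1,2)] ensemble_nrm2_unique[OF assms(3,4)] ..

text \<open>In the matrix elements of \<open>Y\<close> between the bases \<open>f\<close> and
  \<open>g\<close> the three terms decouple: each pair (i, j) contributes a quadratic function of
  one complex number, which can be maximised separately.\<close>

lemma vval_coeffs:
  assumes I: "finite I" and f: "onb I f" and g: "onb I g"
  shows "vval s I I f r I g t Y = (\<Sum>i\<in>I. \<Sum>j\<in>I.
     2 * r i * Re (cnj (ip I (g j) (f i)) * ip I (g j) (app I Y (f i)))
     - (t j + s * r i) * (cmod (ip I (g j) (app I Y (f i))))\<^sup>2)"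
proof -
  let ?y = "\<lambda>i j. ip I (g j) (app I Y (f i))"
  let ?u = "\<lambda>i j. ip I (g j) (f i)"
  have a: "Re (complex_of_real (r i) * ip I (f i) (app I Y (f i))) = (\<Sum>j\<in>I. r i * Re (cnj (?u i j) * ?y i j))" for i
    unfolding parseval[OF I g, of "f i", symmetric] by (simp add: sum_distrib_left Re_complex_of_real)
  have b: "nrm2 I (app I Y (f i)) = (\<Sum>j\<in>I. (cmod (?y i j))\<^sup>2)" for i
    by (rule parseval_nrm2[OF I g, symmetric])
  have c: "nrm2 I (app I (\<lambda>x y. cnj (Y y x)) (g j)) = (\<Sum>i\<in>I. (cmod (?y i j))\<^sup>2)" for j
  proof -
    have "cmod (ip I (f i) (app I (\<lambda>x y. cnj (Y y x)) (g j))) = cmod (?y i j)" for i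
      by (subst ip_app_adjoint, subst cnj_ip[symmetric]) simp
    then show ?thesis unfolding parseval_nrm2[OF I f, symmetric] by simp
  qed
  show ?thesis
    unfolding vval_def Re_sum a b c sum_distrib_left
    by (subst (2) sum.swap) (simp add: sum.distrib sum_subtractf algebra_simps sum_distrib_left)
qed

lemma vval_le_qval:
  assumes I: "finite I" and f: "onb I f" and g: "onb I g" and s: "0 < s"
    and r: "\<And>i. i \<in> I \<Longrightarrow> 0 \<le> r i" and t: "\<And>i. i \<in> I \<Longrightarrow> 0 \<le> t i"
  shows "vval s I I f r I g t Y \<le> qval s I f r g t"
  unfolding vval_coeffs[OF I f g] qval_def
proof (intro sum_mono)
  fix i j assume i: "i \<in> I" and j: "j \<in> I"
  let ?y = "ip I (g j) (app I Y (f i))" and ?u = "ip I (g j) (f i)" and ?D = "t j + s * r i"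
  have sr: "0 \<le> s * r i" using s r[OF i] by simp
  show "2 * r i * Re (cnj ?u * ?y) - ?D * (cmod ?y)\<^sup>2 \<le> (r i)\<^sup>2 * (cmod ?u)\<^sup>2 / ?D"
  \<comment> \<open>A zero denominator forces \<open>r i = 0\<close> because s > 0; then both sides
    are 0, with x / 0 = 0.\<close>
  proof (cases "?D = 0")
    case True
    then have "s * r i = 0" using sr t[OF j] by linarith
    then have "r i = 0" using s by simp
    then show ?thesis using True by simp
  next
    case False
    then have D: "?D > 0" using sr t[OF j] by simp
    \<comment> \<open>Completing the square: this is the squared modulus of r u - D y.\<close>
    have "0 \<le> (r i * Re ?u - ?D * Re ?y)\<^sup>2 + (r i * Im ?u - ?D * Im ?y)\<^sup>2" by simp
    also have "\<dots> = (r i)\<^sup>2 * (cmod ?u)\<^sup>2 - ?D * (2 * r i * Re (cnj ?u * ?y) - ?D * (cmod ?y)\<^sup>2)"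
      unfolding cmod_power2 by (simp add: power2_eq_square algebra_simps)
    finally show ?thesis using D by (simp add: pos_le_divide_eq mult.commute)
  qed
qed

lemma qval_attained:
  assumes I: "finite I" and f: "onb I f" and g: "onb I g"
  shows "\<exists>Y. vval s I I f r I g t Y = qval s I f r g t"
proof -
  \<comment> \<open>The stationary point of the quadratic function belonging to (i, j);
    \<open>Y\<close> is the operator with these matrix elements.\<close>
  define y where "y i j = complex_of_real (r i / (t j + s * r i)) * ip I (g j) (f i)" for i j
  define Y where "Y x z = (\<Sum>i\<in>I. (\<Sum>j\<in>I. y i j * g j x) * cnj (f i z))" for x z
  have coeff: "ip I (g j) (app I Y (f i)) = y i j" if i: "i \<in> I" and j: "j \<in> I" for i j
  proof -
    have "app I Y (f i) x = (\<Sum>m\<in>I. (\<Sum>j\<in>I. y m j * g j x) * ip I (f m) (f i))" for x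
      unfolding app_def Y_def ip_def sum_distrib_right[of _ _ "f i _"] sum_distrib_left[of "\<Sum>j\<in>I. y _ j * g j x"]
      by (subst sum.swap) (simp add: mult_ac)
    also have "\<dots> x = (\<Sum>m\<in>I. if m = i then \<Sum>j\<in>I. y i j * g j x else 0)" for x
      by (rule sum.cong) (use onb_ip[OF f _ i] in auto)
    finally have "app I Y (f i) = (\<lambda>x. \<Sum>j\<in>I. y i j * g j x)" using I i by auto
    then have "ip I (g j) (app I Y (f i)) = (\<Sum>m\<in>I. y i m * ip I (g j) (g m))"
      by (simp only: ip_sum_right)
    also have "\<dots> = (\<Sum>m\<in>I. if m = j then y i j else 0)"
      by (rule sum.cong) (use onb_ip[OF g j] in auto)
    finally show ?thesis using I j by simp
  qed
  have c: "2 * a * (a / D * c) - D * ((a / D)\<^sup>2 * c) = a\<^sup>2 * c / D" for a c D :: real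
    by (cases "D = 0") (auto simp: power2_eq_square field_simps)
  have "vval s I I f r I g t Y = qval s I f r g t"
    unfolding vval_coeffs[OF I f g] qval_def
  proof (intro sum.cong refl)
    fix i j assume ij: "i \<in> I" "j \<in> I"
    let ?u = "ip I (g j) (f i)" and ?D = "t j + s * r i"
    have a: "Re (cnj ?u * y i j) = r i / ?D * (cmod ?u)\<^sup>2"
      unfolding y_def cmod_power2 by (simp add: power2_eq_square algebra_simps add_divide_distrib)
    have b: "(cmod (y i j))\<^sup>2 = (r i / ?D)\<^sup>2 * (cmod ?u)\<^sup>2"
      unfolding y_def norm_mult norm_of_real power_mult_distrib power2_abs by (rule refl)
    show "2 * r i * Re (cnj ?u * ip I (g j) (app I Y (f i))) - ?D * (cmod (ip I (g j) (app I Y (f i))))\<^sup>2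
        = (r i)\<^sup>2 * (cmod ?u)\<^sup>2 / ?D"
      unfolding coeff[OF ij] a b using c[of "r i" ?D "(cmod ?u)\<^sup>2"] by simp
  qed
  then show ?thesis by blast
qed

text \<open>An optimal \<open>Y\<close> for the images is pulled back along the adjoint channel to
  \<open>Z Y\<close>. The linear term is unchanged, and the two quadratic terms, which are
  subtracted, do not grow by the Schwarz inequality; so \<open>Z Y\<close> does at least as well for
  the original pair.\<close>

lemma qval_kraus_mono:
  assumes I: "finite I" and J: "finite J" and tp: "kraus_tp L I J M"
    and \<rho>: "spectral I \<rho> f r" and \<sigma>: "spectral I \<sigma> g t"
    and \<rho>': "spectral J (kraus_map L I M \<rho>) f' r'" and \<sigma>': "spectral J (kraus_map L I M \<sigma>) g' t'"
    and r: "\<And>i. i \<in> I \<Longrightarrow> 0 \<le> r i" and t: "\<And>i. i \<in> I \<Longrightarrow> 0 \<le> t i" and s: "0 < s"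
  shows "qval s J f' r' g' t' \<le> qval s I f r g t"
proof -
  obtain Y where Y: "vval s J J f' r' J g' t' Y = qval s J f' r' g' t'"
    using qval_attained[OF J spectral_onb[OF \<rho>'] spectral_onb[OF \<sigma>']] by blast
  define Z where "Z W a b = (\<Sum>l\<in>L. app J (\<lambda>a x. cnj (M l x a)) (app J W (\<lambda>y. M l y b)) a)" for W a b
  have Z: "app I (Z W) v a = (\<Sum>l\<in>L. app J (\<lambda>a x. cnj (M l x a)) (app J W (app I (M l) v)) a)" for W v a
    unfolding Z_def app_def sum_distrib_left sum_distrib_right
    by (subst sum.swap, rule sum.cong[OF refl], subst sum.swap, rule sum.cong[OF refl],
        subst sum.swap, rule sum.cong[OF refl]) (simp add: mult_ac)
  \<comment> \<open>The term with \<open>\<sigma>\<close> contains the adjoint of \<open>Y\<close>,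
    so the pullback has to commute with adjoints before the Schwarz inequality applies to
    it.\<close>
  have Zadj: "(\<lambda>x y. cnj (Z Y y x)) = Z (\<lambda>x y. cnj (Y y x))"
  proof (intro ext)
    fix x y
    show "cnj (Z Y y x) = Z (\<lambda>x y. cnj (Y y x)) x y"
      unfolding Z_def app_def sum_distrib_left cnj_sum
      by (rule sum.cong[OF refl], subst sum.swap) (simp add: mult_ac)
  qed
  \<comment> \<open>\<open>Z W\<close> applied to \<open>v\<close> is the adjoint Stinespring
    isometry applied to the family of all W M_l v, hence its norm is bounded by that of the
    family.\<close>
  have S: "nrm2 I (app I (Z W) v) \<le> (\<Sum>l\<in>L. nrm2 J (app J W (app I (M l) v)))" for W v
    unfolding Z[abs_def] by (rule kraus_tp_coisometry[OF I tp])
  have ipZ: "ip I v (app I (Z W) v) = (\<Sum>l\<in>L. ip J (app I (M l) v) (app J W (app I (M l) v)))" for W v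
  proof -
    have "ip I v (app I (Z W) v) = (\<Sum>l\<in>L. ip I v (app J (\<lambda>a x. cnj (M l x a)) (app J W (app I (M l) v))))"
      using ip_sum_right[of I v "\<lambda>_. 1" "\<lambda>l. app J (\<lambda>a x. cnj (M l x a)) (app J W (app I (M l) v))" L]
      unfolding Z[abs_def] by simp
    also have "\<dots> = (\<Sum>l\<in>L. ip J (app I (M l) v) (app J W (app I (M l) v)))"
      by (rule sum.cong[OF refl], subst ip_app_adjoint) simp
    finally show ?thesis .
  qed
  have sw: "(\<Sum>k\<in>L \<times> I. complex_of_real (case k of (l, i) \<Rightarrow> r i) * (case k of (l, i) \<Rightarrow> h l i)) =
      (\<Sum>i\<in>I. complex_of_real (r i) * (\<Sum>l\<in>L. h l i))" for h
    unfolding sum_distrib_left by (subst sum.swap) (simp add: sum.cartesian_product split_def)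
  have sw': "(\<Sum>k\<in>L \<times> I. (case k of (l, i) \<Rightarrow> q i) * (case k of (l, i) \<Rightarrow> h l i)) =
      (\<Sum>i\<in>I. q i * (\<Sum>l\<in>L. h l i))" for h and q :: "_ \<Rightarrow> real"
    unfolding sum_distrib_left by (subst sum.swap) (simp add: sum.cartesian_product split_def)
  have "qval s J f' r' g' t' = vval s J (L \<times> I) (\<lambda>(l, i). app I (M l) (f i)) (\<lambda>(l, i). r i)
      (L \<times> I) (\<lambda>(l, i). app I (M l) (g i)) (\<lambda>(l, i). t i) Y"
    unfolding Y[symmetric]
    by (rule vval_ensemble[OF spectral_ensemble[OF \<rho>'] ensemble_kraus[OF spectral_ensemble[OF \<rho>]]
          spectral_ensemble[OF \<sigma>'] ensemble_kraus[OF spectral_ensemble[OF \<sigma>]]])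
  also have "\<dots> = 2 * Re (\<Sum>i\<in>I. complex_of_real (r i) * ip I (f i) (app I (Z Y) (f i)))
     - (\<Sum>j\<in>I. t j * (\<Sum>l\<in>L. nrm2 J (app J (\<lambda>x y. cnj (Y y x)) (app I (M l) (g j)))))
     - s * (\<Sum>i\<in>I. r i * (\<Sum>l\<in>L. nrm2 J (app J Y (app I (M l) (f i)))))"
    unfolding vval_def ipZ sw[symmetric] sw'[symmetric] by (simp add: split_def)
  also have "\<dots> \<le> vval s I I f r I g t (Z Y)"
    unfolding vval_def Zadj
    by (intro diff_mono order_refl mult_left_mono sum_mono S) (use r t s in auto)
  also have "\<dots> \<le> qval s I f r g t"
    by (rule vval_le_qval[OF I spectral_onb[OF \<rho>] spectral_onb[OF \<sigma>] s r t])
  finally show ?thesis .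
qed


section \<open>From the resolvent to the logarithm\<close>

lemma has_real_derivative_scaled_ln:
  fixes c t r s :: real
  assumes "c = 0 \<or> 0 < t + s * r"
  shows "((\<lambda>s. c * ln (t + s * r)) has_real_derivative c * (r / (t + s * r))) (at s)"
proof (cases "c = 0")
  case False
  then have "0 < t + s * r" using assms by simp
  then show ?thesis by (auto intro!: derivative_eq_intros)
qed simp

text \<open>Subtracting ln s amounts to dividing the argument by s, and t / s + r tends to
  r.\<close>

lemma tendsto_scaled_ln:
  fixes c t r :: real
  assumes "c = 0 \<or> 0 < r"
  shows "((\<lambda>s. c * (ln (t + s * r) - ln s)) \<longlongrightarrow> c * ln r) at_top"
proof (cases "c = 0")
  case False
  then have r: "0 < r" using assms by simp
  have "((\<lambda>s::real. ln (t / s + r)) \<longlongrightarrow> ln (0 + r)) at_top"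
    using r by (intro tendsto_intros tendsto_divide_0[OF tendsto_const] filterlim_at_top_imp_at_infinity filterlim_ident) auto
  moreover have "\<forall>\<^sub>F s in at_top. ln (t / s + r) = ln (t + s * r) - ln s"
  proof (rule eventually_mono[OF eventually_gt_at_top[of "max 0 (- t / r)"]])
    fix s :: real assume s: "max 0 (- t / r) < s"
    then have "0 < t + s * r" using r by (auto simp: field_simps)
    moreover have "t / s + r = (t + s * r) / s" using s by (auto simp: field_simps)
    ultimately show "ln (t / s + r) = ln (t + s * r) - ln s" using s by (simp add: ln_div)
  qed
  ultimately have "((\<lambda>s. ln (t + s * r) - ln s) \<longlongrightarrow> ln (0 + r)) at_top"
    by (rule Lim_transform_eventually)
  then show ?thesis by (intro tendsto_mult tendsto_const) simp
qed simp

text \<open>By \<open>mono\<close> the difference D(s) of the two sums of logarithms has a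
  nonnegative derivative. It increases from D(0), which contains the logarithms of \<open>t\<close>
  and \<open>t'\<close>, to its limit at infinity, where only those of \<open>r\<close> and
  \<open>r'\<close> are left. The alternative of weight 0 covers terms whose logarithm is
  meaningless.\<close>

lemma log_sum_mono:
  fixes c t r :: "'a \<Rightarrow> real" and c' t' r' :: "'b \<Rightarrow> real"
  assumes P: "\<And>p. p \<in> P \<Longrightarrow> c p = 0 \<or> 0 < t p \<and> 0 < r p"
    and P': "\<And>p. p \<in> P' \<Longrightarrow> c' p = 0 \<or> 0 < t' p \<and> 0 < r' p"
    and tot: "sum c P = sum c' P'"
    and mono: "\<And>s. 0 < s \<Longrightarrow> (\<Sum>p\<in>P'. c' p * (r' p / (t' p + s * r' p))) \<le> (\<Sum>p\<in>P. c p * (r p / (t p + s * r p)))"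
  shows "(\<Sum>p\<in>P'. c' p * (ln (r' p) - ln (t' p))) \<le> (\<Sum>p\<in>P. c p * (ln (r p) - ln (t p)))"
proof -
  define D where "D s = (\<Sum>p\<in>P. c p * ln (t p + s * r p)) - (\<Sum>p\<in>P'. c' p * ln (t' p + s * r' p))" for s
  have arg: "c p = 0 \<or> 0 < t p + s * r p" if "p \<in> P" "0 \<le> s" for p s
    using P[OF that(1)] that(2) by (auto intro: add_pos_nonneg)
  have arg': "c' p = 0 \<or> 0 < t' p + s * r' p" if "p \<in> P'" "0 \<le> s" for p s
    using P'[OF that(1)] that(2) by (auto intro: add_pos_nonneg)
  have der: "(D has_real_derivative (\<Sum>p\<in>P. c p * (r p / (t p + s * r p))) - (\<Sum>p\<in>P'. c' p * (r' p / (t' p + s * r' p)))) (at s)"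
    if "0 \<le> s" for s
    unfolding D_def[abs_def]
    by (intro DERIV_diff DERIV_sum has_real_derivative_scaled_ln arg arg' that)
  have le: "D 0 \<le> D s" if s: "0 < s" for s
  proof (rule DERIV_nonneg_imp_increasing_open[OF less_imp_le[OF s]])
    show "\<exists>y. (D has_real_derivative y) (at x) \<and> 0 \<le> y" if "0 < x" "x < s" for x
      using der[of x] mono[OF that(1)] that by force
    show "continuous_on {0..s} D"
      using der by (intro continuous_at_imp_continuous_on ballI) (auto intro: DERIV_isCont)
  qed
  \<comment> \<open>Each sum diverges like its total weight times ln s; by \<open>tot\<close> the
    divergent parts cancel.\<close>
  have split: "D s = (\<Sum>p\<in>P. c p * (ln (t p + s * r p) - ln s)) - (\<Sum>p\<in>P'. c' p * (ln (t' p + s * r' p) - ln s))" for s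
    using tot unfolding D_def by (simp add: right_diff_distrib sum_subtractf flip: sum_distrib_right)
  have "(D \<longlongrightarrow> (\<Sum>p\<in>P. c p * ln (r p)) - (\<Sum>p\<in>P'. c' p * ln (r' p))) at_top"
    unfolding split by (intro tendsto_diff tendsto_sum tendsto_scaled_ln) (use P P' in auto)
  then have "D 0 \<le> (\<Sum>p\<in>P. c p * ln (r p)) - (\<Sum>p\<in>P'. c' p * ln (r' p))"
    by (rule tendsto_lowerbound)
      (auto intro!: eventually_mono[OF eventually_gt_at_top[of 0]] le)
  then show ?thesis unfolding D_def by (simp add: right_diff_distrib sum_subtractf)
qed

lemma kraus_tp_trace:
  assumes I: "finite I" and tp: "kraus_tp L I J M"
  shows "(\<Sum>x\<in>J. kraus_map L I M \<rho> x x) = (\<Sum>a\<in>I. \<rho> a a)"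
proof -
  have "(\<Sum>x\<in>J. kraus_map L I M \<rho> x x) =
      (\<Sum>a\<in>I. \<Sum>b\<in>I. \<rho> a b * (\<Sum>l\<in>L. \<Sum>x\<in>J. cnj (M l x b) * M l x a))"
    unfolding kraus_map_def sum_distrib_left
    by (subst sum.swap, subst (2) sum_rotate, subst sum_rotate) (simp add: mult_ac)
  also have "\<dots> = (\<Sum>a\<in>I. \<Sum>b\<in>I. if b = a then \<rho> a a else 0)"
    by (intro sum.cong refl) (use kraus_tpD[OF tp] in auto)
  finally show ?thesis using I by simp
qed

text \<open>Monotonicity of the relative entropy: the sums are \<open>Tr \<rho>(ln \<rho> - ln \<sigma>)\<close>, written in
  eigenbases; the hypotheses \<open>supp\<close> say that the null space of \<open>\<sigma>\<close> is contained in that of \<open>\<rho>\<close>.\<close>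

theorem relative_entropy_mono:
  assumes I: "finite I" and J: "finite J" and tp: "kraus_tp L I J M"
    and \<rho>: "spectral I \<rho> f r" and \<sigma>: "spectral I \<sigma> g t"
    and \<rho>': "spectral J (kraus_map L I M \<rho>) f' r'" and \<sigma>': "spectral J (kraus_map L I M \<sigma>) g' t'"
    and r: "\<And>i. i \<in> I \<Longrightarrow> 0 \<le> r i" and t: "\<And>i. i \<in> I \<Longrightarrow> 0 \<le> t i"
    and r': "\<And>i. i \<in> J \<Longrightarrow> 0 \<le> r' i" and t': "\<And>i. i \<in> J \<Longrightarrow> 0 \<le> t' i"
    and supp: "\<And>i j. i \<in> I \<Longrightarrow> j \<in> I \<Longrightarrow> t j = 0 \<Longrightarrow> r i * (cmod (ip I (g j) (f i)))\<^sup>2 = 0"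
    and supp': "\<And>i j. i \<in> J \<Longrightarrow> j \<in> J \<Longrightarrow> t' j = 0 \<Longrightarrow> r' i * (cmod (ip J (g' j) (f' i)))\<^sup>2 = 0"
  shows "(\<Sum>i\<in>J. r' i * ln (r' i)) - (\<Sum>i\<in>J. \<Sum>j\<in>J. r' i * (cmod (ip J (g' j) (f' i)))\<^sup>2 * ln (t' j))
    \<le> (\<Sum>i\<in>I. r i * ln (r i)) - (\<Sum>i\<in>I. \<Sum>j\<in>I. r i * (cmod (ip I (g j) (f i)))\<^sup>2 * ln (t j))"
proof -
  \<comment> \<open>By Parseval the squared overlaps with an orthonormal basis sum to 1, so the
    weights have total Tr \<rho>, which the channel preserves.\<close>
  have row: "(\<Sum>j\<in>I. r i * (cmod (ip I (g j) (f i)))\<^sup>2) = r i" if "i \<in> I" for i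
    using parseval_nrm2[OF I spectral_onb[OF \<sigma>], of "f i"] onb_ip[OF spectral_onb[OF \<rho>] that that]
    unfolding ip_self by (simp flip: sum_distrib_left)
  have row': "(\<Sum>j\<in>J. r' i * (cmod (ip J (g' j) (f' i)))\<^sup>2) = r' i" if "i \<in> J" for i
    using parseval_nrm2[OF J spectral_onb[OF \<sigma>'], of "f' i"] onb_ip[OF spectral_onb[OF \<rho>'] that that]
    unfolding ip_self by (simp flip: sum_distrib_left)
  define c where "c = (\<lambda>(i, j). r i * (cmod (ip I (g j) (f i)))\<^sup>2)"
  define c' where "c' = (\<lambda>(i, j). r' i * (cmod (ip J (g' j) (f' i)))\<^sup>2)"
  have tr: "(\<Sum>i\<in>I. r i) = (\<Sum>i\<in>J. r' i)"
    using kraus_tp_trace[OF I tp, of \<rho>] unfolding spectral_trace[OF I \<rho>] spectral_trace[OF J \<rho>']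
    by (simp only: of_real_eq_iff)
  have "(\<Sum>p\<in>J \<times> J. c' p * (ln (r' (fst p)) - ln (t' (snd p)))) \<le> (\<Sum>p\<in>I \<times> I. c p * (ln (r (fst p)) - ln (t (snd p))))"
  proof (rule log_sum_mono)
    show "c p = 0 \<or> 0 < t (snd p) \<and> 0 < r (fst p)" if "p \<in> I \<times> I" for p
      using that supp r t unfolding c_def by (force simp: less_le)
    show "c' p = 0 \<or> 0 < t' (snd p) \<and> 0 < r' (fst p)" if "p \<in> J \<times> J" for p
      using that supp' r' t' unfolding c'_def by (force simp: less_le)
    show "sum c (I \<times> I) = sum c' (J \<times> J)"
      unfolding c_def c'_def sum.cartesian_product[symmetric] using row row' tr by simp
    fix s :: real assume s: "0 < s"
    \<comment> \<open>Of the two factors r_i in \<open>qval\<close> one belongs to the weight; the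
      other is the one produced by differentiating ln (t + s r) in s.\<close>
    show "(\<Sum>p\<in>J \<times> J. c' p * (r' (fst p) / (t' (snd p) + s * r' (fst p)))) \<le>
        (\<Sum>p\<in>I \<times> I. c p * (r (fst p) / (t (snd p) + s * r (fst p))))"
      using qval_kraus_mono[OF I J tp \<rho> \<sigma> \<rho>' \<sigma>' r t s]
      unfolding qval_def c_def c'_def sum.cartesian_product
      by (simp add: split_def power2_eq_square mult_ac)
  qed
  then show ?thesis
    unfolding c_def c'_def right_diff_distrib sum_subtractf sum.cartesian_product'
    by (simp add: split_def row row' flip: sum_distrib_right)
qed

section \<open>Conditional entropy\<close>

lemma cmod_ip_square: "complex_of_real ((cmod (ip I u v))\<^sup>2) = ip I v u * ip I u v"
  unfolding complex_norm_square cnj_ip by (rule mult.commute)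

text \<open>Moving the Kraus operators onto the test vector turns the form of the image into a sum
  of values of the form of \<open>\<rho>\<close>.\<close>

lemma kraus_pos:
  assumes "pos I \<rho>"
  shows "pos J (kraus_map L I M \<rho>)"
  unfolding pos_def
proof
  fix v
  let ?w = "\<lambda>l. app J (\<lambda>a x. cnj (M l x a)) v"
  have "ip J v (app J (kraus_map L I M \<rho>) v) =
      (\<Sum>x\<in>J. \<Sum>y\<in>J. \<Sum>l\<in>L. \<Sum>a\<in>I. \<Sum>b\<in>I. cnj (v x) * (M l x a * \<rho> a b * cnj (M l y b)) * v y)"
    unfolding ip_def app_def kraus_map_def sum_distrib_left sum_distrib_right by (simp add: mult.assoc)
  also have "\<dots> = (\<Sum>l\<in>L. \<Sum>x\<in>J. \<Sum>y\<in>J. \<Sum>a\<in>I. \<Sum>b\<in>I. cnj (v x) * (M l x a * \<rho> a b * cnj (M l y b)) * v y)"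
    by (rule sum_rotate[symmetric])
  also have "\<dots> = (\<Sum>l\<in>L. ip I (?w l) (app I \<rho> (?w l)))"
  proof (rule sum.cong[OF refl])
    fix l
    have "(\<Sum>x\<in>J. \<Sum>y\<in>J. \<Sum>a\<in>I. \<Sum>b\<in>I. cnj (v x) * (M l x a * \<rho> a b * cnj (M l y b)) * v y) =
        (\<Sum>a\<in>I. \<Sum>x\<in>J. \<Sum>b\<in>I. \<Sum>y\<in>J. cnj (v x) * (M l x a * \<rho> a b * cnj (M l y b)) * v y)"
      by (subst sum_rotate[symmetric]) (intro sum.cong refl, rule sum.swap)
    also have "\<dots> = ip I (?w l) (app I \<rho> (?w l))"
      unfolding ip_def app_def cnj_sum sum_distrib_left sum_distrib_right
      by (subst (2) sum.swap, simp add: mult_ac, rule sum.cong[OF refl], rule sum.cong[OF refl], rule sum.swap)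
    finally show "(\<Sum>x\<in>J. \<Sum>y\<in>J. \<Sum>a\<in>I. \<Sum>b\<in>I. cnj (v x) * (M l x a * \<rho> a b * cnj (M l y b)) * v y) =
      ip I (?w l) (app I \<rho> (?w l))" .
  qed
  finally show "0 \<le> ip J v (app J (kraus_map L I M \<rho>) v)"
    using assms unfolding pos_def by (simp add: sum_nonneg)
qed

lemma pos_cong:
  assumes "\<And>x y. x \<in> I \<Longrightarrow> y \<in> I \<Longrightarrow> \<rho> x y = \<rho>' x y"
  shows "pos I \<rho> = pos I \<rho>'"
  using assms unfolding pos_def ip_def app_def by simp

lemma pos_reindex:
  fixes f :: "'b \<Rightarrow> 'a"
  assumes f: "bij_betw f J I" and p: "pos I \<rho>"
  shows "pos J (\<lambda>x y. \<rho> (f x) (f y))"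
  unfolding pos_def
proof
  fix v :: "'b \<Rightarrow> complex"
  define w where "w y = v (inv_into J f y)" for y
  have w: "v x = w (f x)" if "x \<in> J" for x
    unfolding w_def using bij_betw_inv_into_left[OF f that] by simp
  have a: "app J (\<lambda>x y. \<rho> (f x) (f y)) v x = app I \<rho> w (f x)" for x
    unfolding app_def sum.reindex_bij_betw[OF f, of "\<lambda>y. \<rho> (f x) y * w y", symmetric]
    by (rule sum.cong) (auto simp: w)
  have "ip J v (app J (\<lambda>x y. \<rho> (f x) (f y)) v) = ip I w (app I \<rho> w)"
    unfolding ip_def a sum.reindex_bij_betw[OF f, of "\<lambda>y. cnj (w y) * app I \<rho> w y", symmetric]
    by (rule sum.cong) (auto simp: w)
  then show "0 \<le> ip J v (app J (\<lambda>x y. \<rho> (f x) (f y)) v)"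
    using p unfolding pos_def by simp
qed

lemma pos_scale: "pos I \<rho> \<Longrightarrow> 0 \<le> c \<Longrightarrow> pos I (\<lambda>x y. complex_of_real c * \<rho> x y)"
  unfolding pos_def
proof
  fix v assume "\<forall>v. 0 \<le> ip I v (app I \<rho> v)" "0 \<le> c"
  moreover have "ip I v (app I (\<lambda>x y. complex_of_real c * \<rho> x y) v) = complex_of_real c * ip I v (app I \<rho> v)"
    unfolding ip_def app_def sum_distrib_left by (simp add: mult_ac)
  ultimately show "0 \<le> ip I v (app I (\<lambda>x y. complex_of_real c * \<rho> x y) v)"
    by (simp add: less_eq_complex_def)
qed

lemma pos_union:
  assumes fin: "finite I" "finite J" and dis: "I \<inter> J = {}" and p: "pos I \<rho>" "pos J \<rho>"
    and z: "\<And>x y. x \<in> I \<Longrightarrow> y \<in> J \<Longrightarrow> \<rho> x y = 0" "\<And>x y. x \<in> I \<Longrightarrow> y \<in> J \<Longrightarrow> \<rho> y x = 0"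
  shows "pos (I \<union> J) \<rho>"
  unfolding pos_def
proof
  fix v
  have S: "sum h (I \<union> J) = sum h I + sum h J" for h :: "'a \<Rightarrow> complex"
    by (rule sum.union_disjoint[OF fin dis])
  have "ip (I \<union> J) v (app (I \<union> J) \<rho> v) = ip I v (app I \<rho> v) + ip J v (app J \<rho> v)"
    unfolding ip_def app_def S using z by simp
  then show "0 \<le> ip (I \<union> J) v (app (I \<union> J) \<rho> v)" using p unfolding pos_def by simp
qed

lemma ent_transfer:
  assumes "finite I" "bij_betw f J I" "herm I \<rho>" "\<And>x y. x \<in> J \<Longrightarrow> y \<in> J \<Longrightarrow> \<rho>' x y = \<rho> (f x) (f y)"
  shows "ent J \<rho>' = ent I \<rho>"
  using ent_reindex[OF assms(1-3)] ent_cong[of J \<rho>' "\<lambda>x y. \<rho> (f x) (f y)"] assms(4) by simp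

text \<open>The eigenvalues of a block diagonal kernel are those of its blocks taken together. No
  Shannon term appears, because the blocks are not normalised.\<close>

lemma ent_blocks:
  assumes "finite K" "finite Y" "\<And>k. k \<in> K \<Longrightarrow> herm Y (\<rho> k)"
  shows "ent (K \<times> Y) (\<lambda>p q. if fst p = fst q then \<rho> (fst p) (snd p) (snd q) else 0) = (\<Sum>k\<in>K. ent Y (\<rho> k))"
  using assms
proof (induction K rule: finite_induct)
  case empty
  then show ?case by (simp add: ent_def)
next
  case (insert k K)
  let ?\<rho> = "\<lambda>p q. if fst p = fst q then \<rho> (fst p) (snd p) (snd q) else 0"
  have h: "herm ({k} \<times> Y) ?\<rho>" "herm (K \<times> Y) ?\<rho>"
    using insert.prems(2) unfolding herm_def by auto
  have bij: "bij_betw snd ({k} \<times> Y) Y" by (auto simp: bij_betw_def inj_on_def image_iff)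
  have "ent ({k} \<times> Y) ?\<rho> = ent Y (\<rho> k)"
    by (rule ent_transfer[OF insert.prems(1) bij]) (use insert.prems in auto)
  moreover have "ent ({k} \<times> Y \<union> K \<times> Y) ?\<rho> = ent ({k} \<times> Y) ?\<rho> + ent (K \<times> Y) ?\<rho>"
    by (rule ent_union[OF _ _ _ h]) (use insert in auto)
  moreover have "insert k K \<times> Y = {k} \<times> Y \<union> K \<times> Y" by auto
  ultimately show ?case using insert by simp
qed

section \<open>Partial traces and operators on one tensor factor\<close>

definition ptr1 :: "'b set \<Rightarrow> ('b \<times> 'x \<Rightarrow> 'b \<times> 'x \<Rightarrow> complex) \<Rightarrow> 'x \<Rightarrow> 'x \<Rightarrow> complex" where
  "ptr1 B \<rho> x y = (\<Sum>b\<in>B. \<rho> (b, x) (b, y))"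

text \<open>One construction for three uses: the operator 1 \<otimes> \<tau>, the Kraus operators of
  a channel on the second factor, and, applied to a basis \<open>g\<close>, the product basis of all
  e_b \<otimes> g_j.\<close>

definition tensor_id :: "('x \<Rightarrow> 'y \<Rightarrow> complex) \<Rightarrow> 'b \<times> 'x \<Rightarrow> 'b \<times> 'y \<Rightarrow> complex" where
  "tensor_id K p q = (if fst p = fst q then K (snd p) (snd q) else 0)"

lemma cnj_tensor_id: "cnj (tensor_id K p q) = tensor_id (\<lambda>x y. cnj (K x y)) p q"
  by (simp add: tensor_id_def)

lemma sum_tensor_id_left:
  assumes "finite B" "b \<in> B"
  shows "(\<Sum>q\<in>B \<times> X. tensor_id K (b, x) q * h q) = (\<Sum>y\<in>X. K x y * h (b, y))"
proof -
  have "(\<Sum>q\<in>B \<times> X. tensor_id K (b, x) q * h q) = (\<Sum>c\<in>B. if c = b then \<Sum>y\<in>X. K x y * h (b, y) else 0)"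
    unfolding sum.cartesian_product' tensor_id_def by (intro sum.cong refl) auto
  then show ?thesis using assms by simp
qed

lemma kraus_map_tensor_id:
  assumes B: "finite B" and p: "fst p \<in> B" "fst q \<in> B"
  shows "kraus_map L (B \<times> X) (\<lambda>l. tensor_id (K l)) \<rho> p q =
    kraus_map L X K (\<lambda>x y. \<rho> (fst p, x) (fst q, y)) (snd p) (snd q)"
proof -
  obtain b x c y where [simp]: "p = (b, x)" "q = (c, y)" by (cases p, cases q)
  have "kraus_map L (B \<times> X) (\<lambda>l. tensor_id (K l)) \<rho> p q =
     (\<Sum>l\<in>L. \<Sum>u\<in>B \<times> X. tensor_id (K l) (b, x) u * cnj (\<Sum>v\<in>B \<times> X. tensor_id (K l) (c, y) v * cnj (\<rho> u v)))"
    unfolding kraus_map_def cnj_sum sum_distrib_left by (simp add: mult_ac)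
  also have "\<dots> = (\<Sum>l\<in>L. \<Sum>a\<in>X. K l x a * cnj (\<Sum>d\<in>X. K l y d * cnj (\<rho> (b, a) (c, d))))"
    using p by (simp only: \<open>p = (b, x)\<close> \<open>q = (c, y)\<close> fst_conv sum_tensor_id_left[OF B])
  also have "\<dots> = kraus_map L X K (\<lambda>x y. \<rho> (b, x) (c, y)) x y"
    unfolding kraus_map_def cnj_sum sum_distrib_left by (simp add: mult_ac)
  finally show ?thesis by simp
qed

lemma kraus_tp_tensor_id:
  assumes B: "finite B" and tp: "kraus_tp L X Y K"
  shows "kraus_tp L (B \<times> X) (B \<times> Y) (\<lambda>l. tensor_id (K l))"
  unfolding kraus_tp_def
proof (intro ballI)
  fix p q assume p: "p \<in> B \<times> X" and q: "q \<in> B \<times> X"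
  obtain b x c y where [simp]: "p = (b, x)" "q = (c, y)" by (cases p, cases q)
  have "(\<Sum>l\<in>L. \<Sum>u\<in>B \<times> Y. cnj (tensor_id (K l) u p) * tensor_id (K l) u q) =
      (\<Sum>l\<in>L. \<Sum>d\<in>B. if d = b then if b = c then \<Sum>z\<in>Y. cnj (K l z x) * K l z y else 0 else 0)"
    unfolding sum.cartesian_product' tensor_id_def by (intro sum.cong refl) auto
  also have "\<dots> = (if b = c then \<Sum>l\<in>L. \<Sum>z\<in>Y. cnj (K l z x) * K l z y else 0)"
    using p B by simp
  also have "\<dots> = (if p = q then 1 else 0)" using kraus_tpD[OF tp, of x y] p q by auto
  finally show "(\<Sum>l\<in>L. \<Sum>u\<in>B \<times> Y. cnj (tensor_id (K l) u p) * tensor_id (K l) u q) = (if p = q then 1 else 0)" .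
qed

text \<open>A channel on X acts on every block (b, b) separately and is linear, so it commutes with
  the sum over b.\<close>

lemma ptr1_kraus:
  assumes B: "finite B"
  shows "ptr1 B (kraus_map L (B \<times> X) (\<lambda>l. tensor_id (K l)) \<rho>) x y = kraus_map L X K (ptr1 B \<rho>) x y"
proof -
  have "ptr1 B (kraus_map L (B \<times> X) (\<lambda>l. tensor_id (K l)) \<rho>) x y =
      (\<Sum>b\<in>B. kraus_map L X K (\<lambda>x y. \<rho> (b, x) (b, y)) x y)"
    unfolding ptr1_def by (intro sum.cong refl) (simp add: kraus_map_tensor_id[OF B])
  also have "\<dots> = kraus_map L X K (ptr1 B \<rho>) x y"
    unfolding kraus_map_def ptr1_def sum_distrib_left sum_distrib_right
    by (subst sum_rotate) (intro sum.cong refl, rule sum.swap)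
  finally show ?thesis .
qed

text \<open>These are the operators <c| \<otimes> 1. They exhibit the partial trace as a channel, so
  positivity of marginals and strong subadditivity become instances of facts about Kraus
  maps.\<close>

definition trace_kraus :: "'c \<Rightarrow> 'x \<Rightarrow> 'c \<times> 'x \<Rightarrow> complex" where
  "trace_kraus c x p = (if p = (c, x) then 1 else 0)"

lemma kraus_map_trace:
  assumes C: "finite C" and X: "finite X" and xy: "x \<in> X" "y \<in> X"
  shows "kraus_map C (C \<times> X) trace_kraus \<rho> x y = ptr1 C \<rho> x y"
  unfolding kraus_map_def ptr1_def
proof (rule sum.cong[OF refl])
  fix b assume b: "b \<in> C"
  have "(\<Sum>p\<in>C \<times> X. \<Sum>q\<in>C \<times> X. trace_kraus b x p * \<rho> p q * cnj (trace_kraus b y q)) =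
      (\<Sum>p\<in>C \<times> X. \<Sum>q\<in>C \<times> X. if q = (b, y) then if p = (b, x) then \<rho> p q else 0 else 0)"
    unfolding trace_kraus_def by (intro sum.cong refl) auto
  also have "\<dots> = \<rho> (b, x) (b, y)" using C X b xy by simp
  finally show "(\<Sum>p\<in>C \<times> X. \<Sum>q\<in>C \<times> X. trace_kraus b x p * \<rho> p q * cnj (trace_kraus b y q)) = \<rho> (b, x) (b, y)" .
qed

lemma pos_ptr1:
  assumes "finite B" "finite X" "pos (B \<times> X) \<rho>"
  shows "pos X (ptr1 B \<rho>)"
  by (rule iffD1[OF pos_cong[OF kraus_map_trace[OF assms(1,2)]] kraus_pos[OF assms(3)]])

lemma spectral_tensor_id:
  assumes B: "finite B" and X: "finite X" and s: "spectral X \<tau> g t"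
  shows "spectral (B \<times> X) (tensor_id \<tau>) (tensor_id g) (\<lambda>p. t (snd p))"
proof -
  have S: "(\<Sum>q\<in>B \<times> X. if fst q = b then h (snd q) else 0) = (\<Sum>x\<in>X. h x)" if "b \<in> B" for b and h :: "_ \<Rightarrow> complex"
  proof -
    have "(\<Sum>q\<in>B \<times> X. if fst q = b then h (snd q) else 0) = (\<Sum>c\<in>B. if c = b then \<Sum>x\<in>X. h x else 0)"
      unfolding sum.cartesian_product' by (intro sum.cong refl) auto
    then show ?thesis using B that by simp
  qed
  have c1: "ip (B \<times> X) (tensor_id g p) (tensor_id g q) = (\<Sum>u\<in>B \<times> X. if fst u = fst p then if fst p = fst q then cnj (g (snd p) (snd u)) * g (snd q) (snd u) else 0 else 0)" for p q
    unfolding ip_def tensor_id_def by (intro sum.cong refl) auto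
  have c2: "(\<Sum>j\<in>B \<times> X. tensor_id g j p * cnj (tensor_id g j q)) = (\<Sum>u\<in>B \<times> X. if fst u = fst p then if fst p = fst q then g (snd u) (snd p) * cnj (g (snd u) (snd q)) else 0 else 0)" for p q
    unfolding tensor_id_def by (intro sum.cong refl) auto
  have c3: "(\<Sum>j\<in>B \<times> X. complex_of_real (t (snd j)) * tensor_id g j p * cnj (tensor_id g j q)) = (\<Sum>u\<in>B \<times> X. if fst u = fst p then if fst p = fst q then complex_of_real (t (snd u)) * g (snd u) (snd p) * cnj (g (snd u) (snd q)) else 0 else 0)" for p q
    unfolding tensor_id_def by (intro sum.cong refl) auto
  note o = onb_ip[OF spectral_onb[OF s], unfolded ip_def] onb_complete[OF spectral_onb[OF s]]
  show ?thesis
    unfolding spectral_def onb_def c1 c2 c3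
  proof (intro conjI ballI)
    fix p q assume pq: "p \<in> B \<times> X" "q \<in> B \<times> X"
    obtain b x c y where eq: "p = (b, x)" "q = (c, y)" by (cases p, cases q)
    have m: "b \<in> B" "c \<in> B" "x \<in> X" "y \<in> X" using pq eq by auto
    note S' = S[OF m(1)]
    show "(\<Sum>u\<in>B \<times> X. if fst u = fst p then if fst p = fst q then cnj (g (snd p) (snd u)) * g (snd q) (snd u) else 0 else 0) = (if p = q then 1 else 0)"
      unfolding eq fst_conv snd_conv using S'[of "\<lambda>u. if b = c then cnj (g x u) * g y u else 0"] o(1)[OF m(3,4)] by (cases "b = c") auto
    show "(\<Sum>u\<in>B \<times> X. if fst u = fst p then if fst p = fst q then g (snd u) (snd p) * cnj (g (snd u) (snd q)) else 0 else 0) = (if p = q then 1 else 0)"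
      unfolding eq fst_conv snd_conv using S'[of "\<lambda>u. if b = c then g u x * cnj (g u y) else 0"] o(2)[OF m(3,4)] by (cases "b = c") auto
    show "tensor_id \<tau> p q = (\<Sum>u\<in>B \<times> X. if fst u = fst p then if fst p = fst q then complex_of_real (t (snd u)) * g (snd u) (snd p) * cnj (g (snd u) (snd q)) else 0 else 0)"
      unfolding eq fst_conv snd_conv using S'[of "\<lambda>u. if b = c then complex_of_real (t u) * g u x * cnj (g u y) else 0"] spectral_eq[OF s m(3,4)]
      by (cases "b = c") (auto simp: tensor_id_def)
  qed
qed

text \<open>The sum over i is the diagonal entry of \<open>\<rho>\<close> at e_b \<otimes> g_j;
  summed over b it becomes that of the marginal at its eigenvector g_j. This evaluates the cross
  term of the relative entropy and also yields the support condition.\<close>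

lemma marginal_weight:
  assumes B: "finite B" and X: "finite X" and \<rho>: "spectral (B \<times> X) \<rho> f r"
    and \<tau>: "spectral X (ptr1 B \<rho>) g t" and j: "j \<in> X"
  shows "(\<Sum>b\<in>B. \<Sum>i\<in>B \<times> X. r i * (cmod (ip (B \<times> X) (tensor_id g (b, j)) (f i)))\<^sup>2) = t j"
proof -
  have BX: "finite (B \<times> X)" using B X by simp
  have w: "complex_of_real (\<Sum>i\<in>B \<times> X. r i * (cmod (ip (B \<times> X) (tensor_id g (b, j)) (f i)))\<^sup>2) =
      (\<Sum>x\<in>X. \<Sum>y\<in>X. cnj (g j x) * \<rho> (b, x) (b, y) * g j y)" if b: "b \<in> B" for b
  proof -
    let ?G = "tensor_id g (b, j)"
    have "complex_of_real (\<Sum>i\<in>B \<times> X. r i * (cmod (ip (B \<times> X) ?G (f i)))\<^sup>2) =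
        (\<Sum>i\<in>B \<times> X. complex_of_real (r i) * ip (B \<times> X) (f i) ?G * ip (B \<times> X) ?G (f i))"
      unfolding of_real_sum of_real_mult cmod_ip_square by (simp only: mult.assoc)
    also have "\<dots> = ip (B \<times> X) ?G (\<lambda>x. \<Sum>i\<in>B \<times> X. complex_of_real (r i) * ip (B \<times> X) (f i) ?G * f i x)"
      by (rule ip_sum_right[symmetric])
    also have "\<dots> = ip (B \<times> X) ?G (app (B \<times> X) \<rho> ?G)"
      by (rule ip_cong) (simp_all add: spectral_app[OF \<rho>])
    also have "\<dots> = (\<Sum>x\<in>X. cnj (g j x) * app (B \<times> X) \<rho> ?G (b, x))"
      unfolding ip_def using sum_tensor_id_left[OF B b, of "\<lambda>x y. cnj (g x y)" j "app (B \<times> X) \<rho> ?G" X]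
      by (simp only: cnj_tensor_id)
    also have "\<dots> = (\<Sum>x\<in>X. cnj (g j x) * (\<Sum>y\<in>X. g j y * \<rho> (b, x) (b, y)))"
      unfolding app_def using sum_tensor_id_left[OF B b, of g j _ X] by (simp add: mult.commute)
    finally show ?thesis by (simp add: sum_distrib_left mult_ac)
  qed
  have "complex_of_real (\<Sum>b\<in>B. \<Sum>i\<in>B \<times> X. r i * (cmod (ip (B \<times> X) (tensor_id g (b, j)) (f i)))\<^sup>2) =
      (\<Sum>b\<in>B. \<Sum>x\<in>X. \<Sum>y\<in>X. cnj (g j x) * \<rho> (b, x) (b, y) * g j y)"
    unfolding of_real_sum by (rule sum.cong[OF refl]) (use w in simp)
  also have "\<dots> = ip X (g j) (app X (ptr1 B \<rho>) (g j))"
    unfolding ip_def app_def ptr1_def sum_distrib_left sum_distrib_right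
    by (subst sum_rotate) (simp add: mult_ac)
  also have "\<dots> = ip X (g j) (\<lambda>x. t j * g j x)"
    by (rule ip_cong) (use spectral_eigen[OF X \<tau> _ j] in auto)
  also have "\<dots> = t j" using onb_ip[OF spectral_onb[OF \<tau>] j j] by (simp add: ip_scale_right)
  finally show ?thesis by (simp only: of_real_eq_iff)
qed

lemma ent_eq_ln:
  assumes "finite I" "spectral I \<rho> e r"
  shows "ln 2 * ent I \<rho> = - (\<Sum>j\<in>I. r j * ln (r j))"
  unfolding ent_eq[OF assms] by (simp add: log_def sum_distrib_left)

text \<open>S(B|X) is, up to the factor ln 2, minus the relative entropy of \<open>\<rho>\<close>
  with respect to 1 \<otimes> \<open>ptr1 B \<rho>\<close>.\<close>

theorem conditional_entropy_mono:
  assumes B: "finite B" and X: "finite X" and Y: "finite Y" and tp: "kraus_tp L X Y K"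
    and p: "pos (B \<times> X) \<rho>"
  defines "\<rho>' \<equiv> kraus_map L (B \<times> X) (\<lambda>l. tensor_id (K l)) \<rho>"
  shows "ent (B \<times> X) \<rho> - ent X (ptr1 B \<rho>) \<le> ent (B \<times> Y) \<rho>' - ent Y (ptr1 B \<rho>')"
proof -
  have fin: "finite (B \<times> X)" "finite (B \<times> Y)" using B X Y by simp_all
  have p': "pos (B \<times> Y) \<rho>'" unfolding \<rho>'_def by (rule kraus_pos[OF p])
  have q: "pos X (ptr1 B \<rho>)" by (rule pos_ptr1[OF B X p])
  have q': "pos Y (ptr1 B \<rho>')" by (rule pos_ptr1[OF B Y p'])
  obtain f r where s: "spectral (B \<times> X) \<rho> f r" using spectral_exists[OF fin(1) pos_herm[OF fin(1) p]] by blast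
  obtain f' r' where s': "spectral (B \<times> Y) \<rho>' f' r'" using spectral_exists[OF fin(2) pos_herm[OF fin(2) p']] by blast
  obtain g t where u: "spectral X (ptr1 B \<rho>) g t" using spectral_exists[OF X pos_herm[OF X q]] by blast
  obtain g' t' where u': "spectral Y (ptr1 B \<rho>') g' t'" using spectral_exists[OF Y pos_herm[OF Y q']] by blast
  note v = spectral_tensor_id[OF B X u] and v1 = spectral_tensor_id[OF B Y u']
  \<comment> \<open>The second argument keeps its shape: a channel on X alone leaves the factor 1 on
    B, and its value on the marginal is the marginal of the output.\<close>
  have v': "spectral (B \<times> Y) (kraus_map L (B \<times> X) (\<lambda>l. tensor_id (K l)) (tensor_id (ptr1 B \<rho>))) (tensor_id g') (\<lambda>p. t' (snd p))"
  proof (rule spectral_cong[OF v1])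
    fix x y assume "x \<in> B \<times> Y" "y \<in> B \<times> Y"
    then show "tensor_id (ptr1 B \<rho>') x y = kraus_map L (B \<times> X) (\<lambda>l. tensor_id (K l)) (tensor_id (ptr1 B \<rho>)) x y"
      by (subst kraus_map_tensor_id[OF B])
        (auto simp: tensor_id_def \<rho>'_def ptr1_kraus[OF B] kraus_map_def)
  qed
  have cross: "(\<Sum>i\<in>B \<times> Z. \<Sum>j\<in>B \<times> Z. R i * (cmod (ip (B \<times> Z) (tensor_id G j) (F i)))\<^sup>2 * ln (T (snd j))) = (\<Sum>j\<in>Z. T j * ln (T j))"
    if "finite Z" "spectral (B \<times> Z) \<omega> F R" "spectral Z (ptr1 B \<omega>) G T" for Z :: "'z set" and F R G T \<omega>
  proof -
    have "(\<Sum>i\<in>B \<times> Z. \<Sum>j\<in>B \<times> Z. R i * (cmod (ip (B \<times> Z) (tensor_id G j) (F i)))\<^sup>2 * ln (T (snd j))) =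
        (\<Sum>b\<in>B. \<Sum>j\<in>Z. (\<Sum>i\<in>B \<times> Z. R i * (cmod (ip (B \<times> Z) (tensor_id G (b, j)) (F i)))\<^sup>2) * ln (T j))"
      unfolding sum_distrib_right by (subst sum.swap, subst sum.cartesian_product) (simp add: split_def)
    also have "\<dots> = (\<Sum>j\<in>Z. (\<Sum>b\<in>B. \<Sum>i\<in>B \<times> Z. R i * (cmod (ip (B \<times> Z) (tensor_id G (b, j)) (F i)))\<^sup>2) * ln (T j))"
      unfolding sum_distrib_right[of _ B] by (rule sum.swap)
    also have "\<dots> = (\<Sum>j\<in>Z. T j * ln (T j))"
      using marginal_weight[OF B that] by simp
    finally show ?thesis .
  qed
  \<comment> \<open>An eigenvalue 0 of the marginal is, by \<open>marginal_weight\<close>, a sum of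
    nonnegative weights, all of which must vanish.\<close>
  have supp: "R i * (cmod (ip (B \<times> Z) (tensor_id G j) (F i)))\<^sup>2 = 0"
    if "finite Z" "spectral (B \<times> Z) \<omega> F R" "spectral Z (ptr1 B \<omega>) G T" "\<And>i. i \<in> B \<times> Z \<Longrightarrow> 0 \<le> R i"
      "i \<in> B \<times> Z" "j \<in> B \<times> Z" "T (snd j) = 0" for Z :: "'z set" and F R G T \<omega> i j
  proof -
    let ?h = "\<lambda>b i. R i * (cmod (ip (B \<times> Z) (tensor_id G (b, snd j)) (F i)))\<^sup>2"
    have nn: "0 \<le> (\<Sum>i\<in>B \<times> Z. ?h b i)" for b by (intro sum_nonneg) (use that(4) in auto)
    have "(\<Sum>b\<in>B. \<Sum>i\<in>B \<times> Z. ?h b i) = 0"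
      using marginal_weight[OF B that(1-3), of "snd j"] that by auto
    then have "(\<Sum>i\<in>B \<times> Z. ?h (fst j) i) = 0"
      using nn B that(6) by (subst (asm) sum_nonneg_eq_0_iff) auto
    then have "?h (fst j) i = 0"
      by (subst (asm) sum_nonneg_eq_0_iff) (use that B in auto)
    then show ?thesis by simp
  qed
  note nn = spectral_nonneg[OF fin(1) s p] spectral_nonneg[OF fin(2) s' p']
    spectral_nonneg[OF X u q] spectral_nonneg[OF Y u' q']
  have "(\<Sum>i\<in>B \<times> Y. r' i * ln (r' i)) - (\<Sum>j\<in>Y. t' j * ln (t' j)) \<le> (\<Sum>i\<in>B \<times> X. r i * ln (r i)) - (\<Sum>j\<in>X. t j * ln (t j))"
    using relative_entropy_mono[OF fin kraus_tp_tensor_id[OF B tp] s v s'[unfolded \<rho>'_def] v' nn(1) _ nn(2)]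
      supp[OF X s u nn(1)] supp[OF Y s' u' nn(2)] nn(3,4)
    unfolding cross[OF X s u] cross[OF Y s' u'] by auto
  then have "ln 2 * (ent (B \<times> X) \<rho> - ent X (ptr1 B \<rho>)) \<le> ln 2 * (ent (B \<times> Y) \<rho>' - ent Y (ptr1 B \<rho>'))"
    unfolding right_diff_distrib ent_eq_ln[OF fin(1) s] ent_eq_ln[OF fin(2) s'] ent_eq_ln[OF X u] ent_eq_ln[OF Y u']
    by simp
  then show ?thesis by simp
qed

section \<open>Conditional mutual information\<close>

lemma kraus_tp_trace_kraus:
  assumes C: "finite C" and X: "finite X"
  shows "kraus_tp C (C \<times> X) X trace_kraus"
  unfolding kraus_tp_def
proof (intro ballI)
  fix p q :: "'a \<times> 'b" assume p: "p \<in> C \<times> X" "q \<in> C \<times> X"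
  have "(\<Sum>c\<in>C. \<Sum>x\<in>X. cnj (trace_kraus c x p) * trace_kraus c x q) =
      (\<Sum>c\<in>C. \<Sum>x\<in>X. if x = snd p then if c = fst p then if p = q then 1 else 0 else 0 else 0)"
    unfolding trace_kraus_def by (intro sum.cong refl) auto
  also have "\<dots> = (if p = q then 1 else 0)" using C X p by auto
  finally show "(\<Sum>c\<in>C. \<Sum>x\<in>X. cnj (trace_kraus c x p) * trace_kraus c x q) = (if p = q then 1 else 0)" .
qed

text \<open>Partial traces and local maps are set up for the first factor only; the middle factor is
  reached through this exchange.\<close>

definition swap12 ::
  "('a \<times> 'b \<times> 'e \<Rightarrow> 'a \<times> 'b \<times> 'e \<Rightarrow> complex) \<Rightarrow> 'b \<times> 'a \<times> 'e \<Rightarrow> 'b \<times> 'a \<times> 'e \<Rightarrow> complex" where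
  "swap12 \<omega> = (\<lambda>(b, a, e) (b', a', e'). \<omega> (a, b, e) (a', b', e'))"

lemma swap12_simp [simp]: "swap12 \<omega> (b, a, e) (b', a', e') = \<omega> (a, b, e) (a', b', e')"
  by (simp add: swap12_def)

lemma swap12_swap12 [simp]: "swap12 (swap12 \<omega>) = \<omega>"
  by (simp add: swap12_def fun_eq_iff)

lemma swap12_eq: "swap12 \<omega> p q = \<omega> ((\<lambda>(b, a, e). (a, b, e)) p) ((\<lambda>(b, a, e). (a, b, e)) q)"
  by (cases p, cases q) simp

lemma bij_swap12: "bij_betw (\<lambda>(b, a, e). (a, b, e)) (B \<times> A \<times> E) (A \<times> B \<times> E)"
  by (rule bij_betw_byWitness[where f' = "\<lambda>(a, b, e). (b, a, e)"]) auto

lemma pos_swap12: "pos (A \<times> B \<times> E) \<omega> \<Longrightarrow> pos (B \<times> A \<times> E) (swap12 \<omega>)"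
  using pos_reindex[OF bij_swap12] unfolding swap12_eq[abs_def] .

lemma ent_swap12:
  assumes "finite A" "finite B" "finite E" "herm (A \<times> B \<times> E) \<omega>"
  shows "ent (B \<times> A \<times> E) (swap12 \<omega>) = ent (A \<times> B \<times> E) \<omega>"
  by (rule ent_transfer[OF _ bij_swap12]) (use assms in \<open>auto simp: swap12_eq\<close>)

text \<open>Discarding C is a channel on the conditioning system C X, so it cannot decrease the
  conditional entropy of B.\<close>

theorem strong_subadditivity:
  assumes fin: "finite B" "finite C" "finite X" and p: "pos (B \<times> C \<times> X) \<rho>"
  shows "ent (B \<times> C \<times> X) \<rho> - ent (C \<times> X) (ptr1 B \<rho>) \<le>
    ent (B \<times> X) (ptr1 C (swap12 \<rho>)) - ent X (ptr1 B (ptr1 C (swap12 \<rho>)))"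
proof -
  let ?\<rho> = "kraus_map C (B \<times> C \<times> X) (\<lambda>c. tensor_id (trace_kraus c)) \<rho>"
  have eq: "?\<rho> u v = ptr1 C (swap12 \<rho>) u v" if "u \<in> B \<times> X" "v \<in> B \<times> X" for u v
    using that by (subst kraus_map_tensor_id[OF fin(1)]) (auto simp: kraus_map_trace[OF fin(2,3)] ptr1_def)
  have "ent (B \<times> C \<times> X) \<rho> - ent (C \<times> X) (ptr1 B \<rho>) \<le> ent (B \<times> X) ?\<rho> - ent X (ptr1 B ?\<rho>)"
    using fin by (intro conditional_entropy_mono kraus_tp_trace_kraus p) auto
  moreover have "ent (B \<times> X) ?\<rho> = ent (B \<times> X) (ptr1 C (swap12 \<rho>))" by (rule ent_cong) (rule eq)
  moreover have "ent X (ptr1 B ?\<rho>) = ent X (ptr1 B (ptr1 C (swap12 \<rho>)))"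
    by (rule ent_cong) (use eq in \<open>auto simp: ptr1_def[of B] intro!: sum.cong\<close>)
  ultimately show ?thesis by simp
qed

text \<open>\<open>register \<beta>\<close> is \<open>\<Sum>\<^sub>k |k\<rangle>\<langle>k| \<otimes> \<beta>\<^sub>k\<close>, with the classical register \<open>k\<close> placed in the middle.\<close>

definition register ::
  "('k \<Rightarrow> 'b \<times> 'z \<Rightarrow> 'b \<times> 'z \<Rightarrow> complex) \<Rightarrow> 'b \<times> 'k \<times> 'z \<Rightarrow> 'b \<times> 'k \<times> 'z \<Rightarrow> complex" where
  "register \<beta> = (\<lambda>(b, k, z) (b', k', z'). if k = k' then \<beta> k (b, z) (b', z') else 0)"

text \<open>The register makes both operators block diagonal with one block for each
  outcome.\<close>

lemma register_conditional_entropy: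
  assumes fin: "finite B" "finite K" "finite Z" and p: "\<And>k. k \<in> K \<Longrightarrow> pos (B \<times> Z) (\<beta> k)"
  shows "ent (B \<times> K \<times> Z) (register \<beta>) - ent (K \<times> Z) (ptr1 B (register \<beta>)) =
    (\<Sum>k\<in>K. ent (B \<times> Z) (\<beta> k) - ent Z (ptr1 B (\<beta> k)))"
proof -
  let ?blk = "\<lambda>\<beta> p q. if fst p = fst q then \<beta> (fst p) (snd p) (snd q) else 0"
  have finp: "finite (B \<times> Z)" using fin by simp
  have h: "herm (B \<times> Z) (\<beta> k)" if "k \<in> K" for k by (rule pos_herm[OF finp p[OF that]])
  have h': "herm Z (ptr1 B (\<beta> k))" if "k \<in> K" for k
    by (rule pos_herm[OF fin(3) pos_ptr1[OF fin(1,3) p[OF that]]])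
  have bij: "bij_betw (\<lambda>(b, k, z). (k, b, z)) (B \<times> K \<times> Z) (K \<times> B \<times> Z)"
    by (rule bij_swap12)
  have "ent (B \<times> K \<times> Z) (register \<beta>) = ent (K \<times> B \<times> Z) (?blk \<beta>)"
    by (rule ent_transfer[OF _ bij]) (use fin h in \<open>auto simp: register_def herm_def\<close>)
  also have "\<dots> = (\<Sum>k\<in>K. ent (B \<times> Z) (\<beta> k))"
    by (rule ent_blocks[OF fin(2) finp h])
  finally have 1: "ent (B \<times> K \<times> Z) (register \<beta>) = (\<Sum>k\<in>K. ent (B \<times> Z) (\<beta> k))" .
  have "ent (K \<times> Z) (ptr1 B (register \<beta>)) = ent (K \<times> Z) (?blk (\<lambda>k. ptr1 B (\<beta> k)))"
    by (rule ent_cong) (auto simp: register_def ptr1_def)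
  also have "\<dots> = (\<Sum>k\<in>K. ent Z (ptr1 B (\<beta> k)))"
    by (rule ent_blocks[OF fin(2,3) h'])
  finally show ?thesis using 1 by (simp add: sum_subtractf)
qed

lemma pos_register:
  assumes fin: "finite B" "finite K" "finite Z" and p: "\<And>k. k \<in> K \<Longrightarrow> pos (B \<times> Z) (\<beta> k)"
  shows "pos (B \<times> K \<times> Z) (register \<beta>)"
  unfolding pos_def
proof
  fix v :: "'a \<times> 'b \<times> 'c \<Rightarrow> complex"
  have "ip (B \<times> K \<times> Z) v (app (B \<times> K \<times> Z) (register \<beta>) v) =
      (\<Sum>b\<in>B. \<Sum>k\<in>K. \<Sum>z\<in>Z. \<Sum>b'\<in>B. \<Sum>k'\<in>K. if k' = k then \<Sum>z'\<in>Z. cnj (v (b, k, z)) * \<beta> k (b, z) (b', z') * v (b', k, z') else 0)"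
    unfolding ip_def app_def sum.cartesian_product' sum_distrib_left
    by (intro sum.cong refl) (auto simp: register_def mult.assoc)
  also have "\<dots> = (\<Sum>b\<in>B. \<Sum>k\<in>K. \<Sum>z\<in>Z. \<Sum>b'\<in>B. \<Sum>z'\<in>Z. cnj (v (b, k, z)) * \<beta> k (b, z) (b', z') * v (b', k, z'))"
    using fin(2) by (intro sum.cong refl) simp
  also have "\<dots> = (\<Sum>k\<in>K. ip (B \<times> Z) (\<lambda>(b, z). v (b, k, z)) (app (B \<times> Z) (\<beta> k) (\<lambda>(b, z). v (b, k, z))))"
    unfolding ip_def app_def sum.cartesian_product' sum_distrib_left
    by (subst sum.swap) (simp add: mult.assoc)
  finally show "0 \<le> ip (B \<times> K \<times> Z) v (app (B \<times> K \<times> Z) (register \<beta>) v)"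
    using p unfolding pos_def by (simp add: sum_nonneg)
qed

text \<open>Concavity of the conditional entropy, in its form for unnormalised operators. The
  left-hand side is the conditional entropy given Z and the register; discarding the register cannot
  decrease it.\<close>

lemma conditional_entropy_superadditive:
  assumes fin: "finite B" "finite K" "finite Z" and p: "\<And>k. k \<in> K \<Longrightarrow> pos (B \<times> Z) (\<beta> k)"
  defines "\<beta>s \<equiv> \<lambda>p q. \<Sum>k\<in>K. \<beta> k p q"
  shows "(\<Sum>k\<in>K. ent (B \<times> Z) (\<beta> k) - ent Z (ptr1 B (\<beta> k))) \<le> ent (B \<times> Z) \<beta>s - ent Z (ptr1 B \<beta>s)"
proof -
  have "ptr1 K (swap12 (register \<beta>)) = \<beta>s"
    unfolding \<beta>s_def by (intro ext) (auto simp: ptr1_def register_def)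
  moreover have "ent (B \<times> K \<times> Z) (register \<beta>) - ent (K \<times> Z) (ptr1 B (register \<beta>)) =
      (\<Sum>k\<in>K. ent (B \<times> Z) (\<beta> k) - ent Z (ptr1 B (\<beta> k)))"
    by (rule register_conditional_entropy[OF fin p])
  moreover have "pos (B \<times> K \<times> Z) (register \<beta>)" by (rule pos_register[OF fin p])
  ultimately show ?thesis using strong_subadditivity[OF fin, of "register \<beta>"] by simp
qed

lemma conditional_entropy_instrument:
  assumes fin: "finite B" "finite X" "finite Y" "finite K" "finite L"
    and tp: "kraus_tp (K \<times> L) X Y (\<lambda>(k, l). N k l)" and p: "pos (B \<times> X) \<rho>"
  defines "\<beta> \<equiv> \<lambda>k. kraus_map L (B \<times> X) (\<lambda>l. tensor_id (N k l)) \<rho>"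
  shows "ent (B \<times> X) \<rho> - ent X (ptr1 B \<rho>) \<le> (\<Sum>k\<in>K. ent (B \<times> Y) (\<beta> k) - ent Y (ptr1 B (\<beta> k)))"
proof -
  \<comment> \<open>The instrument as a single channel into K \<times> Y: the Kraus operator with
    label (k, l) writes k into the register.\<close>
  define M where "M = (\<lambda>(k, l) (k', y) x. if k' = k then N k l y x else 0)"
  have M: "kraus_tp (K \<times> L) X (K \<times> Y) M"
    unfolding kraus_tp_def
  proof (intro ballI)
    fix a b assume ab: "a \<in> X" "b \<in> X"
    have "(\<Sum>s\<in>K \<times> L. \<Sum>u\<in>K \<times> Y. cnj (M s u a) * M s u b) =
        (\<Sum>k\<in>K. \<Sum>l\<in>L. \<Sum>k'\<in>K. if k' = k then \<Sum>y\<in>Y. cnj (N k l y a) * N k l y b else 0)"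
      unfolding sum.cartesian_product' M_def by (intro sum.cong refl) auto
    also have "\<dots> = (\<Sum>s\<in>K \<times> L. \<Sum>y\<in>Y. cnj ((\<lambda>(k, l). N k l) s y a) * (\<lambda>(k, l). N k l) s y b)"
      unfolding sum.cartesian_product' using fin(4) by simp
    finally show "(\<Sum>s\<in>K \<times> L. \<Sum>u\<in>K \<times> Y. cnj (M s u a) * M s u b) = (if a = b then 1 else 0)"
      using kraus_tpD[OF tp ab] by simp
  qed
  let ?\<rho> = "kraus_map (K \<times> L) (B \<times> X) (\<lambda>s. tensor_id (M s)) \<rho>"
  have eq: "?\<rho> u v = register \<beta> u v" if uv: "u \<in> B \<times> K \<times> Y" "v \<in> B \<times> K \<times> Y" for u v
  proof -
    obtain b k y where u: "u = (b, k, y)" by (cases u)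
    obtain b' k' y' where v: "v = (b', k', y')" by (cases v)
    have m: "b \<in> B" "b' \<in> B" "k \<in> K" using uv u v by auto
    have "?\<rho> u v = kraus_map (K \<times> L) X M (\<lambda>x y. \<rho> (b, x) (b', y)) (k, y) (k', y')"
      using uv u v by (subst kraus_map_tensor_id[OF fin(1)]) auto
    also have "\<dots> = (\<Sum>c\<in>K. if c = k then if k = k' then
        \<Sum>l\<in>L. \<Sum>x\<in>X. \<Sum>x'\<in>X. N k l y x * \<rho> (b, x) (b', x') * cnj (N k l y' x') else 0 else 0)"
      unfolding kraus_map_def sum.cartesian_product' M_def by (intro sum.cong refl) auto
    also have "\<dots> = (if k = k' then kraus_map L X (N k) (\<lambda>x y. \<rho> (b, x) (b', y)) y y' else 0)"
      unfolding kraus_map_def using fin(4) m by simp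
    also have "\<dots> = register \<beta> u v"
      unfolding u v register_def \<beta>_def using m by (simp add: kraus_map_tensor_id[OF fin(1)])
    finally show ?thesis .
  qed
  have "ent (B \<times> X) \<rho> - ent X (ptr1 B \<rho>) \<le> ent (B \<times> K \<times> Y) ?\<rho> - ent (K \<times> Y) (ptr1 B ?\<rho>)"
    using fin by (intro conditional_entropy_mono M p) auto
  also have "ent (B \<times> K \<times> Y) ?\<rho> = ent (B \<times> K \<times> Y) (register \<beta>)" by (rule ent_cong) (rule eq)
  also have "ent (K \<times> Y) (ptr1 B ?\<rho>) = ent (K \<times> Y) (ptr1 B (register \<beta>))"
    by (rule ent_cong) (use eq in \<open>auto simp: ptr1_def intro!: sum.cong\<close>)
  also have "ent (B \<times> K \<times> Y) (register \<beta>) - ent (K \<times> Y) (ptr1 B (register \<beta>)) =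
      (\<Sum>k\<in>K. ent (B \<times> Y) (\<beta> k) - ent Y (ptr1 B (\<beta> k)))"
    using fin by (intro register_conditional_entropy) (auto simp: \<beta>_def intro: kraus_pos[OF p])
  finally show ?thesis .
qed

section \<open>Instruments of one party and conditional mutual information\<close>

definition id_tensor :: "('x \<Rightarrow> 'y \<Rightarrow> complex) \<Rightarrow> 'x \<times> 'c \<Rightarrow> 'y \<times> 'c \<Rightarrow> complex" where
  "id_tensor K p q = (if snd p = snd q then K (fst p) (fst q) else 0)"

lemma sum_id_tensor_left:
  assumes "finite C" "c \<in> C"
  shows "(\<Sum>q\<in>X \<times> C. id_tensor K (x, c) q * h q) = (\<Sum>y\<in>X. K x y * h (y, c))"
proof -
  have "(\<Sum>q\<in>X \<times> C. id_tensor K (x, c) q * h q) = (\<Sum>y\<in>X. \<Sum>d\<in>C. if d = c then K x y * h (y, c) else 0)"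
    unfolding sum.cartesian_product' id_tensor_def by (intro sum.cong refl) auto
  then show ?thesis using assms by simp
qed

lemma kraus_map_id_tensor:
  assumes C: "finite C" and p: "snd p \<in> C" "snd q \<in> C"
  shows "kraus_map L (X \<times> C) (\<lambda>l. id_tensor (K l)) \<rho> p q =
    kraus_map L X K (\<lambda>x y. \<rho> (x, snd p) (y, snd q)) (fst p) (fst q)"
proof -
  obtain x b y c where [simp]: "p = (x, b)" "q = (y, c)" by (cases p, cases q)
  have "kraus_map L (X \<times> C) (\<lambda>l. id_tensor (K l)) \<rho> p q =
     (\<Sum>l\<in>L. \<Sum>u\<in>X \<times> C. id_tensor (K l) (x, b) u * cnj (\<Sum>v\<in>X \<times> C. id_tensor (K l) (y, c) v * cnj (\<rho> u v)))"
    unfolding kraus_map_def cnj_sum sum_distrib_left by (simp add: mult_ac)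
  also have "\<dots> = (\<Sum>l\<in>L. \<Sum>a\<in>X. K l x a * cnj (\<Sum>d\<in>X. K l y d * cnj (\<rho> (a, b) (d, c))))"
    using p by (simp only: \<open>p = (x, b)\<close> \<open>q = (y, c)\<close> snd_conv sum_id_tensor_left[OF C])
  also have "\<dots> = kraus_map L X K (\<lambda>x y. \<rho> (x, b) (y, c)) x y"
    unfolding kraus_map_def cnj_sum sum_distrib_left by (simp add: mult_ac)
  finally show ?thesis by simp
qed

lemma kraus_tp_id_tensor:
  assumes C: "finite C" and tp: "kraus_tp L X Y K"
  shows "kraus_tp L (X \<times> C) (Y \<times> C) (\<lambda>l. id_tensor (K l))"
  unfolding kraus_tp_def
proof (intro ballI)
  fix p q assume p: "p \<in> X \<times> C" and q: "q \<in> X \<times> C"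
  obtain x b y c where [simp]: "p = (x, b)" "q = (y, c)" by (cases p, cases q)
  have "(\<Sum>l\<in>L. \<Sum>u\<in>Y \<times> C. cnj (id_tensor (K l) u p) * id_tensor (K l) u q) =
      (\<Sum>l\<in>L. \<Sum>z\<in>Y. \<Sum>d\<in>C. if d = b then if b = c then cnj (K l z x) * K l z y else 0 else 0)"
    unfolding sum.cartesian_product' id_tensor_def by (intro sum.cong refl) auto
  also have "\<dots> = (if b = c then \<Sum>l\<in>L. \<Sum>z\<in>Y. cnj (K l z x) * K l z y else 0)"
    using p C by simp
  also have "\<dots> = (if p = q then 1 else 0)" using kraus_tpD[OF tp, of x y] p q by auto
  finally show "(\<Sum>l\<in>L. \<Sum>u\<in>Y \<times> C. cnj (id_tensor (K l) u p) * id_tensor (K l) u q) = (if p = q then 1 else 0)" .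
qed

text \<open>The Kraus operators act on the first index, and the indices of all other factors are
  mere parameters, so no index set for them has to be named. For a finite set of them this is the
  Kraus map with operators \<open>id_tensor (K l)\<close>.\<close>

definition local_map where
  "local_map L A K \<omega> p q = kraus_map L A K (\<lambda>a c. \<omega> (a, snd p) (c, snd q)) (fst p) (fst q)"

lemma pos_local_map:
  assumes "finite C" "pos (A \<times> C) \<omega>"
  shows "pos (A' \<times> C) (local_map L A K \<omega>)"
proof -
  have "pos (A' \<times> C) (local_map L A K \<omega>) = pos (A' \<times> C) (kraus_map L (A \<times> C) (\<lambda>l. id_tensor (K l)) \<omega>)"
    by (rule pos_cong) (auto simp: kraus_map_id_tensor[OF assms(1)] local_map_def)
  then show ?thesis using kraus_pos[OF assms(2)] by simp
qed

text \<open>No signalling: summed over the outcomes the instrument preserves the trace on A, so the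
  other systems do not notice it.\<close>

lemma ptr1_local_map:
  assumes A: "finite A" and tp: "kraus_tp (S \<times> L) A A' (\<lambda>(k, l). K k l)"
  shows "(\<Sum>k\<in>S. ptr1 A' (local_map L A (K k) \<omega>) u v) = ptr1 A \<omega> u v"
proof -
  have "(\<Sum>k\<in>S. ptr1 A' (local_map L A (K k) \<omega>) u v) =
      (\<Sum>x\<in>A'. kraus_map (S \<times> L) A (\<lambda>(k, l). K k l) (\<lambda>a c. \<omega> (a, u) (c, v)) x x)"
    unfolding ptr1_def local_map_def kraus_map_def
    by (subst sum.swap) (simp add: sum.cartesian_product')
  also have "\<dots> = ptr1 A \<omega> u v"
    unfolding ptr1_def by (rule kraus_tp_trace[OF A tp])
  finally show ?thesis .
qed

definition cmi ::
  "'a set \<Rightarrow> 'b set \<Rightarrow> 'e set \<Rightarrow> ('a \<times> 'b \<times> 'e \<Rightarrow> 'a \<times> 'b \<times> 'e \<Rightarrow> complex) \<Rightarrow> real" where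
  "cmi A B E \<omega> = ent (A \<times> E) (ptr1 B (swap12 \<omega>)) + ent (B \<times> E) (ptr1 A \<omega>)
     - ent (A \<times> B \<times> E) \<omega> - ent E (ptr1 B (ptr1 A \<omega>))"

lemma ptr1_swap12: "ptr1 A (ptr1 B (swap12 \<omega>)) = ptr1 B (ptr1 A \<omega>)"
  unfolding ptr1_def swap12_simp by (intro ext, rule sum.swap)

lemma cmi_swap:
  assumes "finite A" "finite B" "finite E" "pos (A \<times> B \<times> E) \<omega>"
  shows "cmi B A E (swap12 \<omega>) = cmi A B E \<omega>"
  using ent_swap12[OF assms(1-3) pos_herm[OF _ assms(4)]] assms(1-3)
  unfolding cmi_def by (simp add: ptr1_swap12)

text \<open>Strong subadditivity in the form S(B|AE) \<le> S(B|E). Later this bounds the infimum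
  defining squashed entanglement from below.\<close>

theorem cmi_nonneg:
  assumes fin: "finite A" "finite B" "finite E" and p: "pos (A \<times> B \<times> E) \<omega>"
  shows "0 \<le> cmi A B E \<omega>"
  using strong_subadditivity[OF fin(2,1,3) pos_swap12[OF p]] ent_swap12[OF fin pos_herm[OF _ p]] fin
  unfolding cmi_def by simp

theorem cmi_instrument:
  assumes fin: "finite A" "finite B" "finite E" "finite A'" "finite S" "finite L"
    and tp: "kraus_tp (S \<times> L) A A' (\<lambda>(k, l). K k l)" and p: "pos (A \<times> B \<times> E) \<omega>"
  shows "(\<Sum>k\<in>S. cmi A' B E (local_map L A (K k) \<omega>)) \<le> cmi A B E \<omega>"
proof -
  define \<omega>' where "\<omega>' k = local_map L A (K k) \<omega>" for k
  have p': "pos (A' \<times> B \<times> E) (\<omega>' k)" for k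
    unfolding \<omega>'_def by (rule pos_local_map) (use fin p in auto)
  \<comment> \<open>The same operations with B moved to the front, so that the instrument acts on
    the conditioning system A E.\<close>
  define \<beta> where "\<beta> k = kraus_map L (B \<times> A \<times> E) (\<lambda>l. tensor_id (id_tensor (K k l))) (swap12 \<omega>)" for k
  have eq: "\<beta> k u v = swap12 (\<omega>' k) u v" if "u \<in> B \<times> A' \<times> E" "v \<in> B \<times> A' \<times> E" for k u v
    using that unfolding \<beta>_def \<omega>'_def local_map_def
    by (subst kraus_map_tensor_id[OF fin(2)])
      (auto simp: kraus_map_id_tensor[OF fin(3)])
  have tp': "kraus_tp (S \<times> L) (A \<times> E) (A' \<times> E) (\<lambda>(k, l). id_tensor (K k l))"
    using kraus_tp_id_tensor[OF fin(3) tp] by (simp add: split_def)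
  have "ent (B \<times> A \<times> E) (swap12 \<omega>) - ent (A \<times> E) (ptr1 B (swap12 \<omega>)) \<le>
      (\<Sum>k\<in>S. ent (B \<times> A' \<times> E) (\<beta> k) - ent (A' \<times> E) (ptr1 B (\<beta> k)))"
    unfolding \<beta>_def
    by (rule conditional_entropy_instrument[OF fin(2) _ _ fin(5,6) tp' pos_swap12[OF p]]) (use fin in auto)
  also have "\<dots> = (\<Sum>k\<in>S. ent (A' \<times> B \<times> E) (\<omega>' k) - ent (A' \<times> E) (ptr1 B (swap12 (\<omega>' k))))"
  proof (rule sum.cong[OF refl])
    fix k
    have "ent (B \<times> A' \<times> E) (\<beta> k) = ent (B \<times> A' \<times> E) (swap12 (\<omega>' k))" by (rule ent_cong) (rule eq)
    moreover have "ent (A' \<times> E) (ptr1 B (\<beta> k)) = ent (A' \<times> E) (ptr1 B (swap12 (\<omega>' k)))"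
      by (rule ent_cong) (use eq in \<open>auto simp: ptr1_def intro!: sum.cong\<close>)
    ultimately show "ent (B \<times> A' \<times> E) (\<beta> k) - ent (A' \<times> E) (ptr1 B (\<beta> k)) =
        ent (A' \<times> B \<times> E) (\<omega>' k) - ent (A' \<times> E) (ptr1 B (swap12 (\<omega>' k)))"
      using ent_swap12[OF fin(4,2,3) pos_herm[OF _ p']] fin by simp
  qed
  finally have 1: "ent (A \<times> B \<times> E) \<omega> - ent (A \<times> E) (ptr1 B (swap12 \<omega>)) \<le>
      (\<Sum>k\<in>S. ent (A' \<times> B \<times> E) (\<omega>' k) - ent (A' \<times> E) (ptr1 B (swap12 (\<omega>' k))))"
    using ent_swap12[OF fin(1-3) pos_herm[OF _ p]] fin by simp
  \<comment> \<open>The outcome marginals on B E add up to the original one, so superadditivity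
    bounds the sum of the terms S(B|E).\<close>
  have "(\<Sum>k\<in>S. ptr1 A' (\<omega>' k) u v) = ptr1 A \<omega> u v" for u v
    unfolding \<omega>'_def by (rule ptr1_local_map[OF fin(1) tp])
  then have "(\<Sum>k\<in>S. ent (B \<times> E) (ptr1 A' (\<omega>' k)) - ent E (ptr1 B (ptr1 A' (\<omega>' k))))
      \<le> ent (B \<times> E) (ptr1 A \<omega>) - ent E (ptr1 B (ptr1 A \<omega>))"
    using conditional_entropy_superadditive[OF fin(2,5,3), of "\<lambda>k. ptr1 A' (\<omega>' k)"]
      pos_ptr1[OF fin(4) _ p'] fin by simp
  with 1 show ?thesis
    unfolding cmi_def \<omega>'_def[symmetric] by (simp add: sum.distrib sum_subtractf)
qed

lemma cmi_cong:
  assumes "\<And>p q. p \<in> A \<times> B \<times> E \<Longrightarrow> q \<in> A \<times> B \<times> E \<Longrightarrow> \<omega> p q = \<omega>' p q"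
  shows "cmi A B E \<omega> = cmi A B E \<omega>'"
proof -
  have "ent (A \<times> E) (ptr1 B (swap12 \<omega>)) = ent (A \<times> E) (ptr1 B (swap12 \<omega>'))"
    by (rule ent_cong) (use assms in \<open>auto simp: ptr1_def intro!: sum.cong\<close>)
  moreover have "ent (B \<times> E) (ptr1 A \<omega>) = ent (B \<times> E) (ptr1 A \<omega>')"
    by (rule ent_cong) (use assms in \<open>auto simp: ptr1_def intro!: sum.cong\<close>)
  moreover have "ent (A \<times> B \<times> E) \<omega> = ent (A \<times> B \<times> E) \<omega>'" by (rule ent_cong) (rule assms)
  moreover have "ent E (ptr1 B (ptr1 A \<omega>)) = ent E (ptr1 B (ptr1 A \<omega>'))"
    by (rule ent_cong) (use assms in \<open>auto simp: ptr1_def intro!: sum.cong\<close>)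
  ultimately show ?thesis unfolding cmi_def by simp
qed

lemma marginals_pos:
  assumes "finite A" "finite B" "finite E" "pos (A \<times> B \<times> E) \<omega>"
  shows "pos (A \<times> E) (ptr1 B (swap12 \<omega>))" "pos (B \<times> E) (ptr1 A \<omega>)" "pos E (ptr1 B (ptr1 A \<omega>))"
  using assms by (auto intro!: pos_ptr1 pos_swap12)

lemma marginals_herm:
  assumes "finite A" "finite B" "finite E" "pos (A \<times> B \<times> E) \<omega>"
  shows "herm (A \<times> E) (ptr1 B (swap12 \<omega>))" "herm (B \<times> E) (ptr1 A \<omega>)" "herm E (ptr1 B (ptr1 A \<omega>))"
    "herm (A \<times> B \<times> E) \<omega>"
  using assms marginals_pos[OF assms] by (auto intro!: pos_herm)

lemma cmi_reindex:
  assumes fin: "finite A" "finite B" "finite E" and f: "bij_betw f E' E" and p: "pos (A \<times> B \<times> E) \<omega>"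
  shows "cmi A B E' (\<lambda>(a, b, e) (a', b', e'). \<omega> (a, b, f e) (a', b', f e')) = cmi A B E \<omega>"
proof -
  note h = marginals_herm[OF fin p]
  have b1: "bij_betw (map_prod id f) (X \<times> E') (X \<times> E)" for X :: "'x set"
    using f by (rule bij_betw_map_prod[OF bij_betw_id])
  have b2: "bij_betw (map_prod id (map_prod id f)) (A \<times> B \<times> E') (A \<times> B \<times> E)"
    by (rule bij_betw_map_prod[OF bij_betw_id b1])
  let ?\<omega> = "\<lambda>(a, b, e) (a', b', e'). \<omega> (a, b, f e) (a', b', f e')"
  have "ent (A \<times> E') (ptr1 B (swap12 ?\<omega>)) = ent (A \<times> E) (ptr1 B (swap12 \<omega>))"
    by (rule ent_transfer[OF _ b1 h(1)]) (use fin in \<open>auto simp: ptr1_def\<close>)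
  moreover have "ent (B \<times> E') (ptr1 A ?\<omega>) = ent (B \<times> E) (ptr1 A \<omega>)"
    by (rule ent_transfer[OF _ b1 h(2)]) (use fin in \<open>auto simp: ptr1_def\<close>)
  moreover have "ent (A \<times> B \<times> E') ?\<omega> = ent (A \<times> B \<times> E) \<omega>"
    by (rule ent_transfer[OF _ b2 h(4)]) (use fin in \<open>auto simp: ptr1_def\<close>)
  moreover have "ent E' (ptr1 B (ptr1 A ?\<omega>)) = ent E (ptr1 B (ptr1 A \<omega>))"
    by (rule ent_transfer[OF _ f h(3)]) (use fin in \<open>auto simp: ptr1_def\<close>)
  ultimately show ?thesis unfolding cmi_def by simp
qed

text \<open>All four operators whose entropies enter are block diagonal for the splitting of the
  environment, so each entropy is additive.\<close>

lemma cmi_union: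
  assumes fin: "finite A" "finite B" "finite E" "finite F" and dis: "E \<inter> F = {}"
    and p: "pos (A \<times> B \<times> E) \<omega>" "pos (A \<times> B \<times> F) \<omega>"
    and z: "\<And>a b e a' b' e'. e \<in> E \<Longrightarrow> e' \<in> F \<Longrightarrow> \<omega> (a, b, e) (a', b', e') = 0"
      "\<And>a b e a' b' e'. e \<in> E \<Longrightarrow> e' \<in> F \<Longrightarrow> \<omega> (a', b', e') (a, b, e) = 0"
  shows "cmi A B (E \<union> F) \<omega> = cmi A B E \<omega> + cmi A B F \<omega>"
proof -
  note h = marginals_herm[OF fin(1-3) p(1)] and k = marginals_herm[OF fin(1,2,4) p(2)]
  have e: "A \<times> (E \<union> F) = A \<times> E \<union> A \<times> F" "B \<times> (E \<union> F) = B \<times> E \<union> B \<times> F"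
    "A \<times> B \<times> (E \<union> F) = A \<times> B \<times> E \<union> A \<times> B \<times> F" by auto
  have "ent (A \<times> (E \<union> F)) (ptr1 B (swap12 \<omega>)) = ent (A \<times> E) (ptr1 B (swap12 \<omega>)) + ent (A \<times> F) (ptr1 B (swap12 \<omega>))"
    unfolding e by (rule ent_union[OF _ _ _ h(1) k(1)]) (use fin dis z in \<open>auto simp: ptr1_def\<close>)
  moreover have "ent (B \<times> (E \<union> F)) (ptr1 A \<omega>) = ent (B \<times> E) (ptr1 A \<omega>) + ent (B \<times> F) (ptr1 A \<omega>)"
    unfolding e by (rule ent_union[OF _ _ _ h(2) k(2)]) (use fin dis z in \<open>auto simp: ptr1_def\<close>)
  moreover have "ent (A \<times> B \<times> (E \<union> F)) \<omega> = ent (A \<times> B \<times> E) \<omega> + ent (A \<times> B \<times> F) \<omega>"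
    unfolding e(3) by (rule ent_union[OF _ _ _ h(4) k(4)]) (use fin dis z in \<open>auto simp: ptr1_def\<close>)
  moreover have "ent (E \<union> F) (ptr1 B (ptr1 A \<omega>)) = ent E (ptr1 B (ptr1 A \<omega>)) + ent F (ptr1 B (ptr1 A \<omega>))"
    by (rule ent_union[OF _ _ _ h(3) k(3)]) (use fin dis z in \<open>auto simp: ptr1_def\<close>)
  ultimately show ?thesis unfolding cmi_def by simp
qed

lemma ptr1_trace: "(\<Sum>x\<in>X. ptr1 B \<rho> x x) = (\<Sum>p\<in>B \<times> X. \<rho> p p)"
  unfolding ptr1_def sum.cartesian_product' by (rule sum.swap)

text \<open>Each entropy acquires c log c times a trace by \<open>ent_scale\<close>. The four traces
  are equal and occur twice with either sign, so these terms cancel.\<close>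

lemma cmi_scale:
  assumes fin: "finite A" "finite B" "finite E" and p: "pos (A \<times> B \<times> E) \<omega>" and c: "0 \<le> c"
  shows "cmi A B E (\<lambda>p q. complex_of_real c * \<omega> p q) = c * cmi A B E \<omega>"
proof -
  note q = marginals_pos[OF fin p]
  have s: "swap12 (\<lambda>p q. complex_of_real c * \<omega> p q) = (\<lambda>p q. complex_of_real c * swap12 \<omega> p q)"
    by (auto simp: swap12_def fun_eq_iff)
  have m: "ptr1 Z (\<lambda>p q. complex_of_real c * \<rho> p q) = (\<lambda>p q. complex_of_real c * ptr1 Z \<rho> p q)"
    for Z :: "'z set" and \<rho> :: "'z \<times> 'y \<Rightarrow> 'z \<times> 'y \<Rightarrow> complex"
    by (auto simp: ptr1_def fun_eq_iff sum_distrib_left)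
  have t: "(\<Sum>p\<in>B \<times> A \<times> E. swap12 \<omega> p p) = (\<Sum>p\<in>A \<times> B \<times> E. \<omega> p p)"
    unfolding swap12_eq by (rule sum.reindex_bij_betw[OF bij_swap12])
  have fin': "finite (A \<times> E)" "finite (B \<times> E)" "finite (A \<times> B \<times> E)" using fin by auto
  show ?thesis
    unfolding cmi_def s m ent_scale[OF fin'(1) q(1) c] ent_scale[OF fin'(2) q(2) c]
      ent_scale[OF fin(3) q(3) c] ent_scale[OF fin'(3) p c] ptr1_trace t
    by (simp add: algebra_simps)
qed

section \<open>Matrices as kernels\<close>

abbreviation entry :: "complex mat \<Rightarrow> nat \<Rightarrow> nat \<Rightarrow> complex" where
  "entry M x y \<equiv> M $$ (x, y)"

lemma pair_less: "a < p \<Longrightarrow> c < q \<Longrightarrow> a * q + c < p * (q::nat)"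
  by (metis add.commute add_less_cancel_left less_le_trans mult_Suc mult_le_mono1 Suc_leI)

lemma bij_pair: "bij_betw (\<lambda>(a, c). a * q + c) ({..<p} \<times> {..<q}) {..<p * q :: nat}"
proof (rule bij_betw_byWitness[where f' = "\<lambda>x. (x div q, x mod q)"])
  show "(\<lambda>x. (x div q, x mod q)) ` {..<p * q} \<subseteq> {..<p} \<times> {..<q}"
    by (auto simp: less_mult_imp_div_less intro!: mod_less_divisor) (metis gr0I mult_0_right not_less_zero)
qed (auto simp: pair_less)

lemma tidx_less: "a < p \<Longrightarrow> i < n \<Longrightarrow> c < q \<Longrightarrow> tidx n q a i c < p * n * q"
  unfolding tidx_def by (intro pair_less)

lemma tidx_assoc: "tidx n q a i c = a * (n * q) + (i * q + c)"
  unfolding tidx_def by (simp add: algebra_simps)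

lemma tidx_div_mod [simp]:
  assumes "i < n" "c < q"
  shows "tidx n q a i c div q = a * n + i" "tidx n q a i c mod q = c" "tidx n q a i c div (n * q) = a"
    "tidx n q a i c div q mod n = i"
proof -
  show "tidx n q a i c div (n * q) = a"
    unfolding tidx_assoc
    by (subst div_mult_self3) (use assms pair_less[OF assms] in auto)
qed (use assms in \<open>simp_all add: tidx_def\<close>)

lemma bij_tidx: "bij_betw (\<lambda>(a, i, c). tidx n q a i c) ({..<p} \<times> {..<n} \<times> {..<q}) {..<p * n * q}"
proof (rule bij_betw_byWitness[where f' = "\<lambda>x. (x div (n * q), x div q mod n, x mod q)"])
  show "\<forall>x\<in>{..<p * n * q}. (\<lambda>(a, i, c). tidx n q a i c) (x div (n * q), x div q mod n, x mod q) = x"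
    by (auto simp: tidx_def mult.commute[of n q] div_mult2_eq)
  show "(\<lambda>x. (x div (n * q), x div q mod n, x mod q)) ` {..<p * n * q} \<subseteq> {..<p} \<times> {..<n} \<times> {..<q}"
  proof (clarsimp)
    fix x assume x: "x < p * n * q"
    then have "n > 0" "q > 0" by (auto intro!: gr0I)
    then show "x div (n * q) < p \<and> x div q mod n < n \<and> x mod q < q"
      using x less_mult_imp_div_less[of x p "n * q"] by (simp add: mult.assoc)
  qed
qed (auto simp: tidx_less)

definition ker3 :: "nat \<Rightarrow> nat \<Rightarrow> complex mat \<Rightarrow> nat \<times> nat \<times> nat \<Rightarrow> nat \<times> nat \<times> nat \<Rightarrow> complex" where
  "ker3 n q M = (\<lambda>(a, i, c) (b, j, d). M $$ (tidx n q a i c, tidx n q b j d))"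

lemma ker3_simp [simp]: "ker3 n q M (a, i, c) (b, j, d) = M $$ (tidx n q a i c, tidx n q b j d)"
  by (simp add: ker3_def)

lemma psd_carrier: "psd n M \<Longrightarrow> M \<in> carrier_mat n n"
  unfolding psd_def by simp

lemma psd_iff_pos: "psd n M \<longleftrightarrow> M \<in> carrier_mat n n \<and> pos {..<n} (entry M)"
proof (cases "M \<in> carrier_mat n n")
  case True
  have e: "(M *\<^sub>v v) \<bullet>c v = ip {..<n} (\<lambda>i. v $ i) (app {..<n} (entry M) (\<lambda>i. v $ i))"
    if "v \<in> carrier_vec n" for v
    using that True
    by (simp add: scalar_prod_def ip_def app_def lessThan_atLeast0 mult.commute)
  have c: "ip {..<n} w (app {..<n} (entry M) w) =
      ip {..<n} (\<lambda>i. vec n w $ i) (app {..<n} (entry M) (\<lambda>i. vec n w $ i))" for w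
    by (simp add: ip_def app_def)
  show ?thesis
  proof
    assume psd: "psd n M"
    have "0 \<le> ip {..<n} w (app {..<n} (entry M) w)" for w
    proof -
      have "0 \<le> (M *\<^sub>v vec n w) \<bullet>c vec n w" using psd vec_carrier unfolding psd_def by blast
      then show ?thesis unfolding e[OF vec_carrier] c[of w] .
    qed
    then show "M \<in> carrier_mat n n \<and> pos {..<n} (entry M)" using True unfolding pos_def by simp
  next
    assume "M \<in> carrier_mat n n \<and> pos {..<n} (entry M)"
    then show "psd n M" unfolding psd_def pos_def using e by simp
  qed
qed (simp add: psd_def)

lemma pos_transfer:
  assumes f: "bij_betw f J I" and p: "pos J \<rho>'" and eq: "\<And>x y. x \<in> J \<Longrightarrow> y \<in> J \<Longrightarrow> \<rho>' x y = \<rho> (f x) (f y)"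
  shows "pos I \<rho>"
proof -
  let ?g = "inv_into J f"
  have "pos I (\<lambda>x y. \<rho>' (?g x) (?g y))" by (rule pos_reindex[OF bij_betw_inv_into[OF f] p])
  moreover have "\<rho>' (?g x) (?g y) = \<rho> x y" if "x \<in> I" "y \<in> I" for x y
    using that eq[of "?g x" "?g y"] f
    by (metis bij_betw_def bij_betw_inv_into_right inv_into_into)
  ultimately show ?thesis using pos_cong[of I "\<lambda>x y. \<rho>' (?g x) (?g y)" \<rho>] by simp
qed

lemma psd_ker3: "psd (p * n * q) M \<Longrightarrow> pos ({..<p} \<times> {..<n} \<times> {..<q}) (ker3 n q M)"
proof -
  assume "psd (p * n * q) M"
  then have "pos {..<p * n * q} (entry M)" unfolding psd_iff_pos by simp
  from pos_reindex[OF bij_tidx this] show ?thesis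
    by (subst pos_cong[where \<rho>' = "\<lambda>x y. M $$ ((\<lambda>(a, i, c). tidx n q a i c) x, (\<lambda>(a, i, c). tidx n q a i c) y)"]) auto
qed

lemma psd_ker3I:
  assumes "M \<in> carrier_mat (p * n * q) (p * n * q)" "pos ({..<p} \<times> {..<n} \<times> {..<q}) (ker3 n q M)"
  shows "psd (p * n * q) M"
  unfolding psd_iff_pos
proof
  show "pos {..<p * n * q} (entry M)"
    by (rule pos_transfer[OF bij_tidx assms(2)]) auto
qed (rule assms(1))

section \<open>Functional calculus and entropy of matrices\<close>

lemma mat_adjoint_index:
  assumes "U \<in> carrier_mat n n" "j < n" "y < n"
  shows "mat_adjoint U $$ (j, y) = cnj (U $$ (y, j))"
  using assms by (simp add: mat_adjoint_def mat_of_rows_def)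

lemma mat_adjoint_carrier: "U \<in> carrier_mat n n \<Longrightarrow> mat_adjoint U \<in> carrier_mat n n"
  unfolding mat_adjoint_def by auto

lemma conjugation_index:
  assumes U: "U \<in> carrier_mat n n" and xy: "x < n" "y < n"
  shows "(U * mat_diag n D * mat_adjoint U) $$ (x, y) = (\<Sum>j<n. D j * U $$ (x, j) * cnj (U $$ (y, j)))"
proof -
  have "dim_row (mat_adjoint U) = n" "dim_col (mat_adjoint U) = n"
    using mat_adjoint_carrier[OF U] by auto
  then show ?thesis
    using U xy by (subst mat_diag_mult_right[OF U])
      (simp add: scalar_prod_def mat_adjoint_index[OF U] lessThan_atLeast0 mult_ac)
qed

text \<open>\<open>herm_fun\<close> demands only that U times its adjoint is 1. For square matrices
  the product in the other order is then 1 too, which is the orthonormality of the columns.\<close>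

lemma spectral_unitary:
  assumes U: "U \<in> carrier_mat n n" "U * mat_adjoint U = 1\<^sub>m n"
    and M: "M = U * mat_diag n (\<lambda>i. complex_of_real (d i)) * mat_adjoint U"
  shows "spectral {..<n} (entry M) (\<lambda>j x. U $$ (x, j)) d"
proof -
  have A: "mat_adjoint U \<in> carrier_mat n n" by (rule mat_adjoint_carrier[OF U(1)])
  have "mat_adjoint U * U = 1\<^sub>m n" by (rule mat_mult_left_right_inverse[OF U(1) A U(2)])
  then have 1: "(mat_adjoint U * U) $$ (j, k) = (if j = k then 1 else 0)" if "j < n" "k < n" for j k
    using that by simp
  have 2: "(U * mat_adjoint U) $$ (j, k) = (if j = k then 1 else 0)" if "j < n" "k < n" for j k
    using that U(2) by simp
  have dims: "dim_row (mat_adjoint U) = n" "dim_col (mat_adjoint U) = n" "dim_row U = n" "dim_col U = n"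
    using A U by auto
  show ?thesis
    unfolding spectral_def onb_def ip_def
  proof (intro conjI ballI)
    fix j k assume jk: "j \<in> {..<n}" "k \<in> {..<n}"
    show "(\<Sum>x<n. cnj (U $$ (x, j)) * U $$ (x, k)) = (if j = k then 1 else 0)"
      using 1[of j k] jk by (simp add: dims scalar_prod_def mat_adjoint_index[OF U(1)] lessThan_atLeast0)
    show "(\<Sum>i<n. U $$ (j, i) * cnj (U $$ (k, i))) = (if j = k then 1 else 0)"
      using 2[of j k] jk by (simp add: dims scalar_prod_def mat_adjoint_index[OF U(1)] lessThan_atLeast0)
    show "M $$ (j, k) = (\<Sum>i<n. complex_of_real (d i) * U $$ (j, i) * cnj (U $$ (k, i)))"
      unfolding M using jk by (simp add: conjugation_index[OF U(1)])
  qed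
qed

lemma unitary_of_spectral:
  assumes M: "M \<in> carrier_mat n n" and s: "spectral {..<n} (entry M) e d"
  defines "U \<equiv> mat n n (\<lambda>(x, j). e j x)"
  shows "U \<in> carrier_mat n n" "U * mat_adjoint U = 1\<^sub>m n"
    "M = U * mat_diag n (\<lambda>i. complex_of_real (d i)) * mat_adjoint U"
proof -
  show U: "U \<in> carrier_mat n n" unfolding U_def by simp
  note A = mat_adjoint_carrier[OF U]
  show "U * mat_adjoint U = 1\<^sub>m n"
  proof (rule eq_matI)
    fix i j assume ij: "i < dim_row (1\<^sub>m n)" "j < dim_col (1\<^sub>m n)"
    have dims: "dim_row (mat_adjoint U) = n" "dim_col (mat_adjoint U) = n" "dim_row U = n" "dim_col U = n"
      using A U by auto
    have "(U * mat_adjoint U) $$ (i, j) = (\<Sum>k<n. U $$ (i, k) * cnj (U $$ (j, k)))"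
      using ij by (simp add: dims scalar_prod_def mat_adjoint_index[OF U] lessThan_atLeast0)
    also have "\<dots> = (\<Sum>k<n. e k i * cnj (e k j))" using ij by (simp add: U_def)
    finally have "(U * mat_adjoint U) $$ (i, j) = (\<Sum>k<n. e k i * cnj (e k j))" .
    then show "(U * mat_adjoint U) $$ (i, j) = 1\<^sub>m n $$ (i, j)"
      using onb_complete[OF spectral_onb[OF s], of i j] ij by simp
  qed (use U A in auto)
  show "M = U * mat_diag n (\<lambda>i. complex_of_real (d i)) * mat_adjoint U"
  proof (rule eq_matI)
    fix i j assume "i < dim_row (U * mat_diag n (\<lambda>i. complex_of_real (d i)) * mat_adjoint U)"
      "j < dim_col (U * mat_diag n (\<lambda>i. complex_of_real (d i)) * mat_adjoint U)"
    then have ij: "i < n" "j < n" using U A by auto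
    show "M $$ (i, j) = (U * mat_diag n (\<lambda>i. complex_of_real (d i)) * mat_adjoint U) $$ (i, j)"
      unfolding conjugation_index[OF U ij] using spectral_eq[OF s, of i j] ij
      by (simp add: U_def)
  qed (use U A M in auto)
qed

text \<open>Overlaps between eigenvectors of different eigenvalues vanish, so \<phi>(r_j) may be
  replaced by \<phi>(r'_k) in the double expansion. This gives the uniqueness that the definite
  description in \<open>herm_fun\<close> requires.\<close>

lemma spectral_fun_unique:
  fixes \<phi> :: "real \<Rightarrow> real"
  assumes I: "finite I" and s: "spectral I \<rho> e r" and s': "spectral I \<rho> e' r'" and xy: "x \<in> I" "y \<in> I"
  shows "(\<Sum>j\<in>I. complex_of_real (\<phi> (r j)) * e j x * cnj (e j y)) =
    (\<Sum>k\<in>I. complex_of_real (\<phi> (r' k)) * e' k x * cnj (e' k y))"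
proof -
  note o = spectral_onb[OF s] and o' = spectral_onb[OF s']
  have w: "complex_of_real (\<phi> (r j)) * ip I (e' k) (e j) = complex_of_real (\<phi> (r' k)) * ip I (e' k) (e j)"
    if jk: "j \<in> I" "k \<in> I" for j k
    using spectral_overlap[OF I s s' jk] by auto
  have "(\<Sum>j\<in>I. complex_of_real (\<phi> (r j)) * e j x * cnj (e j y)) =
      (\<Sum>j\<in>I. \<Sum>k\<in>I. complex_of_real (\<phi> (r j)) * ip I (e' k) (e j) * (e' k x * cnj (e j y)))"
    by (subst onb_expand[OF I o' xy(1)]) (simp add: sum_distrib_left sum_distrib_right mult_ac)
  also have "\<dots> = (\<Sum>j\<in>I. \<Sum>k\<in>I. complex_of_real (\<phi> (r' k)) * ip I (e' k) (e j) * (e' k x * cnj (e j y)))"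
    by (intro sum.cong refl) (simp add: w)
  also have "\<dots> = (\<Sum>k\<in>I. complex_of_real (\<phi> (r' k)) * e' k x * cnj (\<Sum>j\<in>I. ip I (e j) (e' k) * e j y))"
    unfolding cnj_sum sum_distrib_left by (subst sum.swap) (simp add: cnj_ip mult_ac)
  also have "\<dots> = (\<Sum>k\<in>I. complex_of_real (\<phi> (r' k)) * e' k x * cnj (e' k y))"
    by (simp add: onb_expand[OF I o xy(2), symmetric])
  finally show ?thesis .
qed

lemma herm_fun_eq:
  assumes M: "M \<in> carrier_mat n n" and s: "spectral {..<n} (entry M) e d"
  shows "herm_fun f M = mat n n (\<lambda>(x, y). \<Sum>j<n. complex_of_real (f (d j)) * e j x * cnj (e j y))"
    (is "_ = ?L")
  unfolding herm_fun_def Let_def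
proof (rule the_equality)
  have n: "dim_row M = n" using M by simp
  note U = unitary_of_spectral[OF M s]
  let ?U = "mat n n (\<lambda>(x, j). e j x)"
  have "?L = ?U * mat_diag n (\<lambda>i. complex_of_real (f (d i))) * mat_adjoint ?U" (is "_ = ?R")
  proof (rule eq_matI)
    fix i j assume "i < dim_row ?R" "j < dim_col ?R"
    then have ij: "i < n" "j < n" using U(1) mat_adjoint_carrier[OF U(1)] by auto
    show "?L $$ (i, j) = ?R $$ (i, j)"
      unfolding conjugation_index[OF U(1) ij] using ij by simp
  qed (use U(1) mat_adjoint_carrier[OF U(1)] in auto)
  then show "\<exists>U d. U \<in> carrier_mat (dim_row M) (dim_row M) \<and> U * mat_adjoint U = 1\<^sub>m (dim_row M) \<and>
      M = U * mat_diag (dim_row M) (\<lambda>i. complex_of_real (d i)) * mat_adjoint U \<and>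
      ?L = U * mat_diag (dim_row M) (\<lambda>i. complex_of_real (f (d i))) * mat_adjoint U"
    unfolding n using U by blast
next
  fix L
  assume "\<exists>U d. U \<in> carrier_mat (dim_row M) (dim_row M) \<and> U * mat_adjoint U = 1\<^sub>m (dim_row M) \<and>
      M = U * mat_diag (dim_row M) (\<lambda>i. complex_of_real (d i)) * mat_adjoint U \<and>
      L = U * mat_diag (dim_row M) (\<lambda>i. complex_of_real (f (d i))) * mat_adjoint U"
  moreover have n: "dim_row M = n" using M by simp
  ultimately obtain U d' where U: "U \<in> carrier_mat n n" "U * mat_adjoint U = 1\<^sub>m n"
      "M = U * mat_diag n (\<lambda>i. complex_of_real (d' i)) * mat_adjoint U"
    and L: "L = U * mat_diag n (\<lambda>i. complex_of_real (f (d' i))) * mat_adjoint U"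
    by auto
  note s' = spectral_unitary[OF U]
  show "L = ?L"
  proof (rule eq_matI)
    fix i j assume "i < dim_row ?L" "j < dim_col ?L"
    then have ij: "i < n" "j < n" by auto
    then show "L $$ (i, j) = ?L $$ (i, j)"
      unfolding L conjugation_index[OF U(1) ij]
      using spectral_fun_unique[OF finite_lessThan s' s, of i j f] by simp
  qed (use L U(1) mat_adjoint_carrier[OF U(1)] in auto)
qed

lemma entropy_eq_ent:
  assumes M: "M \<in> carrier_mat n n" and h: "herm {..<n} (entry M)"
  shows "entropy M = ent {..<n} (entry M)"
proof -
  obtain e d where s: "spectral {..<n} (entry M) e d"
    using spectral_exists[OF finite_lessThan h] by blast
  let ?l = "\<lambda>x y. \<Sum>j<n. complex_of_real (log 2 (d j)) * e j x * cnj (e j y)"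
  have sl: "spectral {..<n} ?l e (\<lambda>j. log 2 (d j))"
    using spectral_onb[OF s] unfolding spectral_def by simp
  have "mtrace (M * herm_fun (log 2) M) = (\<Sum>x<n. \<Sum>y<n. ?l y x * M $$ (x, y))"
    unfolding herm_fun_eq[OF M s] mtrace_def using M
    by (auto simp: scalar_prod_def lessThan_atLeast0 mult.commute intro!: sum.cong)
  \<comment> \<open>The trace is evaluated in the eigenbasis of \<open>M\<close>, where the
    logarithm multiplies \<open>e j\<close> by \<open>log 2 (d j)\<close>.\<close>
  also have "\<dots> = (\<Sum>j<n. complex_of_real (d j) * ip {..<n} (e j) (app {..<n} ?l (e j)))"
    by (subst sum.swap, rule ensemble_ip[OF spectral_ensemble[OF s], symmetric])
  also have "\<dots> = (\<Sum>j<n. complex_of_real (d j * log 2 (d j)))"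
  proof (rule sum.cong[OF refl])
    fix j assume j: "j \<in> {..<n}"
    have "ip {..<n} (e j) (app {..<n} ?l (e j)) = ip {..<n} (e j) (\<lambda>x. log 2 (d j) * e j x)"
      by (rule ip_cong) (use spectral_eigen[OF finite_lessThan sl _ j] in auto)
    also have "\<dots> = log 2 (d j)"
      using onb_ip[OF spectral_onb[OF s] j j] by (simp add: ip_scale_right)
    finally show "complex_of_real (d j) * ip {..<n} (e j) (app {..<n} ?l (e j)) = complex_of_real (d j * log 2 (d j))"
      by simp
  qed
  finally have "mtrace (M * herm_fun (log 2) M) = complex_of_real (\<Sum>j<n. d j * log 2 (d j))" by simp
  then show ?thesis unfolding entropy_def ent_eq[OF finite_lessThan s] by simp
qed

lemma entropy_transfer:
  assumes M: "M \<in> carrier_mat n n" and f: "bij_betw f J {..<n}" and h: "herm J \<rho>"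
    and eq: "\<And>x y. x \<in> J \<Longrightarrow> y \<in> J \<Longrightarrow> \<rho> x y = M $$ (f x, f y)"
  shows "entropy M = ent J \<rho>"
proof -
  have "herm {..<n} (entry M)"
    unfolding herm_def
  proof (intro ballI)
    fix x y assume "x \<in> {..<n}" "y \<in> {..<n}"
    then have "x \<in> f ` J" "y \<in> f ` J" using f by (simp_all add: bij_betw_def)
    then obtain u v where uv: "u \<in> J" "x = f u" "v \<in> J" "y = f v" by blast
    then show "cnj (M $$ (x, y)) = M $$ (y, x)"
      using hermD[OF h uv(1,3)] eq[OF uv(1,3)] eq[OF uv(3,1)] by simp
  qed
  then show ?thesis
    unfolding entropy_eq_ent[OF M \<open>herm {..<n} (entry M)\<close>]
    by (intro ent_transfer[OF _ f, symmetric]) (auto simp: eq)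
qed

lemma ptrace_carrier [simp]: "ptrace p n q M \<in> carrier_mat (p * q) (p * q)"
  unfolding ptrace_def by simp

lemma ptrace_index:
  assumes "a < p" "c < q" "b < p" "d < q"
  shows "ptrace p n q M $$ (a * q + c, b * q + d) = (\<Sum>k<n. M $$ (tidx n q a k c, tidx n q b k d))"
  unfolding ptrace_def using assms by (simp add: pair_less)

text \<open>The numbering of product bases is associative: B E is one factor while A is traced out,
  and A B is one factor while only E is kept.\<close>

lemma cond_mutual_info_eq_cmi:
  assumes p: "psd (dA * dB * dE) \<omega>"
  shows "cond_mutual_info dA dB dE \<omega> = cmi {..<dA} {..<dB} {..<dE} (ker3 dB dE \<omega>)"
proof -
  note h = marginals_herm[OF finite_lessThan finite_lessThan finite_lessThan psd_ker3[OF p]]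
  let ?k = "ker3 dB dE \<omega>"
  have 1: "entropy (ptrace dA dB dE \<omega>) = ent ({..<dA} \<times> {..<dE}) (ptr1 {..<dB} (swap12 ?k))"
    by (rule entropy_transfer[OF ptrace_carrier bij_pair h(1)]) (auto simp: ptrace_index ptr1_def)
  have "bij_betw (\<lambda>(b, e). b * dE + e) ({..<dB} \<times> {..<dE}) {..<1 * (dB * dE)}"
    using bij_pair by simp
  then have 2: "entropy (ptrace 1 dA (dB * dE) \<omega>) = ent ({..<dB} \<times> {..<dE}) (ptr1 {..<dA} ?k)"
  proof (rule entropy_transfer[OF ptrace_carrier _ h(2)])
    fix x y assume "x \<in> {..<dB} \<times> {..<dE}" "y \<in> {..<dB} \<times> {..<dE}"
    then obtain b e b' e' where x: "x = (b, e)" "b < dB" "e < dE" "y = (b', e')" "b' < dB" "e' < dE" by auto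
    show "ptr1 {..<dA} ?k x y = ptrace 1 dA (dB * dE) \<omega> $$ ((\<lambda>(b, e). b * dE + e) x, (\<lambda>(b, e). b * dE + e) y)"
      using ptrace_index[of 0 1 "b * dE + e" "dB * dE" 0 "b' * dE + e'" dA \<omega>] x
      by (simp add: ptr1_def pair_less tidx_assoc[of dB dE]) (simp add: tidx_def)
  qed
  have 3: "entropy \<omega> = ent ({..<dA} \<times> {..<dB} \<times> {..<dE}) ?k"
    by (rule entropy_transfer[OF psd_carrier[OF p] bij_tidx h(4)]) auto
  have "bij_betw (\<lambda>e. e) {..<dE} {..<1 * dE}"
    using bij_betw_id[of "{..<dE}"] by (simp add: id_def)
  then have 4: "entropy (ptrace 1 (dA * dB) dE \<omega>) = ent {..<dE} (ptr1 {..<dB} (ptr1 {..<dA} ?k))"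
  proof (rule entropy_transfer[OF ptrace_carrier _ h(3)])
    fix x y assume xy: "x \<in> {..<dE}" "y \<in> {..<dE}"
    have "ptrace 1 (dA * dB) dE \<omega> $$ (x, y) = (\<Sum>k<dA * dB. \<omega> $$ (k * dE + x, k * dE + y))"
      using ptrace_index[of 0 1 x dE 0 y "dA * dB" \<omega>] xy by (simp add: tidx_def)
    also have "\<dots> = (\<Sum>(a, b)\<in>{..<dA} \<times> {..<dB}. \<omega> $$ (tidx dB dE a b x, tidx dB dE a b y))"
      unfolding sum.reindex_bij_betw[OF bij_pair, of "\<lambda>k. \<omega> $$ (k * dE + x, k * dE + y)", symmetric]
      by (simp add: split_def tidx_def)
    also have "\<dots> = ptr1 {..<dB} (ptr1 {..<dA} ?k) x y"
      unfolding ptr1_def sum.cartesian_product[symmetric] by (subst sum.swap) simp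
    finally show "ptr1 {..<dB} (ptr1 {..<dA} ?k) x y = ptrace 1 (dA * dB) dE \<omega> $$ (x, y)" ..
  qed
  show ?thesis unfolding cond_mutual_info_def cmi_def 1 2 3 4 ..
qed

lemma mtrace_ker3:
  assumes "M \<in> carrier_mat (p * n * q) (p * n * q)"
  shows "mtrace M = (\<Sum>u\<in>{..<p} \<times> {..<n} \<times> {..<q}. ker3 n q M u u)"
proof -
  have "mtrace M = (\<Sum>x<p * n * q. M $$ (x, x))" unfolding mtrace_def using assms by simp
  also have "\<dots> = (\<Sum>u\<in>{..<p} \<times> {..<n} \<times> {..<q}. ker3 n q M u u)"
    unfolding sum.reindex_bij_betw[OF bij_tidx, of "\<lambda>x. M $$ (x, x)", symmetric]
    by (rule sum.cong) auto
  finally show ?thesis .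
qed

lemma mtrace_ptrace:
  assumes "M \<in> carrier_mat (p * n) (p * n)"
  shows "mtrace (ptrace p n 1 M) = mtrace M"
proof -
  have "mtrace (ptrace p n 1 M) = (\<Sum>x<p. \<Sum>k<n. M $$ (x * n + k, x * n + k))"
    unfolding mtrace_def ptrace_def by (simp add: tidx_def)
  also have "\<dots> = (\<Sum>x<p * n. M $$ (x, x))"
    unfolding sum.reindex_bij_betw[OF bij_pair, of "\<lambda>x. M $$ (x, x)", symmetric] sum.cartesian_product
    by (simp add: split_def)
  finally show ?thesis unfolding mtrace_def using assms by simp
qed

section \<open>Kraus representations\<close>

lemma tensor_map_carrier [simp]: "tensor_map p n m q \<Phi> M \<in> carrier_mat (p * m * q) (p * m * q)"
  unfolding tensor_map_def by simp

lemma tensor_map_index: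
  assumes "a < p" "i < m" "c < q" "b < p" "j < m" "d < q"
  shows "tensor_map p n m q \<Phi> M $$ (tidx m q a i c, tidx m q b j d) =
    \<Phi> (mat n n (\<lambda>(k, l). M $$ (tidx n q a k c, tidx n q b l d))) $$ (i, j)"
  unfolding tensor_map_def using assms by (simp add: tidx_less)

definition mat_unit :: "nat \<Rightarrow> nat \<Rightarrow> nat \<Rightarrow> complex mat" where
  "mat_unit n c d = mat n n (\<lambda>(x, y). if x = c \<and> y = d then 1 else 0)"

lemma mat_unit_carrier [simp]: "mat_unit n c d \<in> carrier_mat n n"
  unfolding mat_unit_def by simp

lemma linear_map_expand:
  assumes lin: "linear_map n m \<Phi>" and M: "M \<in> carrier_mat n n" and ij: "i < m" "j < m"
  shows "\<Phi> M $$ (i, j) = (\<Sum>c<n. \<Sum>d<n. M $$ (c, d) * \<Phi> (mat_unit n c d) $$ (i, j))"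
proof -
  \<comment> \<open>\<open>R P\<close> keeps the entries of \<open>M\<close> at the positions in
    \<open>P\<close>; induction on \<open>P\<close> builds \<open>M\<close> from matrix units one
    entry at a time.\<close>
  define R where "R P = mat n n (\<lambda>p. if p \<in> P then M $$ p else 0)" for P
  have R: "R P \<in> carrier_mat n n" for P unfolding R_def by simp
  have \<Phi>: "\<Phi> N \<in> carrier_mat m m" if "N \<in> carrier_mat n n" for N
    using lin that unfolding linear_map_def by blast
  have add: "\<Phi> (N + N') = \<Phi> N + \<Phi> N'" if "N \<in> carrier_mat n n" "N' \<in> carrier_mat n n" for N N'
    using lin that unfolding linear_map_def by blast
  have sc: "\<Phi> (c \<cdot>\<^sub>m N) = c \<cdot>\<^sub>m \<Phi> N" if "N \<in> carrier_mat n n" for N c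
    using lin that unfolding linear_map_def by blast
  have "\<Phi> (R P) $$ (i, j) = (\<Sum>p\<in>P. M $$ p * \<Phi> (mat_unit n (fst p) (snd p)) $$ (i, j))"
    if "finite P" "P \<subseteq> {..<n} \<times> {..<n}" for P
    using that
  proof (induction P rule: finite_induct)
    case empty
    \<comment> \<open>Homogeneity with the scalar 0 makes the image of the zero matrix
      vanish.\<close>
    have "R {} = 0 \<cdot>\<^sub>m R {}" unfolding R_def by (rule eq_matI) auto
    then have "\<Phi> (R {}) = 0 \<cdot>\<^sub>m \<Phi> (R {})" using sc[OF R, of 0 "{}"] by simp
    then have "\<Phi> (R {}) $$ (i, j) = (0 \<cdot>\<^sub>m \<Phi> (R {})) $$ (i, j)" by simp
    also have "\<dots> = 0" using carrier_matD[OF \<Phi>[OF R[of "{}"]]] ij by simp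
    finally show ?case by simp
  next
    case (insert p P)
    have "R (insert p P) = R P + M $$ p \<cdot>\<^sub>m mat_unit n (fst p) (snd p)"
      unfolding R_def mat_unit_def using insert by (intro eq_matI) auto
    then have "\<Phi> (R (insert p P)) = \<Phi> (R P) + M $$ p \<cdot>\<^sub>m \<Phi> (mat_unit n (fst p) (snd p))"
      using add[OF R, of "M $$ p \<cdot>\<^sub>m mat_unit n (fst p) (snd p)" P] sc by simp
    moreover have "dim_row (\<Phi> (mat_unit n (fst p) (snd p))) = m" "dim_col (\<Phi> (mat_unit n (fst p) (snd p))) = m"
      using \<Phi>[OF mat_unit_carrier] by auto
    ultimately show ?case using insert ij by simp
  qed
  from this[of "{..<n} \<times> {..<n}"]
  have "\<Phi> (R ({..<n} \<times> {..<n})) $$ (i, j) = (\<Sum>c<n. \<Sum>d<n. M $$ (c, d) * \<Phi> (mat_unit n c d) $$ (i, j))"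
    by (simp add: sum.cartesian_product')
  moreover have "R ({..<n} \<times> {..<n}) = M" unfolding R_def using M by (intro eq_matI) auto
  ultimately show ?thesis by simp
qed

text \<open>The labels of the Kraus operators are the indices of the Choi matrix, whose eigenvectors
  provide them. They depend on the dimensions only, so all outcomes of an instrument share one label
  set.\<close>

definition kraus_rep ::
  "nat \<Rightarrow> nat \<Rightarrow> (complex mat \<Rightarrow> complex mat) \<Rightarrow> (nat \<times> nat \<Rightarrow> nat \<Rightarrow> nat \<Rightarrow> complex) \<Rightarrow> bool" where
  "kraus_rep n m \<Phi> K \<longleftrightarrow> (\<forall>M \<in> carrier_mat n n. \<Phi> M \<in> carrier_mat m m \<and>
     (\<forall>i<m. \<forall>j<m. \<Phi> M $$ (i, j) = kraus_map ({..<m} \<times> {..<n}) {..<n} K (entry M) i j))"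

lemma pos_rank_one: "pos I (\<lambda>x y. w x * cnj (w y))"
  unfolding pos_def
proof
  fix v
  have "ip I v (app I (\<lambda>x y. w x * cnj (w y)) v) = (\<Sum>x\<in>I. cnj (v x) * w x) * (\<Sum>y\<in>I. cnj (w y) * v y)"
    unfolding ip_def app_def sum_product by (simp add: sum_distrib_left mult_ac)
  also have "\<dots> = ip I v w * cnj (ip I v w)" unfolding cnj_ip unfolding ip_def ..
  also have "\<dots> = of_real ((cmod (ip I v w))\<^sup>2)" by (rule complex_norm_square[symmetric])
  finally show "0 \<le> ip I v (app I (\<lambda>x y. w x * cnj (w y)) v)" by (simp add: less_eq_complex_def)
qed

text \<open>Choi's theorem: the Kraus operators are the reshaped eigenvectors of \<open>(\<Phi> \<otimes> id)(|\<Omega>\<rangle>\<langle>\<Omega>|)\<close> with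
  \<open>\<Omega> = \<Sum>\<^sub>c c \<otimes> c\<close>, scaled by the roots of the eigenvalues.\<close>

lemma completely_positive_kraus:
  assumes cp: "completely_positive n m \<Phi>"
  shows "\<exists>K. kraus_rep n m \<Phi> K"
proof -
  have lin: "linear_map n m \<Phi>" using cp unfolding completely_positive_def by blast
  define \<Omega> where "\<Omega> = mat (n * n) (n * n) (\<lambda>(x, y). if x div n = x mod n \<and> y div n = y mod n then 1 else (0::complex))"
  have "psd (n * n) \<Omega>"
    unfolding psd_iff_pos
  proof
    let ?w = "\<lambda>x. if x div n = x mod n then 1 else (0::complex)"
    show "pos {..<n * n} (entry \<Omega>)"
      using pos_rank_one[of "{..<n * n}" ?w]
      by (subst pos_cong[where \<rho>' = "\<lambda>x y. ?w x * cnj (?w y)"]) (auto simp: \<Omega>_def)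
  qed (simp add: \<Omega>_def)
  then have "psd (m * n) (tensor_map 1 n m n \<Phi> \<Omega>)" using cp unfolding completely_positive_def by blast
  then have "psd (1 * m * n) (tensor_map 1 n m n \<Phi> \<Omega>)" by simp
  note C = psd_ker3[OF this]
  \<comment> \<open>\<open>ker3\<close> works with three factors; the first one here has dimension 1
    and is stripped off.\<close>
  have bij: "bij_betw (\<lambda>(i, c). (0, i, c)) ({..<m} \<times> {..<n}) ({..<1::nat} \<times> {..<m} \<times> {..<n})"
    by (rule bij_betw_byWitness[where f' = snd]) auto
  let ?S = "{..<m} \<times> {..<n}"
  define J where "J p q = \<Phi> (mat_unit n (snd p) (snd q)) $$ (fst p, fst q)" for p q
  have A: "pos ?S (\<lambda>x y. ker3 m n (tensor_map 1 n m n \<Phi> \<Omega>) ((\<lambda>(i, c). (0, i, c)) x) ((\<lambda>(i, c). (0, i, c)) y))"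
    by (rule pos_reindex[OF bij C])
  have B: "ker3 m n (tensor_map 1 n m n \<Phi> \<Omega>) ((\<lambda>(i, c). (0, i, c)) x) ((\<lambda>(i, c). (0, i, c)) y) = J x y"
    if xy: "x \<in> ?S" "y \<in> ?S" for x y
  proof -
    obtain i c j d where x: "x = (i, c)" "y = (j, d)" "i < m" "c < n" "j < m" "d < n"
      by (cases x, cases y) (use xy in auto)
    have "mat n n (\<lambda>(k, l). \<Omega> $$ (tidx n n 0 k c, tidx n n 0 l d)) = mat_unit n c d"
      unfolding mat_unit_def
    proof (rule eq_matI)
      fix k l assume "k < dim_row (mat n n (\<lambda>(x, y). if x = c \<and> y = d then 1 else (0::complex)))"
        "l < dim_col (mat n n (\<lambda>(x, y). if x = c \<and> y = d then 1 else (0::complex)))"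
      then have kl: "k < n" "l < n" by auto
      then show "mat n n (\<lambda>(k, l). \<Omega> $$ (tidx n n 0 k c, tidx n n 0 l d)) $$ (k, l) =
          mat n n (\<lambda>(x, y). if x = c \<and> y = d then 1 else 0) $$ (k, l)"
        using x tidx_less[of 0 1 k n c n] tidx_less[of 0 1 l n d n] by (simp add: \<Omega>_def)
    qed auto
    then show ?thesis using x by (simp add: tensor_map_index J_def)
  qed
  have p: "pos ?S J" by (rule iffD1[OF pos_cong[OF B] A])
  then obtain e r where s: "spectral ?S J e r"
    using spectral_exists[OF _ pos_herm[OF _ p]] by auto
  \<comment> \<open>The square roots behave because the Choi matrix \<open>J\<close> is positive, so
    its eigenvalues are nonnegative.\<close>
  define K where "K s i c = complex_of_real (sqrt (r s)) * e s (i, c)" for s i c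
  have KJ: "(\<Sum>s\<in>?S. K s i c * cnj (K s j d)) = \<Phi> (mat_unit n c d) $$ (i, j)"
    if "i < m" "j < m" "c < n" "d < n" for i j c d
  proof -
    have "(\<Sum>s\<in>?S. K s i c * cnj (K s j d)) = (\<Sum>s\<in>?S. complex_of_real (r s) * e s (i, c) * cnj (e s (j, d)))"
    proof (rule sum.cong[OF refl])
      fix s assume "s \<in> ?S"
      then have "0 \<le> r s" by (intro spectral_nonneg[OF _ s p]) auto
      then have "complex_of_real (sqrt (r s)) * complex_of_real (sqrt (r s)) = complex_of_real (r s)"
        by (simp flip: of_real_mult)
      then show "K s i c * cnj (K s j d) = complex_of_real (r s) * e s (i, c) * cnj (e s (j, d))"
        unfolding K_def by (simp add: mult_ac)
    qed
    also have "\<dots> = J (i, c) (j, d)" by (rule spectral_eq[OF s, symmetric]) (use that in auto)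
    finally show ?thesis by (simp add: J_def)
  qed
  have "kraus_rep n m \<Phi> K"
    unfolding kraus_rep_def
  proof (intro ballI conjI allI impI)
    fix M :: "complex mat" assume M: "M \<in> carrier_mat n n"
    show "\<Phi> M \<in> carrier_mat m m" using lin M unfolding linear_map_def by blast
    fix i j assume ij: "i < m" "j < m"
    have "\<Phi> M $$ (i, j) = (\<Sum>c<n. \<Sum>d<n. M $$ (c, d) * (\<Sum>s\<in>?S. K s i c * cnj (K s j d)))"
      unfolding linear_map_expand[OF lin M ij] by (intro sum.cong refl) (simp add: KJ ij)
    also have "\<dots> = kraus_map ?S {..<n} K (entry M) i j"
      unfolding kraus_map_def by (subst sum_rotate) (simp add: sum_distrib_left mult_ac)
    finally show "\<Phi> M $$ (i, j) = kraus_map ?S {..<n} K (entry M) i j" .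
  qed
  then show ?thesis by blast
qed

lemma mtrace_msum:
  assumes "\<And>k. k < K \<Longrightarrow> F k \<in> carrier_mat m m"
  shows "mtrace (msum m K F) = (\<Sum>k<K. mtrace (F k))"
proof -
  have "mtrace (msum m K F) = (\<Sum>i<m. \<Sum>k<K. F k $$ (i, i))" unfolding mtrace_def msum_def by simp
  also have "\<dots> = (\<Sum>k<K. \<Sum>i<m. F k $$ (i, i))" by (rule sum.swap)
  also have "\<dots> = (\<Sum>k<K. mtrace (F k))" unfolding mtrace_def using assms by (intro sum.cong) auto
  finally show ?thesis .
qed

text \<open>Testing trace preservation on the matrix unit |b><a| gives the entry (a, b) of the
  completeness relation.\<close>

lemma instrument_kraus_tp:
  assumes ins: "instrument n m N \<E>" and K: "\<And>k. k < N \<Longrightarrow> kraus_rep n m (\<E> k) (K k)"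
  shows "kraus_tp ({..<N} \<times> {..<m} \<times> {..<n}) {..<n} {..<m} (\<lambda>(k, l). K k l)"
  unfolding kraus_tp_def
proof (intro ballI)
  fix a b assume ab: "a \<in> {..<n}" "b \<in> {..<n}"
  let ?S = "{..<m} \<times> {..<n}"
  have E: "\<E> k (mat_unit n b a) \<in> carrier_mat m m" if "k < N" for k
    using K[OF that] unfolding kraus_rep_def by simp
  have "(if a = b then 1 else 0) = mtrace (mat_unit n b a)"
    unfolding mtrace_def mat_unit_def using ab by (auto simp: sum.delta)
  also have "\<dots> = mtrace (msum m N (\<lambda>k. \<E> k (mat_unit n b a)))"
    using ins unfolding instrument_def trace_preserving_def by simp
  also have "\<dots> = (\<Sum>k<N. mtrace (\<E> k (mat_unit n b a)))" by (rule mtrace_msum[OF E])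
  also have "\<dots> = (\<Sum>k<N. \<Sum>x<m. \<Sum>s\<in>?S. cnj (K k s x a) * K k s x b)"
  proof (rule sum.cong[OF refl])
    fix k assume k: "k \<in> {..<N}"
    have "mtrace (\<E> k (mat_unit n b a)) = (\<Sum>x<m. \<E> k (mat_unit n b a) $$ (x, x))"
      unfolding mtrace_def using E k by auto
    also have "\<dots> = (\<Sum>x<m. kraus_map ?S {..<n} (K k) (entry (mat_unit n b a)) x x)"
      using K[of k] k unfolding kraus_rep_def by simp
    also have "\<dots> = (\<Sum>x<m. \<Sum>s\<in>?S. \<Sum>c<n. \<Sum>d<n. if d = a then if c = b then cnj (K k s x a) * K k s x b else 0 else 0)"
      unfolding kraus_map_def mat_unit_def by (intro sum.cong refl) auto
    also have "\<dots> = (\<Sum>x<m. \<Sum>s\<in>?S. cnj (K k s x a) * K k s x b)" using ab by simp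
    finally show "mtrace (\<E> k (mat_unit n b a)) = (\<Sum>x<m. \<Sum>s\<in>?S. cnj (K k s x a) * K k s x b)" .
  qed
  also have "\<dots> = (\<Sum>u\<in>{..<N} \<times> ?S. \<Sum>x<m. cnj ((\<lambda>(k, l). K k l) u x a) * (\<lambda>(k, l). K k l) u x b)"
    unfolding sum.cartesian_product'[of _ "{..<N}"] by (rule sum.cong[OF refl], subst sum.swap) simp
  finally show "(\<Sum>u\<in>{..<N} \<times> ?S. \<Sum>x<m. cnj ((\<lambda>(k, l). K k l) u x a) * (\<lambda>(k, l). K k l) u x b) =
      (if a = b then 1 else 0)" ..
qed

lemma kraus_map_cong:
  "(\<And>x y. x \<in> I \<Longrightarrow> y \<in> I \<Longrightarrow> \<rho> x y = \<rho>' x y) \<Longrightarrow> kraus_map L I K \<rho> = kraus_map L I K \<rho>'"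
  unfolding kraus_map_def by (intro ext sum.cong refl) simp

lemma kraus_map_sum:
  "(\<Sum>e\<in>E. kraus_map L I K (\<rho> e) x y) = kraus_map L I K (\<lambda>a b. \<Sum>e\<in>E. \<rho> e a b) x y"
proof -
  have "(\<Sum>e\<in>E. kraus_map L I K (\<rho> e) x y) = (\<Sum>l\<in>L. \<Sum>a\<in>I. \<Sum>e\<in>E. \<Sum>b\<in>I. K l x a * \<rho> e a b * cnj (K l y b))"
    unfolding kraus_map_def by (rule sum_rotate)
  also have "\<dots> = kraus_map L I K (\<lambda>a b. \<Sum>e\<in>E. \<rho> e a b) x y"
    unfolding kraus_map_def sum_distrib_left sum_distrib_right
    by (intro sum.cong refl, rule sum.swap)
  finally show ?thesis .
qed

lemma kraus_rep_mat:
  assumes "kraus_rep n m \<Phi> K" "i < m" "j < m"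
  shows "\<Phi> (mat n n (\<lambda>(k, l). \<rho> k l)) $$ (i, j) = kraus_map ({..<m} \<times> {..<n}) {..<n} K \<rho> i j"
proof -
  have "\<Phi> (mat n n (\<lambda>(k, l). \<rho> k l)) $$ (i, j) =
      kraus_map ({..<m} \<times> {..<n}) {..<n} K (entry (mat n n (\<lambda>(k, l). \<rho> k l))) i j"
    using assms unfolding kraus_rep_def by simp
  also have "kraus_map ({..<m} \<times> {..<n}) {..<n} K (entry (mat n n (\<lambda>(k, l). \<rho> k l))) =
      kraus_map ({..<m} \<times> {..<n}) {..<n} K \<rho>"
    by (rule kraus_map_cong) auto
  finally show ?thesis .
qed

section \<open>Local operations on tripartite matrices\<close>

lemma tidx_0: "tidx n (m * q) 0 k (b * q + e) = tidx m q k b e"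
  unfolding tidx_def by (simp add: algebra_simps)

lemma tidx_1: "tidx n 1 a i 0 = a * n + i"
  unfolding tidx_def by simp

text \<open>For an operation of Alice, B and E are merged into one factor of dimension
  \<open>s * q\<close>; \<open>tidx_0\<close> splits the merged index again.\<close>

lemma ker3_tensor_map_first:
  assumes K: "kraus_rep n m \<Phi> K" and "p \<in> {..<m} \<times> {..<s} \<times> {..<q}" "p' \<in> {..<m} \<times> {..<s} \<times> {..<q}"
  shows "ker3 s q (tensor_map 1 n m (s * q) \<Phi> \<omega>) p p' =
    local_map ({..<m} \<times> {..<n}) {..<n} K (ker3 s q \<omega>) p p'"
proof -
  obtain a b e a' b' e' where p: "p = (a, b, e)" "p' = (a', b', e')" by (cases p, cases p')
  have m: "a < m" "b < s" "e < q" "a' < m" "b' < s" "e' < q" using assms(2,3) p by auto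
  have "ker3 s q (tensor_map 1 n m (s * q) \<Phi> \<omega>) p p' =
      tensor_map 1 n m (s * q) \<Phi> \<omega> $$ (tidx m (s * q) 0 a (b * q + e), tidx m (s * q) 0 a' (b' * q + e'))"
    unfolding p tidx_0 by simp
  also have "\<dots> = kraus_map ({..<m} \<times> {..<n}) {..<n} K
      (\<lambda>k l. \<omega> $$ (tidx s q k b e, tidx s q l b' e')) a a'"
    using m by (subst tensor_map_index) (auto simp: pair_less tidx_0 kraus_rep_mat[OF K])
  finally show ?thesis unfolding p local_map_def by simp
qed

lemma ker3_tensor_map_middle:
  assumes K: "kraus_rep n m \<Phi> K" and "p \<in> {..<s} \<times> {..<m} \<times> {..<q}" "p' \<in> {..<s} \<times> {..<m} \<times> {..<q}"
  shows "ker3 m q (tensor_map s n m q \<Phi> \<omega>) p p' =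
    swap12 (local_map ({..<m} \<times> {..<n}) {..<n} K (swap12 (ker3 n q \<omega>))) p p'"
proof -
  obtain a b e a' b' e' where p: "p = (a, b, e)" "p' = (a', b', e')" by (cases p, cases p')
  have m: "a < s" "b < m" "e < q" "a' < s" "b' < m" "e' < q" using assms(2,3) p by auto
  then show ?thesis unfolding p local_map_def
    by (simp add: tensor_map_index kraus_rep_mat[OF K])
qed

lemma psd_tensor_map_first:
  assumes K: "kraus_rep n m \<Phi> K" and p: "psd (n * s * q) \<omega>"
  shows "psd (m * s * q) (tensor_map 1 n m (s * q) \<Phi> \<omega>)"
proof (rule psd_ker3I)
  show "tensor_map 1 n m (s * q) \<Phi> \<omega> \<in> carrier_mat (m * s * q) (m * s * q)"
    using tensor_map_carrier[of 1 n m "s * q" \<Phi> \<omega>] by (simp add: mult.assoc)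
  have "pos ({..<m} \<times> {..<s} \<times> {..<q}) (local_map ({..<m} \<times> {..<n}) {..<n} K (ker3 s q \<omega>))"
    by (rule pos_local_map) (use psd_ker3[OF p] in auto)
  then show "pos ({..<m} \<times> {..<s} \<times> {..<q}) (ker3 s q (tensor_map 1 n m (s * q) \<Phi> \<omega>))"
    by (subst pos_cong[OF ker3_tensor_map_first[OF K]])
qed

lemma psd_tensor_map_middle:
  assumes K: "kraus_rep n m \<Phi> K" and p: "psd (s * n * q) \<omega>"
  shows "psd (s * m * q) (tensor_map s n m q \<Phi> \<omega>)"
proof (rule psd_ker3I[OF tensor_map_carrier])
  have "pos ({..<s} \<times> {..<m} \<times> {..<q}) (swap12 (local_map ({..<m} \<times> {..<n}) {..<n} K (swap12 (ker3 n q \<omega>))))"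
    by (intro pos_swap12 pos_local_map psd_ker3 p) auto
  then show "pos ({..<s} \<times> {..<m} \<times> {..<q}) (ker3 m q (tensor_map s n m q \<Phi> \<omega>))"
    by (subst pos_cong[OF ker3_tensor_map_middle[OF K]])
qed

lemma ptrace_last_index:
  assumes "a < dA" "b < dB" "a' < dA" "b' < dB"
  shows "ptrace (dA * dB) dE 1 \<omega> $$ (a * dB + b, a' * dB + b') = (\<Sum>e<dE. ker3 dB dE \<omega> (a, b, e) (a', b', e))"
proof -
  have "ptrace (dA * dB) dE 1 \<omega> $$ ((a * dB + b) * 1 + 0, (a' * dB + b') * 1 + 0) =
      (\<Sum>e<dE. \<omega> $$ (tidx dE 1 (a * dB + b) e 0, tidx dE 1 (a' * dB + b') e 0))"
    using assms by (intro ptrace_index) (auto simp: pair_less)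
  then show ?thesis by (simp add: tidx_1 tidx_def)
qed

lemma mat_eq_pairI:
  assumes "M \<in> carrier_mat (p * q) (p * q)" "N \<in> carrier_mat (p * q) (p * q)"
    and "\<And>a b a' b'. a < p \<Longrightarrow> b < q \<Longrightarrow> a' < p \<Longrightarrow> b' < q \<Longrightarrow> M $$ (a * q + b, a' * q + b') = N $$ (a * q + b, a' * q + b')"
  shows "M = N"
proof (rule eq_matI)
  fix x y assume "x < dim_row N" "y < dim_col N"
  then have "x \<in> (\<lambda>(a, c). a * q + c) ` ({..<p} \<times> {..<q})" "y \<in> (\<lambda>(a, c). a * q + c) ` ({..<p} \<times> {..<q})"
    using assms(2) bij_pair[of q p] by (simp_all add: bij_betw_def)
  then show "M $$ (x, y) = N $$ (x, y)" using assms(3) by auto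
qed (use assms in auto)

text \<open>The environment index is a parameter for the operation, which is linear, so it can be
  summed before or after.\<close>

lemma ptrace_tensor_map_first:
  assumes K: "kraus_rep n m \<Phi> K"
  shows "ptrace (m * s) q 1 (tensor_map 1 n m (s * q) \<Phi> \<omega>) = tensor_map 1 n m s \<Phi> (ptrace (n * s) q 1 \<omega>)"
proof (rule mat_eq_pairI[of _ m s])
  show "ptrace (m * s) q 1 (tensor_map 1 n m (s * q) \<Phi> \<omega>) \<in> carrier_mat (m * s) (m * s)"
    using ptrace_carrier[of "m * s" q 1] by simp
  show "tensor_map 1 n m s \<Phi> (ptrace (n * s) q 1 \<omega>) \<in> carrier_mat (m * s) (m * s)"
    using tensor_map_carrier[of 1 n m s] by simp
  fix a b a' b' assume m: "a < m" "b < s" "a' < m" "b' < s"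
  let ?S = "{..<m} \<times> {..<n}"
  have "ptrace (m * s) q 1 (tensor_map 1 n m (s * q) \<Phi> \<omega>) $$ (a * s + b, a' * s + b') =
      (\<Sum>e<q. kraus_map ?S {..<n} K (\<lambda>k l. ker3 s q \<omega> (k, b, e) (l, b', e)) a a')"
    unfolding ptrace_last_index[OF m]
    by (rule sum.cong[OF refl], subst ker3_tensor_map_first[OF K]) (use m in \<open>auto simp: local_map_def\<close>)
  also have "\<dots> = kraus_map ?S {..<n} K (\<lambda>k l. ptrace (n * s) q 1 \<omega> $$ (k * s + b, l * s + b')) a a'"
    unfolding kraus_map_sum
    by (rule fun_cong[OF fun_cong[OF kraus_map_cong]]) (subst ptrace_last_index, use m in auto)
  also have "\<dots> = tensor_map 1 n m s \<Phi> (ptrace (n * s) q 1 \<omega>) $$ (tidx m s 0 a b, tidx m s 0 a' b')"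
    using m by (subst tensor_map_index) (auto simp: kraus_rep_mat[OF K] tidx_def)
  finally show "ptrace (m * s) q 1 (tensor_map 1 n m (s * q) \<Phi> \<omega>) $$ (a * s + b, a' * s + b') =
      tensor_map 1 n m s \<Phi> (ptrace (n * s) q 1 \<omega>) $$ (a * s + b, a' * s + b')"
    by (simp add: tidx_def)
qed

lemma ptrace_tensor_map_middle:
  assumes K: "kraus_rep n m \<Phi> K"
  shows "ptrace (s * m) q 1 (tensor_map s n m q \<Phi> \<omega>) = tensor_map s n m 1 \<Phi> (ptrace (s * n) q 1 \<omega>)"
proof (rule mat_eq_pairI[of _ s m])
  show "ptrace (s * m) q 1 (tensor_map s n m q \<Phi> \<omega>) \<in> carrier_mat (s * m) (s * m)"
    using ptrace_carrier[of "s * m" q 1] by simp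
  show "tensor_map s n m 1 \<Phi> (ptrace (s * n) q 1 \<omega>) \<in> carrier_mat (s * m) (s * m)"
    using tensor_map_carrier[of s n m 1] by simp
  fix a b a' b' assume m: "a < s" "b < m" "a' < s" "b' < m"
  let ?S = "{..<m} \<times> {..<n}"
  have "ptrace (s * m) q 1 (tensor_map s n m q \<Phi> \<omega>) $$ (a * m + b, a' * m + b') =
      (\<Sum>e<q. kraus_map ?S {..<n} K (\<lambda>k l. ker3 n q \<omega> (a, k, e) (a', l, e)) b b')"
    unfolding ptrace_last_index[OF m]
    by (rule sum.cong[OF refl], subst ker3_tensor_map_middle[OF K]) (use m in \<open>auto simp: local_map_def\<close>)
  also have "\<dots> = kraus_map ?S {..<n} K (\<lambda>k l. ptrace (s * n) q 1 \<omega> $$ (a * n + k, a' * n + l)) b b'"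
    unfolding kraus_map_sum
    by (rule fun_cong[OF fun_cong[OF kraus_map_cong]]) (subst ptrace_last_index, use m in auto)
  also have "\<dots> = tensor_map s n m 1 \<Phi> (ptrace (s * n) q 1 \<omega>) $$ (tidx m 1 a b 0, tidx m 1 a' b' 0)"
    using m by (subst tensor_map_index) (auto simp: kraus_rep_mat[OF K] tidx_def)
  finally show "ptrace (s * m) q 1 (tensor_map s n m q \<Phi> \<omega>) $$ (a * m + b, a' * m + b') =
      tensor_map s n m 1 \<Phi> (ptrace (s * n) q 1 \<omega>) $$ (a * m + b, a' * m + b')"
    by (simp add: tidx_def)
qed

lemma local_map_trace:
  assumes A: "finite A" and tp: "kraus_tp (S \<times> L) A A' (\<lambda>(k, l). K k l)"
  shows "(\<Sum>k\<in>S. \<Sum>p\<in>A' \<times> C. local_map L A (K k) \<omega> p p) = (\<Sum>p\<in>A \<times> C. \<omega> p p)"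
  unfolding ptr1_trace[symmetric] by (subst sum.swap) (simp add: ptr1_local_map[OF A tp])

text \<open>What the induction over protocols needs to know about one move of Alice. Each completely
  positive map is replaced by its Kraus operators, after which the facts about kernels
  apply.\<close>

lemma instrument_first:
  assumes ins: "instrument n m N \<E>" and p: "psd (n * s * q) \<omega>"
  defines "\<omega>' \<equiv> \<lambda>k. tensor_map 1 n m (s * q) (\<E> k) \<omega>"
  shows "\<And>k. k < N \<Longrightarrow> psd (m * s * q) (\<omega>' k)"
    and "\<And>k. k < N \<Longrightarrow> ptrace (m * s) q 1 (\<omega>' k) = tensor_map 1 n m s (\<E> k) (ptrace (n * s) q 1 \<omega>)"
    and "(\<Sum>k<N. mtrace (\<omega>' k)) = mtrace \<omega>"
    and "(\<Sum>k<N. cond_mutual_info m s q (\<omega>' k)) \<le> cond_mutual_info n s q \<omega>"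
proof -
  have "\<forall>k. \<exists>K. k < N \<longrightarrow> kraus_rep n m (\<E> k) K"
    using ins completely_positive_kraus unfolding instrument_def by blast
  then obtain K where K: "\<And>k. k < N \<Longrightarrow> kraus_rep n m (\<E> k) (K k)" by metis
  have tp: "kraus_tp ({..<N} \<times> {..<m} \<times> {..<n}) {..<n} {..<m} (\<lambda>(k, l). K k l)"
    by (rule instrument_kraus_tp[OF ins K])
  let ?L = "\<lambda>k. local_map ({..<m} \<times> {..<n}) {..<n} (K k) (ker3 s q \<omega>)"
  show p': "psd (m * s * q) (\<omega>' k)" if "k < N" for k
    unfolding \<omega>'_def by (rule psd_tensor_map_first[OF K[OF that] p])
  show "ptrace (m * s) q 1 (\<omega>' k) = tensor_map 1 n m s (\<E> k) (ptrace (n * s) q 1 \<omega>)" if "k < N" for k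
    unfolding \<omega>'_def by (rule ptrace_tensor_map_first[OF K[OF that]])
  have eq: "ker3 s q (\<omega>' k) u v = ?L k u v"
    if "k < N" "u \<in> {..<m} \<times> {..<s} \<times> {..<q}" "v \<in> {..<m} \<times> {..<s} \<times> {..<q}" for k u v
    unfolding \<omega>'_def by (rule ker3_tensor_map_first[OF K[OF that(1)] that(2,3)])
  have "(\<Sum>k<N. mtrace (\<omega>' k)) = (\<Sum>k<N. \<Sum>u\<in>{..<m} \<times> {..<s} \<times> {..<q}. ?L k u u)"
    by (intro sum.cong[OF refl]) (simp add: mtrace_ker3[OF psd_carrier[OF p']] eq cong: sum.cong)
  also have "\<dots> = mtrace \<omega>"
    unfolding mtrace_ker3[OF psd_carrier[OF p]] by (rule local_map_trace[OF finite_lessThan tp])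
  finally show "(\<Sum>k<N. mtrace (\<omega>' k)) = mtrace \<omega>" .
  have "cond_mutual_info m s q (\<omega>' k) = cmi {..<m} {..<s} {..<q} (?L k)" if "k < N" for k
    unfolding cond_mutual_info_eq_cmi[OF p'[OF that]] by (rule cmi_cong) (rule eq[OF that])
  then have "(\<Sum>k<N. cond_mutual_info m s q (\<omega>' k)) = (\<Sum>k<N. cmi {..<m} {..<s} {..<q} (?L k))" by simp
  also have "\<dots> \<le> cond_mutual_info n s q \<omega>"
    unfolding cond_mutual_info_eq_cmi[OF p]
    by (rule cmi_instrument[OF _ _ _ _ _ _ tp psd_ker3[OF p]]) auto
  finally show "(\<Sum>k<N. cond_mutual_info m s q (\<omega>' k)) \<le> cond_mutual_info n s q \<omega>" .
qed

text \<open>A move of Bob becomes a move on the first factor by exchanging the first two factors,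
  under which conditional mutual information and trace are invariant.\<close>

lemma instrument_middle:
  assumes ins: "instrument n m N \<E>" and p: "psd (s * n * q) \<omega>"
  defines "\<omega>' \<equiv> \<lambda>k. tensor_map s n m q (\<E> k) \<omega>"
  shows "\<And>k. k < N \<Longrightarrow> psd (s * m * q) (\<omega>' k)"
    and "\<And>k. k < N \<Longrightarrow> ptrace (s * m) q 1 (\<omega>' k) = tensor_map s n m 1 (\<E> k) (ptrace (s * n) q 1 \<omega>)"
    and "(\<Sum>k<N. mtrace (\<omega>' k)) = mtrace \<omega>"
    and "(\<Sum>k<N. cond_mutual_info s m q (\<omega>' k)) \<le> cond_mutual_info s n q \<omega>"
proof -
  have "\<forall>k. \<exists>K. k < N \<longrightarrow> kraus_rep n m (\<E> k) K"
    using ins completely_positive_kraus unfolding instrument_def by blast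
  then obtain K where K: "\<And>k. k < N \<Longrightarrow> kraus_rep n m (\<E> k) (K k)" by metis
  have tp: "kraus_tp ({..<N} \<times> {..<m} \<times> {..<n}) {..<n} {..<m} (\<lambda>(k, l). K k l)"
    by (rule instrument_kraus_tp[OF ins K])
  let ?L = "\<lambda>k. local_map ({..<m} \<times> {..<n}) {..<n} (K k) (swap12 (ker3 n q \<omega>))"
  note ps = pos_swap12[OF psd_ker3[OF p]]
  have pL: "pos ({..<m} \<times> {..<s} \<times> {..<q}) (?L k)" for k by (rule pos_local_map) (use ps in auto)
  show p': "psd (s * m * q) (\<omega>' k)" if "k < N" for k
    unfolding \<omega>'_def by (rule psd_tensor_map_middle[OF K[OF that] p])
  show "ptrace (s * m) q 1 (\<omega>' k) = tensor_map s n m 1 (\<E> k) (ptrace (s * n) q 1 \<omega>)" if "k < N" for k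
    unfolding \<omega>'_def by (rule ptrace_tensor_map_middle[OF K[OF that]])
  have eq: "ker3 m q (\<omega>' k) u v = swap12 (?L k) u v"
    if "k < N" "u \<in> {..<s} \<times> {..<m} \<times> {..<q}" "v \<in> {..<s} \<times> {..<m} \<times> {..<q}" for k u v
    unfolding \<omega>'_def by (rule ker3_tensor_map_middle[OF K[OF that(1)] that(2,3)])
  have sw: "(\<Sum>u\<in>B \<times> A \<times> C. swap12 \<rho> u u) = (\<Sum>u\<in>A \<times> B \<times> C. \<rho> u u)"
    for A B C :: "nat set" and \<rho>
    unfolding swap12_eq by (rule sum.reindex_bij_betw[OF bij_swap12])
  have "(\<Sum>k<N. mtrace (\<omega>' k)) = (\<Sum>k<N. \<Sum>u\<in>{..<s} \<times> {..<m} \<times> {..<q}. swap12 (?L k) u u)"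
    by (intro sum.cong[OF refl]) (simp add: mtrace_ker3[OF psd_carrier[OF p']] eq cong: sum.cong)
  also have "\<dots> = (\<Sum>k<N. \<Sum>u\<in>{..<m} \<times> {..<s} \<times> {..<q}. ?L k u u)" unfolding sw ..
  also have "\<dots> = mtrace \<omega>"
    unfolding mtrace_ker3[OF psd_carrier[OF p]] local_map_trace[OF finite_lessThan tp] by (rule sw)
  finally show "(\<Sum>k<N. mtrace (\<omega>' k)) = mtrace \<omega>" .
  have "cond_mutual_info s m q (\<omega>' k) = cmi {..<m} {..<s} {..<q} (?L k)" if "k < N" for k
  proof -
    have "cond_mutual_info s m q (\<omega>' k) = cmi {..<s} {..<m} {..<q} (swap12 (?L k))"
      unfolding cond_mutual_info_eq_cmi[OF p'[OF that]] by (rule cmi_cong) (rule eq[OF that])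
    then show ?thesis using cmi_swap[OF _ _ _ pL] by simp
  qed
  then have "(\<Sum>k<N. cond_mutual_info s m q (\<omega>' k)) = (\<Sum>k<N. cmi {..<m} {..<s} {..<q} (?L k))" by simp
  also have "\<dots> \<le> cmi {..<n} {..<s} {..<q} (swap12 (ker3 n q \<omega>))"
    by (rule cmi_instrument[OF _ _ _ _ _ _ tp ps]) auto
  also have "\<dots> = cond_mutual_info s n q \<omega>"
    unfolding cond_mutual_info_eq_cmi[OF p] by (rule cmi_swap[OF _ _ _ psd_ker3[OF p]]) auto
  finally show "(\<Sum>k<N. cond_mutual_info s m q (\<omega>' k)) \<le> cond_mutual_info s n q \<omega>" .
qed

section \<open>Extensions\<close>

text \<open>Inverse of \<open>ker3\<close>: direct sums of environments are easiest to write on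
  index triples, while extensions are matrices.\<close>

definition of_ker3 where
  "of_ker3 p n q \<kappa> = mat (p * n * q) (p * n * q)
     (\<lambda>(x, y). \<kappa> (x div (n * q), x div q mod n, x mod q) (y div (n * q), y div q mod n, y mod q))"

lemma of_ker3_carrier [simp]: "of_ker3 p n q \<kappa> \<in> carrier_mat (p * n * q) (p * n * q)"
  unfolding of_ker3_def by simp

lemma ker3_of_ker3:
  assumes "u \<in> {..<p} \<times> {..<n} \<times> {..<q}" "v \<in> {..<p} \<times> {..<n} \<times> {..<q}"
  shows "ker3 n q (of_ker3 p n q \<kappa>) u v = \<kappa> u v"
  using assms unfolding of_ker3_def by (auto simp: tidx_less)

text \<open>Unnormalised extensions are allowed: \<open>I(A;B|E)\<close> is homogeneous of degree one, so there is no need to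
  divide by outcome probabilities, which may vanish.\<close>

definition has_extension :: "nat \<Rightarrow> nat \<Rightarrow> complex mat \<Rightarrow> real \<Rightarrow> bool" where
  "has_extension a b R c \<longleftrightarrow>
     (\<exists>dE \<omega>. psd (a * b * dE) \<omega> \<and> ptrace (a * b) dE 1 \<omega> = R \<and> cond_mutual_info a b dE \<omega> \<le> c)"

lemma has_extensionI:
  "psd (a * b * dE) \<omega> \<Longrightarrow> ptrace (a * b) dE 1 \<omega> = R \<Longrightarrow> cond_mutual_info a b dE \<omega> \<le> c \<Longrightarrow> has_extension a b R c"
  unfolding has_extension_def by blast

lemma has_extension_carrier: "has_extension a b R c \<Longrightarrow> R \<in> carrier_mat (a * b) (a * b)"
  unfolding has_extension_def using ptrace_carrier[of "a * b" _ 1] by auto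

lemma has_extension_mono: "has_extension a b R c \<Longrightarrow> c \<le> c' \<Longrightarrow> has_extension a b R c'"
  unfolding has_extension_def using order_trans by blast

text \<open>The direct sum of the two environments gives an operator that is block diagonal in the
  environment index, so positivity, reduced operator and conditional mutual information can all be
  read off from the blocks.\<close>

lemma has_extension_add:
  assumes "has_extension a b R c" "has_extension a b R' c'"
  shows "has_extension a b (R + R') (c + c')"
proof -
  obtain m \<omega> where w: "psd (a * b * m) \<omega>" "ptrace (a * b) m 1 \<omega> = R" "cond_mutual_info a b m \<omega> \<le> c"
    using assms(1) unfolding has_extension_def by blast
  obtain n \<omega>' where w': "psd (a * b * n) \<omega>'" "ptrace (a * b) n 1 \<omega>' = R'" "cond_mutual_info a b n \<omega>' \<le> c'"
    using assms(2) unfolding has_extension_def by blast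
  let ?A = "{..<a}" and ?B = "{..<b}" and ?E = "{..<m}" and ?F = "{m..<m + n}"
  \<comment> \<open>Environment levels below m carry the first extension, the following n levels the
    second one, shifted by m; entries between the two groups are 0.\<close>
  define \<kappa> where "\<kappa> = (\<lambda>(x, y, e) (x', y', e').
     if e < m \<and> e' < m then ker3 b m \<omega> (x, y, e) (x', y', e')
     else if m \<le> e \<and> m \<le> e' then ker3 b n \<omega>' (x, y, e - m) (x', y', e' - m) else 0)"
  define W where "W = of_ker3 a b (m + n) \<kappa>"
  have EF: "{..<m + n} = ?E \<union> ?F" "?E \<inter> ?F = {}" by auto
  have f: "bij_betw (\<lambda>e. e - m) ?F {..<n}"
    by (rule bij_betw_byWitness[where f' = "\<lambda>e. e + m"]) auto
  have f3: "bij_betw (map_prod id (map_prod id (\<lambda>e. e - m))) (?A \<times> ?B \<times> ?F) (?A \<times> ?B \<times> {..<n})"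
    by (intro bij_betw_map_prod bij_betw_id f)
  have \<kappa>E: "\<kappa> u v = ker3 b m \<omega> u v" if "u \<in> ?A \<times> ?B \<times> ?E" "v \<in> ?A \<times> ?B \<times> ?E" for u v
    using that unfolding \<kappa>_def by auto
  have \<kappa>F: "\<kappa> u v = (\<lambda>(x, y, e) (x', y', e'). ker3 b n \<omega>' (x, y, e - m) (x', y', e' - m)) u v"
    if "u \<in> ?A \<times> ?B \<times> ?F" "v \<in> ?A \<times> ?B \<times> ?F" for u v
    using that unfolding \<kappa>_def by auto
  have z: "\<kappa> u v = 0" "\<kappa> v u = 0" if "u \<in> ?A \<times> ?B \<times> ?E" "v \<in> ?A \<times> ?B \<times> ?F" for u v
    using that unfolding \<kappa>_def by auto
  have pE: "pos (?A \<times> ?B \<times> ?E) \<kappa>"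
    by (rule iffD2[OF pos_cong[OF \<kappa>E] psd_ker3[OF w(1)]])
  have "pos (?A \<times> ?B \<times> ?F) (\<lambda>u v. ker3 b n \<omega>' (map_prod id (map_prod id (\<lambda>e. e - m)) u) (map_prod id (map_prod id (\<lambda>e. e - m)) v))"
    by (rule pos_reindex[OF f3 psd_ker3[OF w'(1)]])
  then have pF: "pos (?A \<times> ?B \<times> ?F) \<kappa>"
    by (rule iffD2[OF pos_cong, rotated]) (subst \<kappa>F, auto)
  have eq: "?A \<times> ?B \<times> {..<m + n} = ?A \<times> ?B \<times> ?E \<union> ?A \<times> ?B \<times> ?F" unfolding EF(1) by blast
  have "pos (?A \<times> ?B \<times> {..<m + n}) \<kappa>"
    unfolding eq by (rule pos_union[OF _ _ _ pE pF]) (use z in auto)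
  then have "pos (?A \<times> ?B \<times> {..<m + n}) (ker3 b (m + n) W)"
    unfolding W_def by (intro iffD2[OF pos_cong[OF ker3_of_ker3]])
  then have W: "psd (a * b * (m + n)) W" by (intro psd_ker3I) (simp_all add: W_def)
  have "cond_mutual_info a b (m + n) W = cmi ?A ?B (?E \<union> ?F) \<kappa>"
    unfolding cond_mutual_info_eq_cmi[OF W] EF(1)[symmetric] unfolding W_def by (rule cmi_cong) (rule ker3_of_ker3)
  also have "\<dots> = cmi ?A ?B ?E \<kappa> + cmi ?A ?B ?F \<kappa>"
    by (rule cmi_union[OF _ _ _ _ EF(2) pE pF]) (auto simp: \<kappa>_def)
  also have "cmi ?A ?B ?E \<kappa> = cond_mutual_info a b m \<omega>"
    unfolding cond_mutual_info_eq_cmi[OF w(1)] by (rule cmi_cong) (rule \<kappa>E)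
  also have "cmi ?A ?B ?F \<kappa> = cmi ?A ?B ?F (\<lambda>(x, y, e) (x', y', e'). ker3 b n \<omega>' (x, y, e - m) (x', y', e' - m))"
    by (rule cmi_cong) (rule \<kappa>F)
  also have "\<dots> = cond_mutual_info a b n \<omega>'"
    unfolding cond_mutual_info_eq_cmi[OF w'(1)]
    by (rule cmi_reindex[OF _ _ _ f psd_ker3[OF w'(1)]]) auto
  finally have c: "cond_mutual_info a b (m + n) W \<le> c + c'" using w(3) w'(3) by simp
  have "ptrace (a * b) (m + n) 1 W = R + R'"
  proof (rule mat_eq_pairI[of _ a b])
    have R: "R \<in> carrier_mat (a * b) (a * b)" "R' \<in> carrier_mat (a * b) (a * b)"
      using assms by (auto dest: has_extension_carrier)
    show "ptrace (a * b) (m + n) 1 W \<in> carrier_mat (a * b) (a * b)" using ptrace_carrier[of "a * b" "m + n" 1] by simp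
    show "R + R' \<in> carrier_mat (a * b) (a * b)" using R by simp
    fix x y x' y' assume l: "x < a" "y < b" "x' < a" "y' < b"
    have "ptrace (a * b) (m + n) 1 W $$ (x * b + y, x' * b + y') = (\<Sum>e\<in>?E \<union> ?F. \<kappa> (x, y, e) (x', y', e))"
      unfolding ptrace_last_index[OF l] W_def EF(1)[symmetric]
      by (rule sum.cong[OF refl], rule ker3_of_ker3) (use l in auto)
    also have "\<dots> = (\<Sum>e\<in>?E. \<kappa> (x, y, e) (x', y', e)) + (\<Sum>e\<in>?F. \<kappa> (x, y, e) (x', y', e))"
      by (rule sum.union_disjoint) auto
    also have "(\<Sum>e\<in>?E. \<kappa> (x, y, e) (x', y', e)) = R $$ (x * b + y, x' * b + y')"
      unfolding w(2)[symmetric] ptrace_last_index[OF l] by (rule sum.cong) (auto simp: \<kappa>_def)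
    also have "(\<Sum>e\<in>?F. \<kappa> (x, y, e) (x', y', e)) = R' $$ (x * b + y, x' * b + y')"
      unfolding w'(2)[symmetric] ptrace_last_index[OF l]
        sum.reindex_bij_betw[OF f, of "\<lambda>e. ker3 b n \<omega>' (x, y, e) (x', y', e)", symmetric]
      by (rule sum.cong) (auto simp: \<kappa>_def)
    finally show "ptrace (a * b) (m + n) 1 W $$ (x * b + y, x' * b + y') = (R + R') $$ (x * b + y, x' * b + y')"
      using R l by (simp add: pair_less)
  qed
  then show ?thesis using W c by (intro has_extensionI)
qed

lemma has_extension_scale:
  assumes "has_extension a b R c" and t: "0 \<le> t"
  shows "has_extension a b (complex_of_real t \<cdot>\<^sub>m R) (t * c)"
proof -
  obtain m \<omega> where w: "psd (a * b * m) \<omega>" "ptrace (a * b) m 1 \<omega> = R" "cond_mutual_info a b m \<omega> \<le> c"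
    using assms(1) unfolding has_extension_def by blast
  let ?W = "complex_of_real t \<cdot>\<^sub>m \<omega>"
  note C = psd_carrier[OF w(1)]
  have k: "ker3 b m ?W u v = complex_of_real t * ker3 b m \<omega> u v"
    if "u \<in> {..<a} \<times> {..<b} \<times> {..<m}" "v \<in> {..<a} \<times> {..<b} \<times> {..<m}" for u v
    using that C by (auto simp: tidx_less)
  have W: "psd (a * b * m) ?W"
  proof (rule psd_ker3I)
    show "pos ({..<a} \<times> {..<b} \<times> {..<m}) (ker3 b m ?W)"
      by (rule iffD2[OF pos_cong[OF k] pos_scale[OF psd_ker3[OF w(1)] t]])
  qed (use C in simp)
  have "cond_mutual_info a b m ?W = t * cond_mutual_info a b m \<omega>"
    unfolding cond_mutual_info_eq_cmi[OF W] cond_mutual_info_eq_cmi[OF w(1)]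
    by (subst cmi_cong[OF k]) (auto intro: cmi_scale psd_ker3 w(1) t)
  also have "\<dots> \<le> t * c" using w(3) t by (rule mult_left_mono)
  finally have c: "cond_mutual_info a b m ?W \<le> t * c" .
  have "ptrace (a * b) m 1 ?W = complex_of_real t \<cdot>\<^sub>m R"
  proof (rule mat_eq_pairI[of _ a b])
    have R: "R \<in> carrier_mat (a * b) (a * b)" using assms by (auto dest: has_extension_carrier)
    show "ptrace (a * b) m 1 ?W \<in> carrier_mat (a * b) (a * b)" using ptrace_carrier[of "a * b" m 1] by simp
    show "complex_of_real t \<cdot>\<^sub>m R \<in> carrier_mat (a * b) (a * b)" using R by simp
    fix x y x' y' assume l: "x < a" "y < b" "x' < a" "y' < b"
    have "ptrace (a * b) m 1 ?W $$ (x * b + y, x' * b + y') = (\<Sum>e<m. complex_of_real t * ker3 b m \<omega> (x, y, e) (x', y', e))"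
      unfolding ptrace_last_index[OF l] by (rule sum.cong[OF refl], rule k) (use l in auto)
    also have "\<dots> = complex_of_real t * R $$ (x * b + y, x' * b + y')"
      unfolding w(2)[symmetric] ptrace_last_index[OF l] by (simp add: sum_distrib_left)
    finally show "ptrace (a * b) m 1 ?W $$ (x * b + y, x' * b + y') = (complex_of_real t \<cdot>\<^sub>m R) $$ (x * b + y, x' * b + y')"
      using R l by (simp add: pair_less)
  qed
  then show ?thesis using W c by (intro has_extensionI)
qed

text \<open>An environment of dimension 0 extends the zero operator; this starts the induction for
  finite sums.\<close>

lemma has_extension_zero: "has_extension a b (0\<^sub>m (a * b) (a * b)) 0"
proof (rule has_extensionI)
  show p: "psd (a * b * 0) (mat 0 0 (\<lambda>_. 0))"
    by (rule psd_ker3I) (auto simp: pos_def ip_def)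
  show "ptrace (a * b) 0 1 (mat 0 0 (\<lambda>_. 0)) = 0\<^sub>m (a * b) (a * b)"
    unfolding ptrace_def by (intro eq_matI) auto
  show "cond_mutual_info a b 0 (mat 0 0 (\<lambda>_. 0)) \<le> 0"
    unfolding cond_mutual_info_eq_cmi[OF p] cmi_def by (simp add: ent_def)
qed

lemma has_extension_msum:
  assumes "\<And>k. k < K \<Longrightarrow> has_extension a b (F k) (c k)"
  shows "has_extension a b (msum (a * b) K F) (\<Sum>k<K. c k)"
  using assms
proof (induction K)
  case 0
  have "msum (a * b) 0 F = 0\<^sub>m (a * b) (a * b)" unfolding msum_def by (rule eq_matI) auto
  then show ?case using has_extension_zero[of a b] by simp
next
  case (Suc K)
  have "has_extension a b (msum (a * b) K F + F K) ((\<Sum>k<K. c k) + c K)"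
    using Suc by (intro has_extension_add) auto
  moreover have "msum (a * b) (Suc K) F = msum (a * b) K F + F K"
    using has_extension_carrier[OF Suc.prems[of K]] unfolding msum_def by (intro eq_matI) auto
  ultimately show ?case by simp
qed

text \<open>Along a branch the dimension of the environment is fixed; environments grow only when
  branches are put together. The operator is arbitrary in the induction because branch operators
  have the outcome probability as trace, and the total trace is carried along because a normalised
  extension is wanted in the end.\<close>

theorem locc_extension:
  assumes "locc dA dB dA' dB' \<Lambda>" "psd (dA * dB * dE) \<omega>"
  shows "has_extension dA' dB' (\<Lambda> (ptrace (dA * dB) dE 1 \<omega>)) (cond_mutual_info dA dB dE \<omega>) \<and>
    mtrace (\<Lambda> (ptrace (dA * dB) dE 1 \<omega>)) = mtrace \<omega>"
  using assms
proof (induction arbitrary: \<omega> rule: locc.induct)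
  case (stop dA dB)
  then show ?case using has_extensionI[OF stop refl order_refl] mtrace_ptrace[OF psd_carrier[OF stop]] by simp
next
  case (Alice dA d K \<E> dB dA' dB' L)
  let ?\<omega> = "\<lambda>k. tensor_map 1 dA d (dB * dE) (\<E> k) \<omega>"
  let ?F = "\<lambda>k. L k (tensor_map 1 dA d dB (\<E> k) (ptrace (dA * dB) dE 1 \<omega>))"
  note i = instrument_first[OF Alice.hyps(1) Alice.prems]
  \<comment> \<open>The partial trace over E commutes with Alice's operation, so the induction
    hypothesis for the branch extension speaks about the branch of the reduced operator.\<close>
  have e: "has_extension dA' dB' (?F k) (cond_mutual_info d dB dE (?\<omega> k))" "mtrace (?F k) = mtrace (?\<omega> k)"
    if "k < K" for k
    using Alice.IH[OF that i(1)[OF that]] unfolding i(2)[OF that] by auto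
  have "has_extension dA' dB' (msum (dA' * dB') K ?F) (\<Sum>k<K. cond_mutual_info d dB dE (?\<omega> k))"
    by (rule has_extension_msum[OF e(1)])
  moreover have "mtrace (msum (dA' * dB') K ?F) = mtrace \<omega>"
    using mtrace_msum[of K ?F "dA' * dB'"] has_extension_carrier[OF e(1)] e(2) i(3) by simp
  ultimately show ?case using has_extension_mono[OF _ i(4)] by simp
next
  case (Bob dB d K \<E> dA dA' dB' L)
  let ?\<omega> = "\<lambda>k. tensor_map dA dB d dE (\<E> k) \<omega>"
  let ?F = "\<lambda>k. L k (tensor_map dA dB d 1 (\<E> k) (ptrace (dA * dB) dE 1 \<omega>))"
  note i = instrument_middle[OF Bob.hyps(1) Bob.prems]
  have e: "has_extension dA' dB' (?F k) (cond_mutual_info dA d dE (?\<omega> k))" "mtrace (?F k) = mtrace (?\<omega> k)"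
    if "k < K" for k
    using Bob.IH[OF that i(1)[OF that]] unfolding i(2)[OF that] by auto
  have "has_extension dA' dB' (msum (dA' * dB') K ?F) (\<Sum>k<K. cond_mutual_info dA d dE (?\<omega> k))"
    by (rule has_extension_msum[OF e(1)])
  moreover have "mtrace (msum (dA' * dB') K ?F) = mtrace \<omega>"
    using mtrace_msum[of K ?F "dA' * dB'"] has_extension_carrier[OF e(1)] e(2) i(3) by simp
  ultimately show ?case using has_extension_mono[OF _ i(4)] by simp
qed

section \<open>Passage to the infimum\<close>

lemma cond_mutual_info_nonneg: "psd (dA * dB * dE) \<omega> \<Longrightarrow> 0 \<le> cond_mutual_info dA dB dE \<omega>"
  unfolding cond_mutual_info_eq_cmi by (rule cmi_nonneg) (auto intro: psd_ker3)

lemma squashed_le: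
  assumes "has_extension a b R c" "mtrace R = 1"
  shows "squashed_entanglement a b R \<le> c / 2"
proof -
  obtain m \<omega> where w: "psd (a * b * m) \<omega>" "ptrace (a * b) m 1 \<omega> = R" "cond_mutual_info a b m \<omega> \<le> c"
    using assms(1) unfolding has_extension_def by blast
  have "mtrace \<omega> = 1" using mtrace_ptrace[OF psd_carrier[OF w(1)]] w(2) assms(2) by simp
  then have "cond_mutual_info a b m \<omega> / 2 \<in> {cond_mutual_info a b dE \<omega> / 2 | dE \<omega>.
      state (a * b * dE) \<omega> \<and> ptrace (a * b) dE 1 \<omega> = R}"
    using w unfolding state_def by blast
  \<comment> \<open>An infimum of reals is a lower bound of its set only when the set is bounded
    below; strong subadditivity provides the bound 0.\<close>
  moreover have "bdd_below {cond_mutual_info a b dE \<omega> / 2 | dE \<omega>.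
      state (a * b * dE) \<omega> \<and> ptrace (a * b) dE 1 \<omega> = R}"
    by (rule bdd_belowI[of _ 0]) (auto simp: state_def dest: cond_mutual_info_nonneg)
  ultimately have "squashed_entanglement a b R \<le> cond_mutual_info a b m \<omega> / 2"
    unfolding squashed_entanglement_def by (rule cInf_lower)
  then show ?thesis using w(3) by simp
qed

lemma squashed_approx:
  assumes "state (a * b) \<rho>" "0 < \<epsilon>"
  obtains m \<omega> where "psd (a * b * m) \<omega>" "ptrace (a * b) m 1 \<omega> = \<rho>" "mtrace \<omega> = 1"
    "cond_mutual_info a b m \<omega> / 2 < squashed_entanglement a b \<rho> + \<epsilon>"
proof -
  let ?X = "{cond_mutual_info a b dE \<omega> / 2 | dE \<omega>. state (a * b * dE) \<omega> \<and> ptrace (a * b) dE 1 \<omega> = \<rho>}"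
  \<comment> \<open>The state is its own extension by a one-dimensional environment, so the infimum
    is over a nonempty set.\<close>
  have "ptrace (a * b) 1 1 \<rho> = \<rho>"
    using assms(1) unfolding ptrace_def state_def psd_def by (intro eq_matI) (auto simp: tidx_def)
  then have "cond_mutual_info a b 1 \<rho> / 2 \<in> ?X" using assms(1) by (intro CollectI exI[of _ 1] exI[of _ \<rho>]) simp
  then have "?X \<noteq> {}" by blast
  from cInf_lessD[OF this, of "squashed_entanglement a b \<rho> + \<epsilon>"] assms(2)
  obtain x where "x \<in> ?X" "x < squashed_entanglement a b \<rho> + \<epsilon>"
    unfolding squashed_entanglement_def by auto
  then show ?thesis using that unfolding state_def by blast
qed

theorem proposition3:
  shows "(\<forall>dA dB dA' dB' \<rho> \<Lambda>.
            state (dA * dB) \<rho> \<longrightarrow> locc dA dB dA' dB' \<Lambda> \<longrightarrow>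
            squashed_entanglement dA' dB' (\<Lambda> \<rho>) \<le> squashed_entanglement dA dB \<rho>) \<and>
         (\<forall>dA dB \<rho> \<sigma> (t :: real).
            state (dA * dB) \<rho> \<longrightarrow> state (dA * dB) \<sigma> \<longrightarrow> 0 \<le> t \<longrightarrow> t \<le> 1 \<longrightarrow>
            squashed_entanglement dA dB
              (complex_of_real t \<cdot>\<^sub>m \<rho> + complex_of_real (1 - t) \<cdot>\<^sub>m \<sigma>)
            \<le> t * squashed_entanglement dA dB \<rho> + (1 - t) * squashed_entanglement dA dB \<sigma>)"
proof (intro conjI allI impI)
  fix dA dB dA' dB' \<rho> \<Lambda>
  assume \<rho>: "state (dA * dB) \<rho>" and \<Lambda>: "locc dA dB dA' dB' \<Lambda>"
  show "squashed_entanglement dA' dB' (\<Lambda> \<rho>) \<le> squashed_entanglement dA dB \<rho>"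
  \<comment> \<open>The infimum is not known to be attained, so an extension within \<epsilon> of it
    is used.\<close>
  proof (rule field_le_epsilon)
    fix \<epsilon> :: real assume "0 < \<epsilon>"
    then obtain m \<omega> where w: "psd (dA * dB * m) \<omega>" "ptrace (dA * dB) m 1 \<omega> = \<rho>" "mtrace \<omega> = 1"
      "cond_mutual_info dA dB m \<omega> / 2 < squashed_entanglement dA dB \<rho> + \<epsilon>"
      using squashed_approx[OF \<rho>] by blast
    show "squashed_entanglement dA' dB' (\<Lambda> \<rho>) \<le> squashed_entanglement dA dB \<rho> + \<epsilon>"
      using squashed_le[of dA' dB' "\<Lambda> \<rho>" "cond_mutual_info dA dB m \<omega>"] locc_extension[OF \<Lambda> w(1)] w(2-4)
      by simp
  qed
next
  fix dA dB \<rho> \<sigma> and t :: real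
  assume \<rho>: "state (dA * dB) \<rho>" and \<sigma>: "state (dA * dB) \<sigma>" and t: "0 \<le> t" "t \<le> 1"
  let ?\<tau> = "complex_of_real t \<cdot>\<^sub>m \<rho> + complex_of_real (1 - t) \<cdot>\<^sub>m \<sigma>"
  have C: "\<rho> \<in> carrier_mat (dA * dB) (dA * dB)" "\<sigma> \<in> carrier_mat (dA * dB) (dA * dB)"
    using \<rho> \<sigma> unfolding state_def psd_def by auto
  have "mtrace ?\<tau> = complex_of_real t * mtrace \<rho> + complex_of_real (1 - t) * mtrace \<sigma>"
    unfolding mtrace_def using C by (auto simp: sum.distrib sum_distrib_left)
  then have tr: "mtrace ?\<tau> = 1" using \<rho> \<sigma> unfolding state_def by simp
  let ?E = "squashed_entanglement dA dB"
  show "?E ?\<tau> \<le> t * ?E \<rho> + (1 - t) * ?E \<sigma>"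
  proof (rule field_le_epsilon)
    fix \<epsilon> :: real assume \<epsilon>: "0 < \<epsilon>"
    obtain m \<omega> where w: "psd (dA * dB * m) \<omega>" "ptrace (dA * dB) m 1 \<omega> = \<rho>"
      "cond_mutual_info dA dB m \<omega> / 2 < ?E \<rho> + \<epsilon>" by (rule squashed_approx[OF \<rho> \<epsilon>])
    obtain n \<omega>' where w': "psd (dA * dB * n) \<omega>'" "ptrace (dA * dB) n 1 \<omega>' = \<sigma>"
      "cond_mutual_info dA dB n \<omega>' / 2 < ?E \<sigma> + \<epsilon>" by (rule squashed_approx[OF \<sigma> \<epsilon>])
    let ?c = "cond_mutual_info dA dB m \<omega>" and ?c' = "cond_mutual_info dA dB n \<omega>'"
    \<comment> \<open>The two near-optimal extensions with weights t and 1 - t, placed in the direct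
      sum of their environments; as the weights add up to 1, the total error is \<epsilon>.\<close>
    have "has_extension dA dB ?\<tau> (t * ?c + (1 - t) * ?c')"
      using t by (intro has_extension_add has_extension_scale has_extensionI[OF w(1,2)] has_extensionI[OF w'(1,2)]) auto
    from squashed_le[OF this tr] have "?E ?\<tau> \<le> t * (?c / 2) + (1 - t) * (?c' / 2)"
      by (simp add: add_divide_distrib)
    also have "\<dots> \<le> t * (?E \<rho> + \<epsilon>) + (1 - t) * (?E \<sigma> + \<epsilon>)"
      using t w(3) w'(3) by (intro add_mono mult_left_mono) auto
    finally show "?E ?\<tau> \<le> t * ?E \<rho> + (1 - t) * ?E \<sigma> + \<epsilon>" by (simp add: algebra_simps)
  qed
qed

end
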